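(* Let $f_{\tau}$ be the density of the distribution of the trace function $\tau(m)=\mathrm{Trace}\, m$ on $G=\mathrm{USp}_4$. If $x\in\mathbb{R}$ and $0<|x|<4$, then $$f_{\tau}(x)=\frac{6}{\pi}\,G\left(\frac{x^{2}}{16}\right),\qquad G(z)=G^{2,0}_{2,2}\left(z\,\middle|\,\begin{matrix}\frac52,&\frac72\\ 0,&1\end{matrix}\right)\quad(0<z<1),$$ a Meijer $G$-function, and for $0<z<1$ $$G(z)=\frac{1}{2i\pi}\int_{\mathrm{Re}\, s=c}\frac{\Gamma(s)\Gamma(s+1)}{\Gamma\left(s+\frac52\right)\Gamma\left(s+\frac72\right)}\,z^{-s}\,ds$$ for any $c$ with $0<c<\frac12$.
   Context: $\mathrm{USp}_{4}=\{m\in \mathrm{GL}_{4}(\mathbb{C}) : {}^t m J m=J,\ {}^t m\,\bar m=I_{4}\}$ with $J=\begin{pmatrix}0&I_2\\ -I_2&0\end{pmatrix}$, equipped with the Haar measure $dm$ of total mass $1$. The trace $\tau(m)=\mathrm{Trace}\, m$ is real with values in $[-4,4]$; its distribution is the image of $dm$ under $\tau$, and $f_\tau$ denotes the continuous density of this distribution: $\int_G\varphi(\tau(m))\,dm=\int_{-4}^{4}\varphi(x)f_\tau(x)\,dx$ for every continuous $\varphi$ on $[-4,4]$. The Meijer $G$-function is defined, for $0<|z|<1$, by $$G^{m,n}_{p,q}\left(z\,\middle|\,\begin{matrix}a_1,\dots,a_p\\ b_1,\dots,b_q\end{matrix}\right)=\frac{1}{2i\pi}\int_C\frac{\prod_{k=1}^m\Gamma(s+b_k)}{\prod_{k=n+1}^p\Gamma(s+a_k)}\cdot\frac{\prod_{k=1}^n\Gamma(-s-a_k+1)}{\prod_{k=m+1}^q\Gamma(-s-b_k+1)}\,z^{-s}\,ds,$$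 where $C$ is a Mellin–Barnes contour separating the poles of the $\Gamma(s+b_k)$, $k\le m$ (on its left) from those of the $\Gamma(1-s-a_k)$, $k\le n$ (on its right); vertical lines are oriented upwards. *)

theory Defs
  imports "HOL-Probability.Probability"
begin

definition cnj_matrix :: "complex^'n^'m \<Rightarrow> complex^'n^'m" where
  "cnj_matrix A = (\<chi> i j. cnj (A $ i $ j))"

definition J4 :: "complex^4^4" where
  "J4 = vector [vector [ 0,  0, 1, 0],
                vector [ 0,  0, 0, 1],
                vector [-1,  0, 0, 0],
                vector [ 0, -1, 0, 0]]"

definition USp4 :: "(complex^4^4) set" where
  "USp4 = {m. invertible m \<and> transpose m ** J4 ** m = J4 \<and> transpose m ** cnj_matrix m = mat 1}"

text \<open>
  The Haar measure of total mass 1 of a compact matrix group \<open>G\<close>, as a left-invariant Borel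
  probability measure on \<open>G\<close>.
\<close>

definition normalized_haar_measure :: "(complex^'n^'n) set \<Rightarrow> (complex^'n^'n) measure \<Rightarrow> bool" where
  "normalized_haar_measure G M \<longleftrightarrow>
     prob_space M \<and> sets M = sets (restrict_space borel G) \<and>
     (\<forall>g\<in>G. distr M M (\<lambda>m. g ** m) = M)"

text \<open>On \<open>USp4\<close> the trace is real, see \<open>of_real_tau\<close> below, so that taking the real part
  is only a change of type.\<close>

definition tau :: "complex^4^4 \<Rightarrow> real" where
  "tau m = Re (trace m)"

definition continuous_trace_density :: "(complex^4^4) measure \<Rightarrow> (real \<Rightarrow> real) \<Rightarrow> bool" where
  "continuous_trace_density dm f \<longleftrightarrow>
     continuous_on {-4..4} f \<and>
     (\<forall>\<phi>::real \<Rightarrow> real. continuous_on {-4..4} \<phi> \<longrightarrow>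
        (LINT m|dm. \<phi> (tau m)) = (LBINT x:{-4..4}. \<phi> x * f x))"

lemma vector_4:
  fixes x y z w :: "'a::zero"
  shows "(vector [x, y, z, w] :: 'a^4) $ 1 = x" "(vector [x, y, z, w] :: 'a^4) $ 2 = y"
    "(vector [x, y, z, w] :: 'a^4) $ 3 = z" "(vector [x, y, z, w] :: 'a^4) $ 4 = w"
  by (simp_all add: vector_def)

lemma cnj_matrix_USp4:
  assumes "m \<in> USp4"
  shows "cnj_matrix m = J4 ** m ** (- J4)"
proof -
  have J: "transpose m ** J4 ** m = J4" and U: "transpose m ** cnj_matrix m = mat 1"
    using assms by (auto simp: USp4_def)
  have U': "cnj_matrix m ** transpose m = mat 1"
    using U by (simp add: matrix_left_right_inverse)
  have "cnj_matrix m ** J4 = cnj_matrix m ** (transpose m ** J4 ** m)"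
    by (simp add: J)
  also have "\<dots> = (cnj_matrix m ** transpose m) ** J4 ** m"
    by (simp add: matrix_mul_assoc)
  finally have JJ: "cnj_matrix m ** J4 = J4 ** m"
    by (simp add: U')
  have JN: "J4 ** (- J4) = mat 1"
    by (simp add: vec_eq_iff matrix_matrix_mult_def J4_def forall_4 sum_4 vector_4 mat_def)
  have "cnj_matrix m ** (J4 ** (- J4)) = J4 ** m ** (- J4)"
    by (simp only: matrix_mul_assoc JJ)
  then show ?thesis by (simp add: JN)
qed

lemma of_real_tau:
  assumes "m \<in> USp4"
  shows "of_real (tau m) = trace m"
proof -
  have NJ: "(- J4) ** J4 = mat 1"
    by (simp add: vec_eq_iff matrix_matrix_mult_def J4_def forall_4 sum_4 vector_4 mat_def)
  have "cnj (trace m) = trace (cnj_matrix m)"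
    by (simp add: trace_def cnj_matrix_def)
  also have "\<dots> = trace ((- J4) ** (J4 ** m))"
    by (metis cnj_matrix_USp4[OF assms] trace_mul_sym)
  also have "\<dots> = trace m"
    by (simp only: matrix_mul_assoc NJ matrix_mul_lid)
  finally have "trace m \<in> \<real>"
    by (simp add: Reals_cnj_iff)
  then show ?thesis
    by (simp add: tau_def)
qed

lemma tau_bounds:
  assumes "m \<in> USp4"
  shows "tau m \<in> {-4..4}"
proof -
  have le1: "cmod (m $ i $ i) \<le> 1" for i
  proof -
    have "(transpose m ** cnj_matrix m) $ i $ i = 1"
      using assms by (simp add: USp4_def mat_def)
    then have "(\<Sum>k\<in>UNIV. m $ k $ i * cnj (m $ k $ i)) = 1"
      by (simp add: matrix_matrix_mult_def transpose_def cnj_matrix_def)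
    then have "of_real (\<Sum>k\<in>UNIV. (cmod (m $ k $ i))\<^sup>2) = (1::complex)"
      by (simp add: complex_norm_square[symmetric])
    then have "(\<Sum>k\<in>UNIV. (cmod (m $ k $ i))\<^sup>2) = 1"
      using of_real_eq_1_iff by blast
    moreover have "(cmod (m $ i $ i))\<^sup>2 \<le> (\<Sum>k\<in>UNIV. (cmod (m $ k $ i))\<^sup>2)"
      by (rule member_le_sum) auto
    ultimately show ?thesis
      by (metis abs_norm_cancel abs_square_le_1)
  qed
  have "cmod (trace m) \<le> (\<Sum>i\<in>(UNIV::4 set). 1)"
    unfolding trace_def by (rule sum_norm_le) (simp add: le1)
  then have "\<bar>tau m\<bar> \<le> 4"
    using abs_Re_le_cmod[of "trace m"] by (simp add: tau_def)
  then show ?thesis by auto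
qed

text \<open>
  A contour is parametrised by the whole real line. The Henstock--Kurzweil integral over \<open>UNIV\<close>
  subsumes conditionally convergent improper integrals.
\<close>

definition has_line_integral ::
    "(complex \<Rightarrow> complex) \<Rightarrow> complex \<Rightarrow> (real \<Rightarrow> complex) \<Rightarrow> bool" where
  "has_line_integral F w \<gamma> \<longleftrightarrow>
     ((\<lambda>t. F (\<gamma> t) * vector_derivative \<gamma> (at t)) has_integral w) UNIV"

definition line_integrable :: "(complex \<Rightarrow> complex) \<Rightarrow> (real \<Rightarrow> complex) \<Rightarrow> bool" where
  "line_integrable F \<gamma> \<longleftrightarrow> (\<exists>w. has_line_integral F w \<gamma>)"

definition line_integral :: "(complex \<Rightarrow> complex) \<Rightarrow> (real \<Rightarrow> complex) \<Rightarrow> complex" where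
  "line_integral F \<gamma> = integral UNIV (\<lambda>t. F (\<gamma> t) * vector_derivative \<gamma> (at t))"

definition vertical_line :: "real \<Rightarrow> real \<Rightarrow> complex" where
  "vertical_line c t = Complex c t"

text \<open>
  The parameters \<open>a\<^sub>1, \<dots>, a\<^sub>p\<close> and \<open>b\<^sub>1, \<dots>, b\<^sub>q\<close> are the lists \<open>as\<close> and \<open>bs\<close>, indexed from 0.
  Since \<open>Gamma\<close> vanishes by convention at its poles and \<open>x / 0 = 0\<close>, the quotient takes the correct
  value 0 where a denominator factor has a pole and the numerator has none.
\<close>

definition meijer_integrand ::
    "nat \<Rightarrow> nat \<Rightarrow> complex list \<Rightarrow> complex list \<Rightarrow> complex \<Rightarrow> complex \<Rightarrow> complex" where
  "meijer_integrand m n as bs z s =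
     (\<Prod>k<m. Gamma (s + bs ! k)) / (\<Prod>k=n..<length as. Gamma (s + as ! k)) *
     ((\<Prod>k<n. Gamma (- s - as ! k + 1)) / (\<Prod>k=m..<length bs. Gamma (- s - bs ! k + 1))) *
     z powr (- s)"

text \<open>
  For a simple curve running from \<open>-\<i>\<infinity>\<close> to \<open>\<i>\<infinity>\<close> with vertical ends, its left (right) side is
  the component of its complement containing all reals that are close to \<open>-\<infinity>\<close> (to \<open>\<infinity>\<close>).
\<close>

definition left_of :: "(real \<Rightarrow> complex) \<Rightarrow> complex set" where
  "left_of \<gamma> = {s. \<forall>\<^sub>F r in at_top. connected_component (- range \<gamma>) s (of_real (- r))}"

definition right_of :: "(real \<Rightarrow> complex) \<Rightarrow> complex set" where
  "right_of \<gamma> = {s. \<forall>\<^sub>F r in at_top. connected_component (- range \<gamma>) s (of_real r)}"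

lemma range_vertical_line: "range (vertical_line c) = {s. Re s = c}"
  by (auto simp: vertical_line_def image_iff complex_eq_iff)

lemma convex_same_component:
  fixes S :: "complex set"
  assumes "convex S" "S \<subseteq> - A" "x \<in> S" "y \<in> S"
  shows "connected_component (- A) x y"
  using assms unfolding connected_component_def by (meson convex_connected)

lemma left_of_vertical_line: "left_of (vertical_line c) = {s. Re s < c}"
proof (intro equalityI subsetI)
  fix s assume "s \<in> left_of (vertical_line c)"
  then have "\<forall>\<^sub>F r in at_top. connected_component (- range (vertical_line c)) s (of_real (- r))"
    by (simp add: left_of_def)
  then have "\<forall>\<^sub>F r in at_top. connected_component (- range (vertical_line c)) s (of_real (- r)) \<and> r > - c"
    by (intro eventually_conj eventually_gt_at_top)
  then obtain r where r: "connected_component (- range (vertical_line c)) s (of_real (- r))" "r > - c"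
    using eventually_happens trivial_limit_at_top_linorder by blast
  then obtain T where T: "connected T" "T \<subseteq> - range (vertical_line c)" "s \<in> T" "of_real (- r) \<in> T"
    unfolding connected_component_def by blast
  show "s \<in> {s. Re s < c}"
  proof (rule ccontr)
    assume "s \<notin> {s. Re s < c}"
    then have "\<exists>u\<in>T. u \<bullet> 1 = c"
      using T r connected_ivt_hyperplane[of T "of_real (- r)" s 1 c] by (auto simp: inner_complex_def)
    then show False
      using T by (auto simp: range_vertical_line inner_complex_def)
  qed
next
  fix s assume s: "s \<in> {s. Re s < c}"
  show "s \<in> left_of (vertical_line c)"
    unfolding left_of_def mem_Collect_eq using eventually_gt_at_top[of "- c"]
  proof eventually_elim
    case (elim r)
    show ?case
      by (rule convex_same_component[of "{s. Re s < c}"])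
         (use s elim in \<open>auto simp: convex_halfspace_Re_lt range_vertical_line\<close>)
  qed
qed

text \<open>
  A Mellin--Barnes contour is a vertical line, oriented upwards, that may be deformed along a bounded
  part in order to separate the two families of poles.
\<close>

definition mellin_barnes_contour ::
    "nat \<Rightarrow> nat \<Rightarrow> complex list \<Rightarrow> complex list \<Rightarrow> (real \<Rightarrow> complex) \<Rightarrow> bool" where
  "mellin_barnes_contour m n as bs \<gamma> \<longleftrightarrow>
     inj \<gamma> \<and>
     (\<exists>c R. \<gamma> piecewise_C1_differentiable_on {-R..R} \<and> (\<forall>t. \<bar>t\<bar> \<ge> R \<longrightarrow> \<gamma> t = vertical_line c t)) \<and>
     (\<forall>k<m. \<forall>s. s + bs ! k \<in> \<int>\<^sub>\<le>\<^sub>0 \<longrightarrow> s \<in> left_of \<gamma>) \<and>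
     (\<forall>k<n. \<forall>s. 1 - s - as ! k \<in> \<int>\<^sub>\<le>\<^sub>0 \<longrightarrow> s \<in> right_of \<gamma>)"

lemma mellin_barnes_contour_vertical_line:
  assumes "\<And>k. k < m \<Longrightarrow> - Re (bs ! k) < c"
  shows "mellin_barnes_contour m 0 as bs (vertical_line c)"
  unfolding mellin_barnes_contour_def
proof (intro conjI)
  show "inj (vertical_line c)"
    by (simp add: inj_def vertical_line_def)
  show "\<exists>c' R. vertical_line c piecewise_C1_differentiable_on {-R..R} \<and>
          (\<forall>t. \<bar>t\<bar> \<ge> R \<longrightarrow> vertical_line c t = vertical_line c' t)"
    by (intro exI[of _ c] exI[of _ "-1"])
       (auto simp: piecewise_C1_differentiable_on_def)
  show "\<forall>k<m. \<forall>s. s + bs ! k \<in> \<int>\<^sub>\<le>\<^sub>0 \<longrightarrow> s \<in> left_of (vertical_line c)"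
  proof (intro allI impI)
    fix k s assume k: "k < m" and "s + bs ! k \<in> \<int>\<^sub>\<le>\<^sub>0"
    then obtain n where "s + bs ! k = - of_nat n"
      by (elim nonpos_Ints_cases')
    then have "Re s + Re (bs ! k) \<le> 0"
      by (metis Re_complex_of_real neg_le_0_iff_le of_nat_0_le_iff of_real_minus of_real_of_nat_eq plus_complex.simps(1))
    then show "s \<in> left_of (vertical_line c)"
      using assms[OF k] by (simp add: left_of_vertical_line)
  qed
qed simp

text \<open>
  By Cauchy's theorem the value does not depend on the choice of the contour. Only arguments with
  \<open>0 < norm z < 1\<close> are relevant; \<open>z powr (- s)\<close> is the principal branch.
\<close>

definition meijer_G :: "nat \<Rightarrow> nat \<Rightarrow> complex list \<Rightarrow> complex list \<Rightarrow> complex \<Rightarrow> complex" where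
  "meijer_G m n as bs z =
     (THE w. \<exists>\<gamma> v. mellin_barnes_contour m n as bs \<gamma> \<and>
                  has_line_integral (meijer_integrand m n as bs z) v \<gamma> \<and>
                  w = 1 / (2 * \<i> * of_real pi) * v)"

end

theory Submission
  imports Defs "HOL-Complex_Analysis.Cauchy_Integral_Formula"
begin

text \<open>
  Both sides are determined by their moments. Differentiating the invariance of the Haar measure
  along the one-parameter groups of \<open>USp4\<close> and summing over an orthogonal basis of its Lie algebra
  gives two Schwinger--Dyson equations, which relate the expectations \<open>M\<^sub>a\<close> of \<open>\<tau>\<^sup>a\<close> to those of
  \<open>\<tau>\<^sup>a Trace(m\<^sup>2)\<close>. Eliminating the latter, with Newton's identity for the trace of \<open>m\<^sup>3\<close>, leaves
  \<open>(a + 6) (a + 8) M\<^bsub>a+2\<^esub> = 16 (a + 1) (a + 3) M\<^sub>a\<close>. The same recursion is the functional equation of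
  the quotient \<open>H(s) = \<Gamma>(s) \<Gamma>(s + 1) / (\<Gamma>(s + 5/2) \<Gamma>(s + 7/2))\<close> at \<open>s = (a + 1) / 2\<close>, and \<open>H\<close> is the
  Mellin transform of \<open>G\<close>: exchange the two integrals and apply Cauchy's formula on a half-plane, where
  \<open>H(s)\<close> is \<open>O(\<bar>s\<bar>\<^sup>-\<^sup>2)\<close>. The independence of the contour follows from the global form of Cauchy's
  theorem, after closing the contour by a far vertical line.
\<close>

section \<open>Uniform first-order expansions\<close>

text \<open>What is compared is x f(x) with (6/pi) x G(x^2/16). On the line Re s = 1/4 the integrand
  of G(x^2/16) grows like |x|^(-1/2) at 0; the factor x turns this into 2 sqrt |x|, so continuity at
  0 is immediate. The zeroth moment of f, which equals 1, fixes the constant: 6/pi = 1 / (4 H(1/2)),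
  where H(1/2) = pi/24. The 16 in the recursion is the square of the endpoint 4, whence the argument
  x^2/16, and the pairs (a + 1)(a + 3) and (a + 6)(a + 8) are 4 s (s + 1) and 4 (s + 5/2)(s + 7/2).
  Each test function brings in a new power sum: the first equation contains Tr(m^2), the second also
  Tr(m^3). The system closes there because the third elementary symmetric function of a symplectic 4
  x 4 matrix is its trace. \<open>meijer_G\<close> is a definite description over all admissible
  contours; their integrals may converge only conditionally, and their ends may lie at negative
  abscissa. Each contour is therefore compared, through symmetric truncations, with the lines Re s =
  D for large D.\<close>

definition expands :: "'a set \<Rightarrow> (real \<Rightarrow> 'a \<Rightarrow> complex) \<Rightarrow> ('a \<Rightarrow> complex) \<Rightarrow> bool" where
  "expands S K d \<longleftrightarrow> (\<exists>C. \<forall>m\<in>S. \<forall>t. \<bar>t\<bar> \<le> 1 \<longrightarrow>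
     norm (K t m) \<le> C \<and> norm (d m) \<le> C \<and> norm (K t m - K 0 m - of_real t * d m) \<le> C * t\<^sup>2)"

lemma expandsI:
  assumes "\<And>m t. m \<in> S \<Longrightarrow> \<bar>t\<bar> \<le> 1 \<Longrightarrow> norm (K t m) \<le> C"
    and "\<And>m. m \<in> S \<Longrightarrow> norm (d m) \<le> C"
    and "\<And>m t. m \<in> S \<Longrightarrow> \<bar>t\<bar> \<le> 1 \<Longrightarrow> norm (K t m - K 0 m - of_real t * d m) \<le> C * t\<^sup>2"
  shows "expands S K d"
  unfolding expands_def using assms by blast

lemma expandsE:
  assumes "expands S K d"
  obtains C where "C \<ge> 0" "\<And>m t. m \<in> S \<Longrightarrow> \<bar>t\<bar> \<le> 1 \<Longrightarrow> norm (K t m) \<le> C"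
    "\<And>m. m \<in> S \<Longrightarrow> norm (d m) \<le> C"
    "\<And>m t. m \<in> S \<Longrightarrow> \<bar>t\<bar> \<le> 1 \<Longrightarrow> norm (K t m - K 0 m - of_real t * d m) \<le> C * t\<^sup>2"
proof -
  obtain C where C: "\<forall>m\<in>S. \<forall>t. \<bar>t\<bar> \<le> 1 \<longrightarrow>
     norm (K t m) \<le> C \<and> norm (d m) \<le> C \<and> norm (K t m - K 0 m - of_real t * d m) \<le> C * t\<^sup>2"
    using assms unfolding expands_def by blast
  show thesis
  proof (rule that[of "max C 0"])
    fix m t assume "m \<in> S" "\<bar>t\<bar> \<le> (1::real)"
    then have "norm (K t m - K 0 m - of_real t * d m) \<le> C * t\<^sup>2" using C by blast
    also have "\<dots> \<le> max C 0 * t\<^sup>2" by (intro mult_right_mono) auto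
    finally show "norm (K t m - K 0 m - of_real t * d m) \<le> max C 0 * t\<^sup>2" .
  next
    fix m assume "m \<in> S"
    then have "norm (d m) \<le> C" using C[rule_format, of m 0] by simp
    then show "norm (d m) \<le> max C 0" by simp
  qed (use C in \<open>auto intro: max.coboundedI1\<close>)
qed

lemma expands_const: "expands S (\<lambda>t m. c) (\<lambda>m. 0)"
  by (rule expandsI[of _ _ "norm c"]) auto

lemma expands_add:
  assumes "expands S K d" "expands S K' d'"
  shows "expands S (\<lambda>t m. K t m + K' t m) (\<lambda>m. d m + d' m)"
proof -
  from assms(1) obtain C where C: "C \<ge> 0" "\<And>m t. m \<in> S \<Longrightarrow> \<bar>t\<bar> \<le> 1 \<Longrightarrow> norm (K t m) \<le> C"
    "\<And>m. m \<in> S \<Longrightarrow> norm (d m) \<le> C"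
    "\<And>m t. m \<in> S \<Longrightarrow> \<bar>t\<bar> \<le> 1 \<Longrightarrow> norm (K t m - K 0 m - of_real t * d m) \<le> C * t\<^sup>2"
    by (rule expandsE) blast
  from assms(2) obtain C' where C': "C' \<ge> 0" "\<And>m t. m \<in> S \<Longrightarrow> \<bar>t\<bar> \<le> 1 \<Longrightarrow> norm (K' t m) \<le> C'"
    "\<And>m. m \<in> S \<Longrightarrow> norm (d' m) \<le> C'"
    "\<And>m t. m \<in> S \<Longrightarrow> \<bar>t\<bar> \<le> 1 \<Longrightarrow> norm (K' t m - K' 0 m - of_real t * d' m) \<le> C' * t\<^sup>2"
    by (rule expandsE) blast
  show ?thesis
  proof (rule expandsI[of _ _ "C + C'"])
    fix m t assume m: "m \<in> S" "\<bar>t\<bar> \<le> (1::real)"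
    have "K t m + K' t m - (K 0 m + K' 0 m) - of_real t * (d m + d' m)
        = (K t m - K 0 m - of_real t * d m) + (K' t m - K' 0 m - of_real t * d' m)"
      by (simp add: algebra_simps)
    then show "norm (K t m + K' t m - (K 0 m + K' 0 m) - of_real t * (d m + d' m)) \<le> (C + C') * t\<^sup>2"
      using norm_triangle_mono[OF C(4)[OF m] C'(4)[OF m]] by (simp only: distrib_right)
  qed (use C C' in \<open>auto intro: norm_triangle_mono\<close>)
qed

text \<open>The product rule is the reason why \<open>expands\<close> also bounds \<open>K\<close>
  and \<open>d\<close>: after both expansions are substituted, every remaining term either contains
  a quadratic error times bounded factors or carries t^2 itself. There are four such terms, hence
  \<open>4 * (C * C')\<close>.\<close>

lemma expands_mult:
  assumes "expands S K d" "expands S K' d'"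
  shows "expands S (\<lambda>t m. K t m * K' t m) (\<lambda>m. d m * K' 0 m + K 0 m * d' m)"
proof -
  from assms(1) obtain C where C: "C \<ge> 0" "\<And>m t. m \<in> S \<Longrightarrow> \<bar>t\<bar> \<le> 1 \<Longrightarrow> norm (K t m) \<le> C"
    "\<And>m. m \<in> S \<Longrightarrow> norm (d m) \<le> C"
    "\<And>m t. m \<in> S \<Longrightarrow> \<bar>t\<bar> \<le> 1 \<Longrightarrow> norm (K t m - K 0 m - of_real t * d m) \<le> C * t\<^sup>2"
    by (rule expandsE) blast
  from assms(2) obtain C' where C': "C' \<ge> 0" "\<And>m t. m \<in> S \<Longrightarrow> \<bar>t\<bar> \<le> 1 \<Longrightarrow> norm (K' t m) \<le> C'"
    "\<And>m. m \<in> S \<Longrightarrow> norm (d' m) \<le> C'"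
    "\<And>m t. m \<in> S \<Longrightarrow> \<bar>t\<bar> \<le> 1 \<Longrightarrow> norm (K' t m - K' 0 m - of_real t * d' m) \<le> C' * t\<^sup>2"
    by (rule expandsE) blast
  have CC: "C * C' \<ge> 0" using C C' by simp
  show ?thesis
  proof (rule expandsI[of _ _ "4 * (C * C')"])
    fix m t assume m: "m \<in> S" "\<bar>t\<bar> \<le> (1::real)"
    have "norm (K t m * K' t m) \<le> C * C'"
      unfolding norm_mult using C C' m by (intro mult_mono) auto
    then show "norm (K t m * K' t m) \<le> 4 * (C * C')" using CC by linarith
  next
    fix m assume m: "m \<in> S"
    have "norm (d m * K' 0 m) \<le> C * C'" "norm (K 0 m * d' m) \<le> C * C'"
      unfolding norm_mult using C C' m by (intro mult_mono; force)+
    then show "norm (d m * K' 0 m + K 0 m * d' m) \<le> 4 * (C * C')"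
      using CC norm_triangle_ineq[of "d m * K' 0 m" "K 0 m * d' m"] by linarith
  next
    fix m t assume m: "m \<in> S" "\<bar>t\<bar> \<le> (1::real)"
    define e where "e = K t m - K 0 m - of_real t * d m"
    define e' where "e' = K' t m - K' 0 m - of_real t * d' m"
    have e: "norm e \<le> C * t\<^sup>2" "norm e' \<le> C' * t\<^sup>2"
      using C(4)[OF m] C'(4)[OF m] by (auto simp: e_def e'_def)
    have eq: "K t m * K' t m - K 0 m * K' 0 m - of_real t * (d m * K' 0 m + K 0 m * d' m)
        = e * K' t m + (K 0 m * e' + of_real t * (d m * e') + of_real (t\<^sup>2) * (d m * d' m))"
      by (simp add: e_def e'_def algebra_simps power2_eq_square)
    have K0: "norm (K 0 m) \<le> C" "norm (d m) \<le> C" "norm (d' m) \<le> C'" using C C' m by auto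
    have 1: "norm (e * K' t m) \<le> (C * t\<^sup>2) * C'"
      unfolding norm_mult using e C' m C by (intro mult_mono) auto
    have 2: "norm (K 0 m * e') \<le> C * (C' * t\<^sup>2)"
      unfolding norm_mult using e K0 C by (intro mult_mono) auto
    have "norm (d m * e') \<le> C * (C' * t\<^sup>2)"
      unfolding norm_mult using e K0 C by (intro mult_mono) auto
    then have "\<bar>t\<bar> * norm (d m * e') \<le> 1 * (C * (C' * t\<^sup>2))"
      using m by (intro mult_mono) auto
    then have 3: "norm (of_real t * (d m * e')) \<le> C * (C' * t\<^sup>2)" by (simp add: norm_mult)
    have "norm (d m * d' m) \<le> C * C'"
      unfolding norm_mult using K0 C by (intro mult_mono) auto
    then have "t\<^sup>2 * norm (d m * d' m) \<le> t\<^sup>2 * (C * C')" by (intro mult_left_mono) auto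
    then have 4: "norm (of_real (t\<^sup>2) * (d m * d' m)) \<le> t\<^sup>2 * (C * C')"
      by (simp add: norm_mult norm_power)
    have "norm (e * K' t m + (K 0 m * e' + of_real t * (d m * e') + of_real (t\<^sup>2) * (d m * d' m)))
      \<le> (C * t\<^sup>2) * C' + (C * (C' * t\<^sup>2) + C * (C' * t\<^sup>2) + t\<^sup>2 * (C * C'))"
      by (intro norm_triangle_mono 1 2 3 4)
    then show "norm (K t m * K' t m - K 0 m * K' 0 m - of_real t * (d m * K' 0 m + K 0 m * d' m))
        \<le> 4 * (C * C') * t\<^sup>2"
      unfolding eq by (simp add: algebra_simps)
  qed
qed

lemma expands_sum:
  assumes "finite I" "\<And>i. i \<in> I \<Longrightarrow> expands S (K i) (d i)"
  shows "expands S (\<lambda>t m. \<Sum>i\<in>I. K i t m) (\<lambda>m. \<Sum>i\<in>I. d i m)"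
  using assms
proof (induction I rule: finite_induct)
  case empty
  show ?case by (simp add: expands_const)
next
  case (insert i I)
  then show ?case by (simp add: expands_add)
qed

lemma expands_power:
  assumes "expands S K d"
  shows "expands S (\<lambda>t m. K t m ^ n) (\<lambda>m. of_nat n * K 0 m ^ (n - 1) * d m)"
proof (induction n)
  case 0
  show ?case by (simp add: expands_const)
next
  case (Suc n)
  \<comment> \<open>At n = 0 the truncated exponent \<open>n - 1\<close> is harmless because its
    coefficient vanishes.\<close>
  have "d m * K 0 m ^ n + K 0 m * (of_nat n * K 0 m ^ (n - 1) * d m)
      = of_nat (Suc n) * K 0 m ^ (Suc n - 1) * d m" for m
    by (cases n) (simp_all add: algebra_simps)
  then show ?case using expands_mult[OF assms Suc] by simp
qed

section \<open>Matrix-valued expansions and one-parameter groups\<close>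

definition mexpands ::
    "'a set \<Rightarrow> (real \<Rightarrow> 'a \<Rightarrow> complex^'n^'n) \<Rightarrow> ('a \<Rightarrow> complex^'n^'n) \<Rightarrow> bool" where
  "mexpands S K d \<longleftrightarrow> (\<forall>i j. expands S (\<lambda>t m. K t m $ i $ j) (\<lambda>m. d m $ i $ j))"

lemma mexpands_const: "mexpands S (\<lambda>t m. A) (\<lambda>m. 0)"
  by (simp add: mexpands_def expands_const)

lemma mexpands_mult:
  assumes "mexpands S K d" "mexpands S K' d'"
  shows "mexpands S (\<lambda>t m. K t m ** K' t m) (\<lambda>m. d m ** K' 0 m + K 0 m ** d' m)"
  using assms unfolding mexpands_def
  by (auto simp: matrix_matrix_mult_def sum.distrib[symmetric] intro!: expands_sum expands_mult)

lemma expands_trace: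
  assumes "mexpands S K d"
  shows "expands S (\<lambda>t m. trace (K t m)) (\<lambda>m. trace (d m))"
  using assms unfolding mexpands_def trace_def by (intro expands_sum) auto

lemma USp4_entry_le:
  assumes "m \<in> USp4"
  shows "cmod (m $ k $ i) \<le> 1"
proof -
  have "(transpose m ** cnj_matrix m) $ i $ i = 1"
    using assms by (simp add: USp4_def mat_def)
  then have "(\<Sum>k\<in>UNIV. m $ k $ i * cnj (m $ k $ i)) = 1"
    by (simp add: matrix_matrix_mult_def transpose_def cnj_matrix_def)
  then have "of_real (\<Sum>k\<in>UNIV. (cmod (m $ k $ i))\<^sup>2) = (1::complex)"
    by (simp add: complex_norm_square[symmetric])
  then have "(\<Sum>k\<in>UNIV. (cmod (m $ k $ i))\<^sup>2) = 1"
    using of_real_eq_1_iff by blast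
  moreover have "(cmod (m $ k $ i))\<^sup>2 \<le> (\<Sum>k\<in>UNIV. (cmod (m $ k $ i))\<^sup>2)"
    by (rule member_le_sum) auto
  ultimately show ?thesis
    by (metis abs_norm_cancel abs_square_le_1)
qed

text \<open>This is the exponential of t X when X^3 = - X: the odd powers then collapse to sin t
  times X, and the even powers beyond the zeroth to (1 - cos t) times X^2.\<close>

definition one_param :: "complex^'n^'n \<Rightarrow> real \<Rightarrow> complex^'n^'n" where
  "one_param X t = mat 1 + (sin t) *\<^sub>R X + (1 - cos t) *\<^sub>R (X ** X)"

lemma one_param_0: "one_param X 0 = mat 1"
  by (simp add: one_param_def)

lemma sin_minus_le: "\<bar>sin t - t\<bar> \<le> t\<^sup>2" for t :: real
proof -
  have "\<bar>sin t - (\<Sum>m<2. sin_coeff m * t ^ m)\<bar> \<le> inverse (fact 2) * \<bar>t\<bar> ^ 2"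
    by (rule Maclaurin_sin_bound)
  moreover have "(\<Sum>m<2. sin_coeff m * t ^ m) = t"
    by (simp add: sin_coeff_def numeral_2_eq_2)
  ultimately have "\<bar>sin t - t\<bar> \<le> t\<^sup>2 / 2" by (simp add: fact_2)
  then show ?thesis using zero_le_power2[of t] by linarith
qed

lemma one_minus_cos_le: "\<bar>1 - cos t\<bar> \<le> t\<^sup>2" for t :: real
proof -
  have "1 - cos t = 2 * (sin (t/2))\<^sup>2"
    using cos_double_sin[of "t/2"] by simp
  moreover have "(sin (t/2))\<^sup>2 \<le> (t/2)\<^sup>2"
    using abs_sin_x_le_abs_x[of "t/2"] by (metis abs_le_square_iff)
  then have "4 * (sin (t/2))\<^sup>2 \<le> t\<^sup>2" by (simp add: power_divide)
  ultimately have "1 - cos t \<le> t\<^sup>2"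
    using zero_le_power2[of t] by linarith
  then show ?thesis by simp
qed

lemma mexpands_one_param:
  "mexpands USp4 (\<lambda>t m. one_param X t ** m) (\<lambda>m. X ** m)"
  unfolding mexpands_def
proof (intro allI)
  fix i j :: 4
  define B :: "complex^4^4 \<Rightarrow> real" where "B A = (\<Sum>k\<in>UNIV. cmod (A $ i $ k))" for A
  have B: "cmod ((A ** m) $ i $ j) \<le> B A" if "m \<in> USp4" for A m
    unfolding matrix_matrix_mult_def B_def vec_lambda_beta
    by (rule sum_norm_le) (use USp4_entry_le[OF that] in \<open>auto simp: norm_mult intro: mult_left_le\<close>)
  have B0: "B A \<ge> 0" for A unfolding B_def by (simp add: sum_nonneg)
  have ex: "(one_param X t ** m) $ i $ j =
      m $ i $ j + of_real (sin t) * (X ** m) $ i $ j + of_real (1 - cos t) * (X ** X ** m) $ i $ j" for t m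
  proof -
    define Y where "Y = X ** X"
    have "((mat 1 + sin t *\<^sub>R X + (1 - cos t) *\<^sub>R Y) ** m) $ i $ j
        = (mat 1 ** m) $ i $ j + of_real (sin t) * (X ** m) $ i $ j + of_real (1 - cos t) * (Y ** m) $ i $ j"
      unfolding matrix_matrix_mult_def
      by (simp add: vector_add_component vector_scaleR_component del: of_real_diff)
         (simp add: scaleR_conv_of_real distrib_right sum.distrib sum_distrib_left mult.assoc del: of_real_diff)
    then show ?thesis by (simp add: one_param_def Y_def)
  qed
  define C where "C = 1 + B X + 2 * B (X ** X)"
  show "expands USp4 (\<lambda>t m. (one_param X t ** m) $ i $ j) (\<lambda>m. (X ** m) $ i $ j)"
  proof (rule expandsI[of _ _ C])
    fix m t assume m: "m \<in> USp4" "\<bar>t\<bar> \<le> (1::real)"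
    have 1: "norm (of_real (sin t) * (X ** m) $ i $ j) \<le> 1 * B X"
      unfolding norm_mult using B[OF m(1)] B0 by (intro mult_mono) auto
    have "\<bar>1 - cos t\<bar> \<le> 2" using cos_ge_minus_one[of t] cos_le_one[of t] by linarith
    then have 2: "norm (of_real (1 - cos t) * (X ** X ** m) $ i $ j) \<le> 2 * B (X ** X)"
      unfolding norm_mult norm_of_real using B[OF m(1)] B0 by (intro mult_mono) auto
    show "cmod ((one_param X t ** m) $ i $ j) \<le> C"
      unfolding ex C_def using USp4_entry_le[OF m(1)] 1 2 by (intro norm_triangle_mono) auto
    have "(one_param X t ** m) $ i $ j - (one_param X 0 ** m) $ i $ j - of_real t * (X ** m) $ i $ j
      = of_real (sin t - t) * (X ** m) $ i $ j + of_real (1 - cos t) * (X ** X ** m) $ i $ j"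
      unfolding ex by (simp add: algebra_simps)
    moreover have "norm (of_real (sin t - t) * (X ** m) $ i $ j) \<le> t\<^sup>2 * B X"
      unfolding norm_mult norm_of_real using B[OF m(1)] B0 sin_minus_le by (intro mult_mono) auto
    moreover have "norm (of_real (1 - cos t) * (X ** X ** m) $ i $ j) \<le> t\<^sup>2 * B (X ** X)"
      unfolding norm_mult norm_of_real using B[OF m(1)] B0 one_minus_cos_le by (intro mult_mono) auto
    ultimately have "cmod ((one_param X t ** m) $ i $ j - (one_param X 0 ** m) $ i $ j
        - of_real t * (X ** m) $ i $ j) \<le> t\<^sup>2 * B X + t\<^sup>2 * B (X ** X)"
      by (simp only: norm_triangle_mono)
    also have "\<dots> \<le> C * t\<^sup>2"
      using B0[of "X**X"] by (simp add: C_def algebra_simps)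
    finally show "cmod ((one_param X t ** m) $ i $ j - (one_param X 0 ** m) $ i $ j
        - of_real t * (X ** m) $ i $ j) \<le> C * t\<^sup>2" .
  next
    fix m :: "complex^4^4" assume "m \<in> USp4"
    then show "cmod ((X ** m) $ i $ j) \<le> C" using B[of m X] B0[of "X**X"] by (simp add: C_def)
  qed
qed

section \<open>Invariance of the Haar measure\<close>

lemma haar_space:
  assumes "normalized_haar_measure G M"
  shows "space M = G"
  using assms sets_eq_imp_space_eq[of M "restrict_space borel G"]
  by (simp add: normalized_haar_measure_def space_restrict_space)

lemma haar_measurable:
  fixes h :: "complex^'n^'n \<Rightarrow> complex"
  assumes "normalized_haar_measure G M" "continuous_on UNIV h"
  shows "h \<in> borel_measurable M"
proof -
  have "h \<in> borel_measurable (restrict_space borel G)"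
    using assms(2) by (intro measurable_restrict_space1 borel_measurable_continuous_onI)
  then show ?thesis
    using assms(1) measurable_cong_sets[of M "restrict_space borel G" borel borel]
    by (auto simp: normalized_haar_measure_def)
qed

lemma continuous_on_matrix_mult:
  fixes f g :: "'a::topological_space \<Rightarrow> complex^'n^'n"
  assumes "continuous_on S f" "continuous_on S g"
  shows "continuous_on S (\<lambda>x. f x ** g x)"
  using assms unfolding matrix_matrix_mult_def
  by (intro continuous_on_vec_lambda continuous_intros)

lemma continuous_on_trace:
  fixes f :: "'a::topological_space \<Rightarrow> complex^'n^'n"
  assumes "continuous_on S f"
  shows "continuous_on S (\<lambda>x. trace (f x))"
  using assms unfolding trace_def by (intro continuous_intros)

lemma haar_translate_measurable:
  fixes g :: "complex^'n^'n"
  assumes M: "normalized_haar_measure G M" and G: "\<And>m. m \<in> G \<Longrightarrow> g ** m \<in> G"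
  shows "(\<lambda>m. g ** m) \<in> measurable M M"
proof -
  have "continuous_on UNIV (\<lambda>m :: complex^'n^'n. g ** m)"
    using continuous_on_matrix_mult[where S = UNIV and f = "\<lambda>_. g" and g = "\<lambda>m. m"] by simp
  then have "(\<lambda>m :: complex^'n^'n. g ** m) \<in> measurable borel borel"
    by (rule borel_measurable_continuous_onI)
  then have "(\<lambda>m. g ** m) \<in> measurable (restrict_space borel G) (restrict_space borel G)"
    using G by (intro measurable_restrict_space3) auto
  then show ?thesis
    using M by (simp add: normalized_haar_measure_def cong: measurable_cong_sets)
qed

lemma haar_translate_integral:
  fixes h :: "complex^'n^'n \<Rightarrow> complex"
  assumes M: "normalized_haar_measure G M" and g: "g \<in> G"
    and G: "\<And>m. m \<in> G \<Longrightarrow> g ** m \<in> G" and h: "continuous_on UNIV h"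
  shows "(LINT m|M. h (g ** m)) = (LINT m|M. h m)"
proof -
  have "(LINT m|M. h m) = (LINT m|distr M M (\<lambda>m. g ** m). h m)"
    using M g by (simp add: normalized_haar_measure_def)
  also have "\<dots> = (LINT m|M. h (g ** m))"
    by (rule integral_distr[OF haar_translate_measurable[OF M G] haar_measurable[OF M h]])
  finally show ?thesis ..
qed

lemma haar_integrable:
  fixes h :: "complex^'n^'n \<Rightarrow> complex"
  assumes M: "normalized_haar_measure G M" and h: "continuous_on UNIV h"
    and C: "\<And>m. m \<in> G \<Longrightarrow> norm (h m) \<le> C"
  shows "integrable M h"
proof -
  interpret prob_space M using M by (simp add: normalized_haar_measure_def)
  show ?thesis
    using C haar_space[OF M] haar_measurable[OF M h]
    by (intro integrable_const_bound[where B = C]) auto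
qed

text \<open>Invariance makes the integral of \<open>h (g t ** m)\<close> constant in t. Integrating
  the uniform expansion thus leaves t |integral of d| <= C t^2 for 0 < t <= 1; divide by t and let t
  tend to 0.\<close>

lemma haar_derivative_zero:
  fixes h d :: "complex^'n^'n \<Rightarrow> complex"
  assumes M: "normalized_haar_measure G M"
    and g: "\<And>t. g t \<in> G" and g0: "g 0 = mat 1"
    and G: "\<And>m m'. m \<in> G \<Longrightarrow> m' \<in> G \<Longrightarrow> m ** m' \<in> G"
    and ex: "expands G (\<lambda>t m. h (g t ** m)) d"
    and h: "continuous_on UNIV h" and d: "continuous_on UNIV d"
  shows "(LINT m|M. d m) = 0"
proof -
  interpret prob_space M using M by (simp add: normalized_haar_measure_def)
  from ex obtain C where C: "C \<ge> 0" "\<And>m t. m \<in> G \<Longrightarrow> \<bar>t\<bar> \<le> 1 \<Longrightarrow> norm (h (g t ** m)) \<le> C"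
    "\<And>m. m \<in> G \<Longrightarrow> norm (d m) \<le> C"
    "\<And>m t. m \<in> G \<Longrightarrow> \<bar>t\<bar> \<le> 1 \<Longrightarrow> norm (h (g t ** m) - h (g 0 ** m) - of_real t * d m) \<le> C * t\<^sup>2"
    by (rule expandsE) blast
  have id: "integrable M d" by (rule haar_integrable[OF M d C(3)])
  have ih: "integrable M (\<lambda>m. h (g t ** m))" if "\<bar>t\<bar> \<le> 1" for t
    by (rule haar_integrable[OF M continuous_on_compose2[OF h]])
       (use C(2)[OF _ that] in \<open>auto intro!: continuous_on_matrix_mult continuous_intros\<close>)
  have ih0: "integrable M h" using ih[of 0] by (simp add: g0)
  have le: "norm (LINT m|M. d m) \<le> C * t" if t: "0 < t" "t \<le> 1" for t
  proof -
    have eq: "(LINT m|M. h (g t ** m) - h (g 0 ** m) - of_real t * d m) = - of_real t * (LINT m|M. d m)"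
      using ih[of t] ih0 id t haar_translate_integral[OF M g G[OF g] h, of t] by (simp add: g0)
    have "norm (LINT m|M. h (g t ** m) - h (g 0 ** m) - of_real t * d m) \<le> C * t\<^sup>2"
    proof -
      have "norm (LINT m|M. h (g t ** m) - h (g 0 ** m) - of_real t * d m)
          \<le> (LINT m|M. norm (h (g t ** m) - h (g 0 ** m) - of_real t * d m))"
        by (rule integral_norm_bound)
      also have "\<dots> \<le> C * t\<^sup>2"
        by (rule integral_le_const) (use t C(4) ih[of t] ih0 id in \<open>auto simp: g0 haar_space[OF M]\<close>)
      finally show ?thesis .
    qed
    then have "t * norm (LINT m|M. d m) \<le> C * t\<^sup>2"
      unfolding eq using t by (simp add: norm_mult)
    then have "t * norm (LINT m|M. d m) \<le> t * (C * t)"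
      by (simp add: power2_eq_square algebra_simps)
    then show ?thesis using t by (simp only: mult_le_cancel_left_pos)
  qed
  have "norm (LINT m|M. d m) \<le> 0"
  proof (rule field_le_epsilon)
    fix e :: real assume "e > 0"
    define t where "t = min 1 (e / (C + 1))"
    have t: "0 < t" "t \<le> 1" "t \<le> e / (C + 1)" using \<open>e > 0\<close> C(1) by (auto simp: t_def)
    have "C * t \<le> (C + 1) * (e / (C + 1))" using t C(1) by (intro mult_mono) auto
    also have "\<dots> = e" using C(1) by simp
    finally show "norm (LINT m|M. d m) \<le> 0 + e" using le[OF t(1,2)] by simp
  qed
  then show ?thesis by simp
qed

section \<open>The group USp4 and elements of its Lie algebra\<close>

lemma cnj_matrix_mult: "cnj_matrix (A ** B) = cnj_matrix A ** cnj_matrix B"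
  by (simp add: cnj_matrix_def matrix_matrix_mult_def vec_eq_iff)

lemma USp4_iff: "m \<in> USp4 \<longleftrightarrow> transpose m ** J4 ** m = J4 \<and> transpose m ** cnj_matrix m = mat 1"
proof -
  have "invertible m" if "transpose m ** cnj_matrix m = mat 1"
  proof -
    have "transpose (transpose m ** cnj_matrix m) = transpose (mat 1 :: complex^4^4)" using that by simp
    then have "transpose (cnj_matrix m) ** m = mat 1"
      by (simp add: matrix_transpose_mul)
    then show ?thesis using invertible_left_inverse by blast
  qed
  then show ?thesis by (auto simp: USp4_def)
qed

lemma USp4_mult:
  assumes "m \<in> USp4" "m' \<in> USp4"
  shows "m ** m' \<in> USp4"
proof -
  have m: "transpose m ** J4 ** m = J4" "transpose m ** cnj_matrix m = mat 1"
    and m': "transpose m' ** J4 ** m' = J4" "transpose m' ** cnj_matrix m' = mat 1"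
    using assms by (simp_all add: USp4_iff)
  have "transpose (m ** m') ** J4 ** (m ** m') = transpose m' ** (transpose m ** J4 ** m) ** m'"
    by (simp add: matrix_transpose_mul matrix_mul_assoc)
  moreover have "transpose (m ** m') ** cnj_matrix (m ** m')
      = transpose m' ** (transpose m ** cnj_matrix m) ** cnj_matrix m'"
    by (simp add: matrix_transpose_mul matrix_mul_assoc cnj_matrix_mult)
  ultimately show ?thesis using m m' by (simp add: USp4_iff)
qed

text \<open>\<open>- mat 1\<close> belongs to the group, so negation is a left translation. This is
  what kills the odd moments.\<close>

lemma haar_uminus:
  fixes h :: "complex^4^4 \<Rightarrow> complex"
  assumes M: "normalized_haar_measure USp4 M" and h: "continuous_on UNIV h"
  shows "(LINT m|M. h (- m)) = (LINT m|M. h m)"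
proof -
  have neg: "(- mat 1) ** m = - m" for m :: "complex^4^4"
    by (simp add: vec_eq_iff matrix_matrix_mult_def mat_def sum_negf if_distrib[of "\<lambda>x. x * _"] cong: if_cong)
  have "(- mat 1 :: complex^4^4) \<in> USp4"
    by (simp add: USp4_iff vec_eq_iff matrix_matrix_mult_def J4_def cnj_matrix_def transpose_def forall_4 sum_4 vector_4 mat_def)
  from haar_translate_integral[OF M this USp4_mult[OF this], of h] h
  show ?thesis by (simp add: neg)
qed

lemma matrix_mult_bilinear:
  fixes A B :: "complex^'n^'m" and C D :: "complex^'k^'n"
  shows "(A + B) ** C = A ** C + B ** C" "A ** (C + D) = A ** C + A ** D"
    "(- A) ** C = - (A ** C)" "A ** (- C) = - (A ** C)"
    "(r *\<^sub>R A) ** C = r *\<^sub>R (A ** C)" "A ** (r *\<^sub>R C) = r *\<^sub>R (A ** C)"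
    "(A - B) ** C = A ** C - B ** C" "A ** (C - D) = A ** C - A ** D"
  by (simp_all add: vec_eq_iff matrix_matrix_mult_def sum.distrib sum_negf algebra_simps scaleR_sum_right sum_subtractf)

text \<open>The first two equations describe the Lie algebra of USp4: X is Hamiltonian for J and
  skew-Hermitian. The cubic equation confines the eigenvalues to 0, i and -i and makes
  \<open>one_param X\<close> the exponential.\<close>

definition unit_generator :: "complex^4^4 \<Rightarrow> bool" where
  "unit_generator X \<longleftrightarrow> transpose X ** J4 = - (J4 ** X) \<and> transpose X = - cnj_matrix X \<and> X ** X ** X = - X"

lemma transpose_add: "transpose (A + B) = transpose A + transpose B" for A B :: "complex^'n^'m"
  by (simp add: transpose_def vec_eq_iff)

lemma transpose_diff: "transpose (A - B) = transpose A - transpose B" for A B :: "complex^'n^'m"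
  by (simp add: transpose_def vec_eq_iff)

lemma transpose_scale: "transpose (r *\<^sub>R A) = r *\<^sub>R transpose A" for A :: "complex^'n^'m"
  by (simp add: transpose_def vec_eq_iff)

lemma one_param_inverse:
  assumes "X ** X ** X = - (X :: complex^'n^'n)"
  shows "one_param X (- t) ** one_param X t = mat 1"
proof -
  define Y where "Y = X ** X"
  have XY: "X ** Y = - X" "Y ** X = - X" "Y ** Y = - Y" "X ** X = Y"
    using assms by (simp_all add: Y_def matrix_mul_assoc matrix_mult_bilinear)
  have c: "cos t * cos t + sin t * sin t = 1"
    using sin_cos_squared_add[of t] by (simp add: power2_eq_square)
  \<comment> \<open>In the product the terms in X cancel, and the coefficient of Y is 1 - cos^2 t -
    sin^2 t.\<close>
  have "(cos t * cos t) *\<^sub>R Y + (sin t * sin t) *\<^sub>R Y = Y"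
    by (simp add: c flip: scaleR_left_distrib)
  then show ?thesis
    unfolding one_param_def Y_def[symmetric]
    by (simp add: matrix_mult_bilinear XY) (simp add: algebra_simps)
qed

text \<open>Write g(t) for \<open>one_param X t\<close>. Moving J across the transpose of X changes
  X to -X, so the transpose of g(t) times J is J g(-t); skew-Hermitian symmetry makes the conjugate
  of g(t) the transpose of g(-t). Both equations of the group thus reduce to g(-t) g(t) = 1.\<close>

lemma one_param_USp4:
  assumes "unit_generator X"
  shows "one_param X t \<in> USp4"
proof -
  have J: "transpose X ** J4 = - (J4 ** X)" and U: "transpose X = - cnj_matrix X"
    and X3: "X ** X ** X = - X"
    using assms by (auto simp: unit_generator_def)
  define g where "g = one_param X t"
  have tr: "transpose g = mat 1 + sin t *\<^sub>R transpose X + (1 - cos t) *\<^sub>R (transpose X ** transpose X)"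
    by (simp add: g_def one_param_def transpose_add transpose_scale matrix_transpose_mul)
  have "transpose X ** transpose X ** J4 = transpose X ** (transpose X ** J4)"
    by (rule matrix_mul_assoc[symmetric])
  also have "\<dots> = transpose X ** (- (J4 ** X))"
    by (simp only: J)
  also have "\<dots> = - ((transpose X ** J4) ** X)"
    by (simp only: matrix_mult_bilinear matrix_mul_assoc)
  also have "\<dots> = J4 ** (X ** X)"
    by (simp only: J matrix_mult_bilinear matrix_mul_assoc minus_minus)
  finally have JX2: "transpose X ** transpose X ** J4 = J4 ** (X ** X)" .
  have "transpose g ** J4 = J4 ** one_param X (- t)"
    unfolding tr by (simp add: one_param_def matrix_mult_bilinear J JX2)
  then have "transpose g ** J4 ** g = J4 ** (one_param X (- t) ** g)"
    by (simp only: matrix_mul_assoc)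
  then have 1: "transpose g ** J4 ** g = J4"
    by (simp add: g_def one_param_inverse[OF X3])
  have cg: "cnj_matrix g = mat 1 - sin t *\<^sub>R transpose X + (1 - cos t) *\<^sub>R (transpose X ** transpose X)"
    unfolding U by (simp add: g_def one_param_def cnj_matrix_def vec_eq_iff mat_def matrix_matrix_mult_def)
  have "cnj_matrix g = transpose (one_param X (- t))"
    unfolding cg by (simp add: one_param_def transpose_add transpose_diff transpose_scale matrix_transpose_mul)
  then have "transpose g ** cnj_matrix g = transpose (one_param X (- t) ** one_param X t)"
    by (simp add: g_def matrix_transpose_mul)
  then show ?thesis using 1 by (simp add: one_param_inverse[OF X3] USp4_iff g_def)
qed

section \<open>The Casimir tensor\<close>

text \<open>Literal rows keep all entries explicit, so that matrix identities reduce to sixteen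
  scalar ones by rewriting.\<close>

definition mat4 :: "complex list \<Rightarrow> complex list \<Rightarrow> complex list \<Rightarrow> complex list \<Rightarrow> complex^4^4" where
  "mat4 a b c d = vector [vector a, vector b, vector c, vector d]"

lemma mat4_nth:
  "mat4 [a11, a12, a13, a14] r2 r3 r4 $ 1 $ 1 = a11" "mat4 [a11, a12, a13, a14] r2 r3 r4 $ 1 $ 2 = a12"
  "mat4 [a11, a12, a13, a14] r2 r3 r4 $ 1 $ 3 = a13" "mat4 [a11, a12, a13, a14] r2 r3 r4 $ 1 $ 4 = a14"
  "mat4 r1 [a21, a22, a23, a24] r3 r4 $ 2 $ 1 = a21" "mat4 r1 [a21, a22, a23, a24] r3 r4 $ 2 $ 2 = a22"
  "mat4 r1 [a21, a22, a23, a24] r3 r4 $ 2 $ 3 = a23" "mat4 r1 [a21, a22, a23, a24] r3 r4 $ 2 $ 4 = a24"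
  "mat4 r1 r2 [a31, a32, a33, a34] r4 $ 3 $ 1 = a31" "mat4 r1 r2 [a31, a32, a33, a34] r4 $ 3 $ 2 = a32"
  "mat4 r1 r2 [a31, a32, a33, a34] r4 $ 3 $ 3 = a33" "mat4 r1 r2 [a31, a32, a33, a34] r4 $ 3 $ 4 = a34"
  "mat4 r1 r2 r3 [a41, a42, a43, a44] $ 4 $ 1 = a41" "mat4 r1 r2 r3 [a41, a42, a43, a44] $ 4 $ 2 = a42"
  "mat4 r1 r2 r3 [a41, a42, a43, a44] $ 4 $ 3 = a43" "mat4 r1 r2 r3 [a41, a42, a43, a44] $ 4 $ 4 = a44"
  by (simp_all add: mat4_def vector_4)

lemma mat4_mult_nth:
  "(mat4 [x, y, z, w] r2 r3 r4 ** A) $ 1 $ j = x * A $ 1 $ j + y * A $ 2 $ j + z * A $ 3 $ j + w * A $ 4 $ j"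
  "(mat4 r1 [x, y, z, w] r3 r4 ** A) $ 2 $ j = x * A $ 1 $ j + y * A $ 2 $ j + z * A $ 3 $ j + w * A $ 4 $ j"
  "(mat4 r1 r2 [x, y, z, w] r4 ** A) $ 3 $ j = x * A $ 1 $ j + y * A $ 2 $ j + z * A $ 3 $ j + w * A $ 4 $ j"
  "(mat4 r1 r2 r3 [x, y, z, w] ** A) $ 4 $ j = x * A $ 1 $ j + y * A $ 2 $ j + z * A $ 3 $ j + w * A $ 4 $ j"
  by (simp_all add: matrix_matrix_mult_def sum_4 mat4_nth)

lemma mat4_eqI:
  fixes A B :: "complex^4^4"
  assumes "A $ 1 $ 1 = B $ 1 $ 1" "A $ 1 $ 2 = B $ 1 $ 2" "A $ 1 $ 3 = B $ 1 $ 3" "A $ 1 $ 4 = B $ 1 $ 4"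
    "A $ 2 $ 1 = B $ 2 $ 1" "A $ 2 $ 2 = B $ 2 $ 2" "A $ 2 $ 3 = B $ 2 $ 3" "A $ 2 $ 4 = B $ 2 $ 4"
    "A $ 3 $ 1 = B $ 3 $ 1" "A $ 3 $ 2 = B $ 3 $ 2" "A $ 3 $ 3 = B $ 3 $ 3" "A $ 3 $ 4 = B $ 3 $ 4"
    "A $ 4 $ 1 = B $ 4 $ 1" "A $ 4 $ 2 = B $ 4 $ 2" "A $ 4 $ 3 = B $ 4 $ 3" "A $ 4 $ 4 = B $ 4 $ 4"
  shows "A = B"
  using assms by (simp add: vec_eq_iff forall_4)

lemma J4_mat4: "J4 = mat4 [0, 0, 1, 0] [0, 0, 0, 1] [-1, 0, 0, 0] [0, -1, 0, 0]"
  by (simp add: J4_def mat4_def)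

lemma transpose_mat4:
  "transpose (mat4 [a11, a12, a13, a14] [a21, a22, a23, a24] [a31, a32, a33, a34] [a41, a42, a43, a44])
    = mat4 [a11, a21, a31, a41] [a12, a22, a32, a42] [a13, a23, a33, a43] [a14, a24, a34, a44]"
  by (rule mat4_eqI) (simp_all add: mat4_nth transpose_def)

lemma cnj_mat4:
  "cnj_matrix (mat4 [a11, a12, a13, a14] [a21, a22, a23, a24] [a31, a32, a33, a34] [a41, a42, a43, a44])
    = mat4 [cnj a11, cnj a12, cnj a13, cnj a14] [cnj a21, cnj a22, cnj a23, cnj a24]
        [cnj a31, cnj a32, cnj a33, cnj a34] [cnj a41, cnj a42, cnj a43, cnj a44]"
  by (rule mat4_eqI) (simp_all add: mat4_nth cnj_matrix_def)

text \<open>The weights make this list, up to a scalar, the Casimir tensor of the Lie algebra of \<open>USp4\<close>;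
  they compensate for the normalization \<open>X\<^sup>3 = - X\<close>, which gives the short closed form of the
  one-parameter groups.\<close>

definition casimir :: "(complex \<times> (complex^4^4)) list" where
  "casimir =
    [(2, mat4 [\<i>,0,0,0] [0,0,0,0] [0,0,-\<i>,0] [0,0,0,0]),
     (2, mat4 [0,0,0,0] [0,\<i>,0,0] [0,0,0,0] [0,0,0,-\<i>]),
     (2, mat4 [0,0,1,0] [0,0,0,0] [-1,0,0,0] [0,0,0,0]),
     (2, mat4 [0,0,\<i>,0] [0,0,0,0] [\<i>,0,0,0] [0,0,0,0]),
     (2, mat4 [0,0,0,0] [0,0,0,1] [0,0,0,0] [0,-1,0,0]),
     (2, mat4 [0,0,0,0] [0,0,0,\<i>] [0,0,0,0] [0,\<i>,0,0]),
     (1, mat4 [0,1,0,0] [-1,0,0,0] [0,0,0,1] [0,0,-1,0]),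
     (1, mat4 [0,\<i>,0,0] [\<i>,0,0,0] [0,0,0,-\<i>] [0,0,-\<i>,0]),
     (1, mat4 [0,0,0,1] [0,0,1,0] [0,-1,0,0] [-1,0,0,0]),
     (1, mat4 [0,0,0,\<i>] [0,0,\<i>,0] [0,\<i>,0,0] [\<i>,0,0,0])]"

lemma unit_generator_casimir: "(w, X) \<in> set casimir \<Longrightarrow> unit_generator X"
proof -
  have "list_all (\<lambda>(w, X). unit_generator X) casimir"
    unfolding casimir_def list.pred_inject(2) prod.case unit_generator_def transpose_mat4 cnj_mat4 J4_mat4
      matrix_mul_assoc[symmetric]
    by (intro conjI list.pred_inject(1)) (rule mat4_eqI; simp add: mat4_nth mat4_mult_nth)+
  then show "(w, X) \<in> set casimir \<Longrightarrow> unit_generator X"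
    by (auto simp: list_all_iff)
qed

lemma trace_mat4_mult:
  "trace (mat4 [a11, a12, a13, a14] [a21, a22, a23, a24] [a31, a32, a33, a34] [a41, a42, a43, a44] ** A)
    = a11 * A $ 1 $ 1 + a12 * A $ 2 $ 1 + a13 * A $ 3 $ 1 + a14 * A $ 4 $ 1
    + (a21 * A $ 1 $ 2 + a22 * A $ 2 $ 2 + a23 * A $ 3 $ 2 + a24 * A $ 4 $ 2)
    + (a31 * A $ 1 $ 3 + a32 * A $ 2 $ 3 + a33 * A $ 3 $ 3 + a34 * A $ 4 $ 3)
    + (a41 * A $ 1 $ 4 + a42 * A $ 2 $ 4 + a43 * A $ 3 $ 4 + a44 * A $ 4 $ 4)"
  by (simp add: trace_def sum_4 mat4_mult_nth)

text \<open>The adjoint of A for the symplectic form J, since J^(-1) = - J; on \<open>USp4\<close>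
  it is the inverse.\<close>

definition symp_adj :: "complex^4^4 \<Rightarrow> complex^4^4" where
  "symp_adj A = - (J4 ** transpose A ** J4)"

lemma symp_adj_mat4: "symp_adj A =
    mat4 [A $ 3 $ 3, A $ 4 $ 3, - A $ 1 $ 3, - A $ 2 $ 3]
         [A $ 3 $ 4, A $ 4 $ 4, - A $ 1 $ 4, - A $ 2 $ 4]
         [- A $ 3 $ 1, - A $ 4 $ 1, A $ 1 $ 1, A $ 2 $ 1]
         [- A $ 3 $ 2, - A $ 4 $ 2, A $ 1 $ 2, A $ 2 $ 2]"
  unfolding symp_adj_def J4_mat4 matrix_mul_assoc[symmetric]
  by (rule mat4_eqI)
     (simp_all add: mat4_nth mat4_mult_nth, simp_all add: matrix_matrix_mult_def sum_4 mat4_nth transpose_def)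

text \<open>The Casimir element acts on the standard representation as the scalar -10: in each
  diagonal position the generators of weight 2 contribute -6 and those of weight 1 contribute
  -4.\<close>

lemma casimir_tr_sq:
  "(\<Sum>(w, X)\<leftarrow>casimir. w * trace (X ** (X ** A))) = - 10 * trace A"
  by (simp add: casimir_def trace_mat4_mult mat4_mult_nth)
     (simp add: trace_def sum_4 algebra_simps)

text \<open>This identity and \<open>casimir_tr_tensor\<close> are contractions of one tensor: the
  weighted sum of X_ij X_kl equals 2 (J_ik J_jl - delta_il delta_jk). The Kronecker term is typical
  of unitary groups; the J term, which produces \<open>symp_adj\<close>, comes from the symplectic
  constraint.\<close>

lemma casimir_tr_tr:
  "(\<Sum>(w, X)\<leftarrow>casimir. w * (trace (X ** A) * trace (X ** B)))
    = 2 * (trace (symp_adj B ** A) - trace (B ** A))"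
  by (simp add: casimir_def symp_adj_mat4 trace_mat4_mult)
     (simp add: trace_def matrix_matrix_mult_def sum_4 algebra_simps)

lemma casimir_tr_tensor:
  "(\<Sum>(w, X)\<leftarrow>casimir. w * trace (X ** (A ** (X ** B))))
    = - 2 * (trace A * trace B + trace (symp_adj A ** B))"
  by (simp add: casimir_def symp_adj_mat4 trace_mat4_mult matrix_matrix_mult_def[of A] sum_4 mat4_mult_nth)
     (simp add: trace_def sum_4 algebra_simps)

section \<open>Schwinger--Dyson equations and moments\<close>

lemma J4_square: "J4 ** J4 = - mat 1"
  unfolding J4_mat4 by (rule mat4_eqI) (simp_all add: mat4_nth mat4_mult_nth mat_def)

lemma symp_adj_mult: "symp_adj (A ** B) = symp_adj B ** symp_adj A"
proof -
  have "symp_adj B ** symp_adj A = J4 ** transpose B ** (J4 ** J4) ** transpose A ** J4"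
    by (simp only: symp_adj_def matrix_mult_bilinear matrix_mul_assoc minus_minus)
  also have "\<dots> = - (J4 ** (transpose B ** transpose A) ** J4)"
    by (simp add: J4_square matrix_mult_bilinear matrix_mul_assoc)
  finally show ?thesis by (simp add: symp_adj_def matrix_transpose_mul)
qed

lemma trace_symp_adj: "trace (symp_adj A) = trace A"
  by (simp add: symp_adj_mat4 trace_def sum_4 mat4_nth)

lemma symp_adj_USp4:
  assumes "m \<in> USp4"
  shows "symp_adj m ** m = mat 1"
proof -
  have "symp_adj m ** m = - (J4 ** (transpose m ** J4 ** m))"
    by (simp only: symp_adj_def matrix_mult_bilinear matrix_mul_assoc)
  also have "\<dots> = mat 1"
    using assms by (simp add: USp4_iff J4_square)
  finally show ?thesis .
qed

text \<open>Newton's identity for \<open>m\<close> symplectic: the third elementary symmetric function of the eigenvalues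
  equals the first one, because a \<open>3 \<times> 3\<close> minor of \<open>m\<close> is a combination of entries of \<open>m\<close> with
  coefficients the symplectic products of columns.\<close>

lemma trace_cube_USp4:
  assumes "m \<in> USp4"
  shows "2 * trace (m ** m ** m) = - (trace m ^ 3) + 3 * trace m * trace (m ** m) + 6 * trace m"
proof -
  \<comment> \<open>The symplectic product of columns i and j, that is, an entry of the transpose of
    m times J times m.\<close>
  define w where "w i j = m $ 1 $ i * m $ 3 $ j + m $ 2 $ i * m $ 4 $ j - m $ 3 $ i * m $ 1 $ j - m $ 4 $ i * m $ 2 $ j" for i j
  have w: "w i j = J4 $ i $ j" for i j
  proof -
    have "(transpose m ** J4 ** m) $ i $ j = J4 $ i $ j" using assms by (simp add: USp4_iff)
    then have "(transpose m ** (J4 ** m)) $ i $ j = J4 $ i $ j" by (simp add: matrix_mul_assoc)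
    moreover have "(transpose m ** (J4 ** m)) $ i $ j = w i j"
      unfolding J4_mat4 w_def
      by (simp add: matrix_matrix_mult_def[of "transpose m"] sum_4 mat4_mult_nth) (simp add: transpose_def)
    ultimately show ?thesis by simp
  qed
  have m: "trace (m ** m) = (\<Sum>i\<in>UNIV. \<Sum>k\<in>UNIV. m $ i $ k * m $ k $ i)"
    "trace (m ** m ** m) = (\<Sum>i\<in>UNIV. \<Sum>k\<in>UNIV. (\<Sum>l\<in>UNIV. m $ i $ l * m $ l $ k) * m $ k $ i)"
    by (simp_all add: trace_def matrix_matrix_mult_def)
  \<comment> \<open>The principal 3 x 3 minor on the indices i, j, k. The identity
    \<open>newton\<close> below holds for every 4 x 4 matrix, since the sum of the four minors is
    the third elementary symmetric function.\<close>
  define d where "d i j k =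
    m $ i $ i * (m $ j $ j * m $ k $ k - m $ j $ k * m $ k $ j)
    - m $ i $ j * (m $ j $ i * m $ k $ k - m $ j $ k * m $ k $ i)
    + m $ i $ k * (m $ j $ i * m $ k $ j - m $ j $ j * m $ k $ i)" for i j k
  have newton: "2 * trace (m ** m ** m) = - (trace m ^ 3) + 3 * trace m * trace (m ** m)
     + 6 * (d 1 2 3 + d 1 2 4 + d 1 3 4 + d 2 3 4)"
    unfolding m unfolding trace_def sum_4 d_def power3_eq_cube by (simp add: algebra_simps)
  have "d 1 2 3 = - w 1 2 * m $ 2 $ 3 + w 1 3 * m $ 2 $ 2 - w 2 3 * m $ 2 $ 1"
    unfolding d_def w_def by algebra
  moreover have "d 1 2 4 = w 1 2 * m $ 1 $ 4 - w 1 4 * m $ 1 $ 2 + w 2 4 * m $ 1 $ 1"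
    unfolding d_def w_def by algebra
  moreover have "d 1 3 4 = w 1 3 * m $ 4 $ 4 - w 1 4 * m $ 4 $ 3 + w 3 4 * m $ 4 $ 1"
    unfolding d_def w_def by algebra
  moreover have "d 2 3 4 = - w 2 3 * m $ 3 $ 4 + w 2 4 * m $ 3 $ 3 - w 3 4 * m $ 3 $ 2"
    unfolding d_def w_def by algebra
  \<comment> \<open>Of the products that occur only \<open>w 1 3\<close> and \<open>w 2 4\<close>
    are nonzero, both equal to 1; the four minors become m_22, m_11, m_44 and m_33.\<close>
  ultimately show ?thesis
    unfolding newton w J4_mat4 by (simp add: mat4_nth trace_def sum_4)
qed

lemma sum_list_linear:
  fixes c e :: complex
  shows "(\<Sum>(w, X)\<leftarrow>L. w * (c * f X + e * g X)) = c * (\<Sum>(w, X)\<leftarrow>L. w * f X) + e * (\<Sum>(w, X)\<leftarrow>L. w * g X)"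
  by (induction L) (auto simp: algebra_simps)

lemma sum_list_linear3:
  fixes c e :: complex
  shows "(\<Sum>(w, X)\<leftarrow>L. w * (c * f X + e * (g X + h X))) =
    c * (\<Sum>(w, X)\<leftarrow>L. w * f X) + e * ((\<Sum>(w, X)\<leftarrow>L. w * g X) + (\<Sum>(w, X)\<leftarrow>L. w * h X))"
  by (induction L) (auto simp: algebra_simps)

lemma integral_sum_list_zero:
  fixes f :: "'b \<Rightarrow> 'a \<Rightarrow> complex"
  assumes "\<And>x. x \<in> set xs \<Longrightarrow> integrable M (f x) \<and> integral\<^sup>L M (f x) = 0"
  shows "integrable M (\<lambda>m. \<Sum>x\<leftarrow>xs. f x m) \<and> (LINT m|M. (\<Sum>x\<leftarrow>xs. f x m)) = 0"
  using assms by (induction xs) simp_all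

lemma integral_casimir_zero:
  fixes D :: "complex^4^4 \<Rightarrow> 'a \<Rightarrow> complex"
  assumes "\<And>X. unit_generator X \<Longrightarrow> integrable M (D X) \<and> integral\<^sup>L M (D X) = 0"
  shows "(LINT m|M. (\<Sum>(w, X)\<leftarrow>casimir. w * D X m)) = 0"
proof -
  have "integrable M (\<lambda>m. fst p * D (snd p) m) \<and> (LINT m|M. fst p * D (snd p) m) = 0"
    if "p \<in> set casimir" for p
    using assms[of "snd p"] unit_generator_casimir[of "fst p" "snd p"] that by simp
  then have "(LINT m|M. (\<Sum>p\<leftarrow>casimir. fst p * D (snd p) m)) = 0"
    using integral_sum_list_zero[of casimir M "\<lambda>p m. fst p * D (snd p) m"] by blast
  then show ?thesis by (simp only: case_prod_unfold)
qed

locale haar_USp4 =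
  fixes M :: "(complex^4^4) measure"
  assumes haar: "normalized_haar_measure USp4 M"
begin

lemma space_M: "space M = USp4"
  by (rule haar_space[OF haar])

lemma derivative_zero:
  assumes X: "unit_generator X" and h: "continuous_on UNIV h" and d: "continuous_on UNIV d"
    and ex: "expands USp4 (\<lambda>t m. h (one_param X t ** m)) d"
  shows "integrable M d \<and> integral\<^sup>L M d = 0"
proof
  show "integral\<^sup>L M d = 0"
    by (rule haar_derivative_zero[OF haar _ one_param_0 USp4_mult ex h d]) (rule one_param_USp4[OF X])
  from ex obtain C where "\<And>m. m \<in> USp4 \<Longrightarrow> norm (d m) \<le> C"
    by (rule expandsE) blast
  then show "integrable M d" by (rule haar_integrable[OF haar d])
qed

text \<open>The test function is \<open>trace m ^ a * trace (X ** m)\<close>, differentiated along X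
  itself. Up to a common factor 2, the square of \<open>trace (X ** m)\<close> contracts to 4 -
  Tr(m^2), because the symplectic adjoint of m is its inverse, and
  \<open>trace (X ** (X ** m))\<close> contracts to -5 Tr(m).\<close>

lemma schwinger_dyson_1:
  "(LINT m|M. of_nat a * trace m ^ (a - 1) * (4 - trace (m ** m)) - 5 * trace m ^ (a + 1)) = 0"
proof -
  define D where "D X m = of_nat a * trace m ^ (a - 1) * trace (X ** m) * trace (X ** m)
     + trace m ^ a * trace (X ** (X ** m))" for X m :: "complex^4^4"
  have "integrable M (D X) \<and> integral\<^sup>L M (D X) = 0" if X: "unit_generator X" for X
  proof (rule derivative_zero[OF X])
    have K: "mexpands USp4 (\<lambda>t m. one_param X t ** m) (\<lambda>m. X ** m)"
      by (rule mexpands_one_param)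
    show "expands USp4 (\<lambda>t m. trace (one_param X t ** m) ^ a * trace (X ** (one_param X t ** m))) (D X)"
      using expands_mult[OF expands_power[OF expands_trace[OF K], of a]
          expands_trace[OF mexpands_mult[OF mexpands_const[of _ X] K]]]
      by (simp add: D_def[abs_def] one_param_0 mult.assoc)
  qed (auto simp: D_def[abs_def] intro!: continuous_intros continuous_on_trace continuous_on_matrix_mult)
  then have "(LINT m|M. (\<Sum>(w, X)\<leftarrow>casimir. w * D X m)) = 0"
    by (rule integral_casimir_zero)
  moreover have eq: "(\<Sum>(w, X)\<leftarrow>casimir. w * D X m)
      = 2 * (of_nat a * trace m ^ (a - 1) * (4 - trace (m ** m)) - 5 * trace m ^ (a + 1))"
    if "m \<in> USp4" for m
  proof -
    have "(\<Sum>(w, X)\<leftarrow>casimir. w * D X m)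
      = of_nat a * trace m ^ (a - 1) * (\<Sum>(w, X)\<leftarrow>casimir. w * (trace (X ** m) * trace (X ** m)))
        + trace m ^ a * (\<Sum>(w, X)\<leftarrow>casimir. w * trace (X ** (X ** m)))"
      unfolding D_def sum_list_linear[symmetric] by (simp only: mult.assoc)
    also have "\<dots> = 2 * (of_nat a * trace m ^ (a - 1) * (4 - trace (m ** m)) - 5 * trace m ^ (a + 1))"
      unfolding casimir_tr_tr casimir_tr_sq symp_adj_USp4[OF that]
      by (simp add: trace_I algebra_simps)
    finally show ?thesis .
  qed
  have "(LINT m|M. 2 * (of_nat a * trace m ^ (a - 1) * (4 - trace (m ** m)) - 5 * trace m ^ (a + 1)))
      = (LINT m|M. (\<Sum>(w, X)\<leftarrow>casimir. w * D X m))"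
    by (rule Bochner_Integration.integral_cong[OF refl]) (simp only: space_M eq)
  ultimately show ?thesis by (simp only: integral_mult_right_zero) simp
qed

text \<open>The test function is now \<open>trace m ^ a * trace (X ** (m ** m))\<close>. Its last
  factor has two derivative terms: XXmm gives -10 Tr(m^2), while XmXm gives -2 (Tr(m)^2 + 4). The
  cross term gives Tr(m^(-2) m) - Tr(m^3), where the inverse of m has the same trace as m.\<close>

lemma schwinger_dyson_2:
  "(LINT m|M. of_nat a * trace m ^ (a - 1) * (trace m - trace (m ** m ** m))
     - 5 * (trace m ^ a * trace (m ** m)) - trace m ^ (a + 2) - 4 * trace m ^ a) = 0"
proof -
  define D where "D X m = of_nat a * trace m ^ (a - 1) * trace (X ** m) * trace (X ** (m ** m))
     + trace m ^ a * (trace (X ** (X ** (m ** m))) + trace (X ** (m ** (X ** m))))" for X m :: "complex^4^4"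
  have "integrable M (D X) \<and> integral\<^sup>L M (D X) = 0" if X: "unit_generator X" for X
  proof (rule derivative_zero[OF X])
    have K: "mexpands USp4 (\<lambda>t m. one_param X t ** m) (\<lambda>m. X ** m)"
      by (rule mexpands_one_param)
    show "expands USp4 (\<lambda>t m. trace (one_param X t ** m) ^ a
        * trace (X ** ((one_param X t ** m) ** (one_param X t ** m)))) (D X)"
      using expands_mult[OF expands_power[OF expands_trace[OF K], of a]
          expands_trace[OF mexpands_mult[OF mexpands_const[of _ X] mexpands_mult[OF K K]]]]
      by (simp add: D_def[abs_def] one_param_0 mult.assoc matrix_mult_bilinear trace_add matrix_mul_assoc)
  qed (auto simp: D_def[abs_def] intro!: continuous_intros continuous_on_trace continuous_on_matrix_mult)
  then have "(LINT m|M. (\<Sum>(w, X)\<leftarrow>casimir. w * D X m)) = 0"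
    by (rule integral_casimir_zero)
  moreover have eq: "(\<Sum>(w, X)\<leftarrow>casimir. w * D X m)
      = 2 * (of_nat a * trace m ^ (a - 1) * (trace m - trace (m ** m ** m))
     - 5 * (trace m ^ a * trace (m ** m)) - trace m ^ (a + 2) - 4 * trace m ^ a)"
    if "m \<in> USp4" for m
  proof -
    have 1: "trace (symp_adj (m ** m) ** m) = trace m"
      using symp_adj_USp4[OF that] by (simp add: symp_adj_mult trace_symp_adj flip: matrix_mul_assoc)
    have "(\<Sum>(w, X)\<leftarrow>casimir. w * D X m)
      = of_nat a * trace m ^ (a - 1) * (\<Sum>(w, X)\<leftarrow>casimir. w * (trace (X ** m) * trace (X ** (m ** m))))
        + trace m ^ a * ((\<Sum>(w, X)\<leftarrow>casimir. w * trace (X ** (X ** (m ** m))))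
            + (\<Sum>(w, X)\<leftarrow>casimir. w * trace (X ** (m ** (X ** m)))))"
      unfolding D_def sum_list_linear3[symmetric] by (simp only: mult.assoc)
    also have "\<dots> = 2 * (of_nat a * trace m ^ (a - 1) * (trace m - trace (m ** m ** m))
     - 5 * (trace m ^ a * trace (m ** m)) - trace m ^ (a + 2) - 4 * trace m ^ a)"
      unfolding casimir_tr_tr casimir_tr_sq casimir_tr_tensor 1 symp_adj_USp4[OF that]
      by (simp add: trace_I algebra_simps power2_eq_square power_add)
    finally show ?thesis .
  qed
  have "(LINT m|M. 2 * (of_nat a * trace m ^ (a - 1) * (trace m - trace (m ** m ** m))
     - 5 * (trace m ^ a * trace (m ** m)) - trace m ^ (a + 2) - 4 * trace m ^ a))
      = (LINT m|M. (\<Sum>(w, X)\<leftarrow>casimir. w * D X m))"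
    by (rule Bochner_Integration.integral_cong[OF refl]) (simp only: space_M eq)
  ultimately show ?thesis by (simp only: integral_mult_right_zero) simp
qed

definition moment :: "nat \<Rightarrow> complex" where
  "moment a = (LINT m|M. trace m ^ a)"

lemma norm_trace_le:
  assumes "m \<in> USp4"
  shows "norm (trace m) \<le> 4"
proof -
  have "norm (trace m) = \<bar>tau m\<bar>"
    unfolding of_real_tau[OF assms, symmetric] by (rule norm_of_real)
  then show ?thesis using tau_bounds[OF assms] by auto
qed

lemma integrable_trace_power: "integrable M (\<lambda>m. trace m ^ a)"
  by (rule haar_integrable[OF haar, of _ "4 ^ a"])
     (auto intro!: continuous_intros continuous_on_trace continuous_on_id power_mono norm_trace_le simp: norm_power)

lemma integrable_trace_power_sq: "integrable M (\<lambda>m. trace m ^ a * trace (m ** m))"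
proof (rule haar_integrable[OF haar, of _ "4 ^ a * 4"])
  fix m assume m: "m \<in> USp4"
  have "norm (trace (m ** m)) \<le> 4" by (intro norm_trace_le USp4_mult m)
  then show "norm (trace m ^ a * trace (m ** m)) \<le> 4 ^ a * 4"
    unfolding norm_mult norm_power by (intro mult_mono power_mono norm_trace_le m USp4_mult) auto
qed (intro continuous_intros continuous_on_trace continuous_on_id continuous_on_matrix_mult)

lemma integral_linear_combination:
  "(LINT m|M. c * trace m ^ i - d * (trace m ^ a * trace (m ** m)) - e * trace m ^ k)
    = c * moment i - d * (LINT m|M. trace m ^ a * trace (m ** m)) - e * moment k"
  by (simp add: moment_def integrable_trace_power integrable_trace_power_sq)

lemma moment_rec:
  "of_nat ((a + 6) * (a + 8)) * moment (a + 2) = of_nat (16 * (a + 1) * (a + 3)) * moment a"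
proof -
  define Q where "Q = (LINT m|M. trace m ^ a * trace (m ** m))"
  define n :: complex where "n = of_nat a"
  \<comment> \<open>The first equation is taken at a + 1, so that it contains the same unknown
    \<open>Q\<close> as the second equation at a.\<close>
  have "of_nat (a + 1) * x ^ (a + 1 - 1) * (4 - p) - 5 * x ^ (a + 1 + 1)
      = 4 * (n + 1) * x ^ a - (n + 1) * (x ^ a * p) - 5 * x ^ (a + 2)" for x p :: complex
    by (simp add: n_def algebra_simps)
  with schwinger_dyson_1[of "a + 1"]
  have "(LINT m|M. 4 * (n + 1) * trace m ^ a - (n + 1) * (trace m ^ a * trace (m ** m))
      - 5 * trace m ^ (a + 2)) = 0"
    by (simp only:)
  then have 1: "4 * (n + 1) * moment a - (n + 1) * Q - 5 * moment (a + 2) = 0"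
    by (simp only: integral_linear_combination Q_def)
  \<comment> \<open>The second equation after Newton's identity, with x for the trace of m and p for
    that of its square. The case a = 0 is separate because the exponent \<open>a - 1\<close> is
    truncated.\<close>
  have *: "n * x ^ (a - 1) * (x - (- (x ^ 3) + 3 * x * p + 6 * x) / 2) - 5 * (x ^ a * p) - x ^ (a + 2) - 4 * x ^ a
      = (n / 2 - 1) * x ^ (a + 2) - (3 / 2 * n + 5) * (x ^ a * p) - (2 * n + 4) * x ^ a"
    for x p :: complex
  proof (cases a)
    case 0
    then show ?thesis by (simp add: n_def)
  next
    case (Suc b)
    have "x ^ (a + 2) = x ^ b * (x * (x * x))" "x ^ a = x ^ b * x" "x ^ (a - 1) = x ^ b"
      by (simp_all add: Suc)
    then show ?thesis by (simp only: power3_eq_cube) (simp add: field_simps)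
  qed
  have "(LINT m|M. (n / 2 - 1) * trace m ^ (a + 2)
      - (3 / 2 * n + 5) * (trace m ^ a * trace (m ** m)) - (2 * n + 4) * trace m ^ a)
    = (LINT m|M. of_nat a * trace m ^ (a - 1) * (trace m - trace (m ** m ** m))
     - 5 * (trace m ^ a * trace (m ** m)) - trace m ^ (a + 2) - 4 * trace m ^ a)"
  proof (rule Bochner_Integration.integral_cong[OF refl])
    fix m assume "m \<in> space M"
    then have "trace (m ** m ** m) = (- (trace m ^ 3) + 3 * trace m * trace (m ** m) + 6 * trace m) / 2"
      using trace_cube_USp4[of m] unfolding space_M by (metis nonzero_mult_div_cancel_left zero_neq_numeral)
    then show "(n / 2 - 1) * trace m ^ (a + 2)
      - (3 / 2 * n + 5) * (trace m ^ a * trace (m ** m)) - (2 * n + 4) * trace m ^ a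
      = of_nat a * trace m ^ (a - 1) * (trace m - trace (m ** m ** m))
     - 5 * (trace m ^ a * trace (m ** m)) - trace m ^ (a + 2) - 4 * trace m ^ a"
      using *[of "trace m" "trace (m ** m)"] by (simp only: n_def)
  qed
  then have 2: "(n / 2 - 1) * moment (a + 2) - (3 / 2 * n + 5) * Q - (2 * n + 4) * moment a = 0"
    unfolding schwinger_dyson_2 by (simp only: integral_linear_combination Q_def)
  define P P' where "P = moment a" and "P' = moment (a + 2)"
  \<comment> \<open>The multipliers 2 (n + 1) and 3 n + 10 are chosen to cancel \<open>Q\<close>,
    whose coefficients are -(3/2 n + 5) and -(n + 1).\<close>
  have "2 * (n + 1) * ((n / 2 - 1) * P' - (3 / 2 * n + 5) * Q - (2 * n + 4) * P)
     - (3 * n + 10) * (4 * (n + 1) * P - (n + 1) * Q - 5 * P')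
    = (n + 6) * (n + 8) * P' - 16 * (n + 1) * (n + 3) * P"
    by (simp add: field_simps)
  then have "(n + 6) * (n + 8) * P' - 16 * (n + 1) * (n + 3) * P = 0"
    using 1 2 by (simp only: P_def P'_def) simp
  then show ?thesis by (simp add: n_def P_def P'_def)
qed

lemma moment_0: "moment 0 = 1"
proof -
  interpret prob_space M using haar by (simp add: normalized_haar_measure_def)
  show ?thesis by (simp add: moment_def prob_space)
qed

lemma moment_odd:
  assumes "odd a"
  shows "moment a = 0"
proof -
  have "(LINT m|M. trace (- m) ^ a) = moment a"
    unfolding moment_def
    by (rule haar_uminus[OF haar]) (intro continuous_intros continuous_on_trace continuous_on_id)
  moreover have "trace (- m) = - trace m" for m :: "complex^4^4"
    by (simp add: trace_def sum_negf)
  ultimately show ?thesis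
    using assms by (simp add: moment_def power_minus_odd)
qed

end

section \<open>Bounds for the quotient of Gamma functions\<close>

lemma norm_Gamma_series:
  "norm (Gamma_series z n) = fact n * exp (Re z * ln (real n)) / (\<Prod>k<n+1. norm (z + of_nat k))"
  for z :: complex
proof -
  have "norm (pochhammer z (n + 1)) = (\<Prod>k<n+1. norm (z + of_nat k))"
    unfolding pochhammer_prod atLeast0LessThan by (rule prod_norm[symmetric])
  then show ?thesis by (simp add: Gamma_series_def norm_divide norm_mult norm_fact)
qed

lemma Gamma_series_real:
  "Gamma_series x n = fact n * exp (x * ln (real n)) / (\<Prod>k<n+1. x + real k)" for x :: real
  unfolding Gamma_series_def pochhammer_prod atLeast0LessThan by simp

text \<open>Each factor of Euler's product satisfies \<open>\<bar>1 + a / (s + k)\<bar> \<le> 1 + a / (c + k)\<close>.\<close>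

lemma Gamma_ratio_le:
  fixes s :: complex and a c :: real
  assumes c: "c > 0" and a: "a \<ge> 0" and s: "Re s \<ge> c"
  shows "norm (Gamma s) * Gamma (c + a) \<le> Gamma c * norm (Gamma (s + of_real a))"
proof (rule LIMSEQ_le)
  show "(\<lambda>n. norm (Gamma_series s n) * Gamma_series (c + a) n) \<longlonglongrightarrow> norm (Gamma s) * Gamma (c + a)"
    by (intro tendsto_intros Gamma_series_LIMSEQ)
  show "(\<lambda>n. Gamma_series c n * norm (Gamma_series (s + of_real a) n)) \<longlonglongrightarrow> Gamma c * norm (Gamma (s + of_real a))"
    by (intro tendsto_intros Gamma_series_LIMSEQ)
  have "norm (Gamma_series s n) * Gamma_series (c + a) n \<le> Gamma_series c n * norm (Gamma_series (s + of_real a) n)" for n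
  proof -
    \<comment> \<open>Since Re s + (c + a) = c + Re (s + a), both sides carry the same power of n;
      only the finite products are left to compare.\<close>
    define E where "E = exp ((Re s + c + a) * ln (real n))"
    have E: "E = exp (Re s * ln (real n)) * exp ((c + a) * ln (real n))"
      "E = exp (c * ln (real n)) * exp (Re (s + of_real a) * ln (real n))"
      by (simp_all add: E_def algebra_simps flip: exp_add)
    define P where "P z = (\<Prod>k<n+1. norm (z + of_nat k))" for z :: complex
    define R where "R x = (\<Prod>k<n+1. x + real k)" for x :: real
    have pos: "norm (s + of_nat k) > 0" "norm (s + of_real a + of_nat k) > 0" "c + a + real k > 0" "c + real k > 0" for k
    proof -
      have "Re (s + of_nat k) > 0" "Re (s + of_real a + of_nat k) > 0" using c a s by simp_all
      then show "norm (s + of_nat k) > 0" "norm (s + of_real a + of_nat k) > 0"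
        by (metis complex_Re_le_cmod order_less_le_trans)+
    qed (use c a in auto)
    have Ppos: "P s > 0" "P (s + of_real a) > 0" "R (c + a) > 0" "R c > 0"
      unfolding P_def R_def by (intro prod_pos ballI pos)+
    have le: "R c * P (s + of_real a) \<le> P s * R (c + a)"
      unfolding R_def P_def prod.distrib[symmetric]
    proof (rule prod_mono, intro conjI)
      fix k
      have 1: "norm (s + of_real a + of_nat k) \<le> norm (s + of_nat k) + a"
        using norm_triangle_ineq[of "s + of_nat k" "of_real a"] a by (simp add: algebra_simps)
      have "c + real k \<le> Re (s + of_nat k)" using s by simp
      also have "\<dots> \<le> norm (s + of_nat k)" by (rule complex_Re_le_cmod)
      finally have 2: "(c + real k) * a \<le> norm (s + of_nat k) * a" using a by (intro mult_right_mono) auto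
      have "(c + real k) * norm (s + of_real a + of_nat k) \<le> (c + real k) * (norm (s + of_nat k) + a)"
        using c by (intro mult_left_mono 1) auto
      also have "\<dots> \<le> norm (s + of_nat k) * (c + a + real k)"
        using 2 by (simp add: algebra_simps)
      finally show "(c + real k) * norm (s + of_real a + of_nat k) \<le> norm (s + of_nat k) * (c + a + real k)" .
      show "0 \<le> (c + real k) * norm (s + of_real a + of_nat k)" using c by simp
    qed
    have "norm (Gamma_series s n) * Gamma_series (c + a) n = (fact n)\<^sup>2 * E / (P s * R (c + a))"
      unfolding norm_Gamma_series Gamma_series_real P_def[symmetric] R_def[symmetric] E(1)
      by (simp add: power2_eq_square)
    also have "\<dots> \<le> (fact n)\<^sup>2 * E / (R c * P (s + of_real a))"
      using le Ppos by (intro divide_left_mono) (auto simp: E_def)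
    also have "\<dots> = Gamma_series c n * norm (Gamma_series (s + of_real a) n)"
      unfolding norm_Gamma_series Gamma_series_real P_def[symmetric] R_def[symmetric] E(2)
      by (simp add: power2_eq_square)
    finally show ?thesis .
  qed
  then show "\<exists>N. \<forall>n\<ge>N. norm (Gamma_series s n) * Gamma_series (c + a) n
      \<le> Gamma_series c n * norm (Gamma_series (s + of_real a) n)" by blast
qed

lemma nonpos_Ints_ReIm:
  assumes "s \<in> \<int>\<^sub>\<le>\<^sub>0"
  shows "Re s \<le> 0" "Im s = 0"
proof -
  obtain n where "s = - of_nat n" using assms by (elim nonpos_Ints_cases')
  then show "Re s \<le> 0" "Im s = 0" by simp_all
qed

lemma Gamma_neq_zero_Re_pos: "Re s > 0 \<Longrightarrow> Gamma s \<noteq> 0" for s :: complex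
  using nonpos_Ints_ReIm(1)[of s] by (auto simp: Gamma_eq_zero_iff)

lemma norm_Gamma_ratio_le:
  fixes s :: complex and a c :: real
  assumes "c > 0" "a \<ge> 0" "Re s \<ge> c"
  shows "norm (Gamma s / Gamma (s + of_real a)) \<le> Gamma c / Gamma (c + a)"
proof -
  have "Gamma (s + of_real a) \<noteq> 0" using assms by (intro Gamma_neq_zero_Re_pos) auto
  moreover have "Gamma (c + a) > 0" using assms by (intro Gamma_real_pos) auto
  ultimately show ?thesis
    using Gamma_ratio_le[OF assms] by (simp add: norm_divide field_simps)
qed

definition gamma_quot :: "complex \<Rightarrow> complex" where
  "gamma_quot s = Gamma s * Gamma (s + 1) / (Gamma (s + 5/2) * Gamma (s + 7/2))"

text \<open>The true decay is of order |s|^(-5), but two powers already give absolute convergence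
  and make far segments negligible. They come from Gamma(s) = Gamma(s + 2) / (s (s + 1)), after
  which the quotients with shifts 1/2 and 5/2 are merely bounded.\<close>

lemma gamma_quot_bound:
  assumes c: "c > 0"
  obtains K where "K \<ge> 0" "\<And>s. Re s \<ge> c \<Longrightarrow> norm (gamma_quot s) \<le> K / (norm s)\<^sup>2"
proof
  define K1 K2 where "K1 = Gamma (c + 2) / Gamma (c + 2 + 1/2)" and "K2 = Gamma (c + 1) / Gamma (c + 1 + 5/2)"
  have K: "K1 \<ge> 0" "K2 \<ge> 0"
    unfolding K1_def K2_def using c by (auto intro!: divide_nonneg_nonneg Gamma_real_nonneg less_imp_le[OF Gamma_real_pos])
  then show "K1 * K2 \<ge> 0" by simp
  fix s :: complex assume s: "Re s \<ge> c"
  have np: "s \<notin> \<int>\<^sub>\<le>\<^sub>0" "s + 1 \<notin> \<int>\<^sub>\<le>\<^sub>0"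
    using s c nonpos_Ints_ReIm(1)[of s] nonpos_Ints_ReIm(1)[of "s + 1"] by auto
  have nz: "norm s > 0" using s c by auto
  have "Gamma (s + 2) = (s + 1) * s * Gamma s"
    using Gamma_plus1[OF np(1)] Gamma_plus1[OF np(2)] by (simp add: add.assoc)
  moreover have nz1: "s + 1 \<noteq> 0" using s c by (auto simp: complex_eq_iff)
  ultimately have G: "Gamma s = Gamma (s + 2) / (s * (s + 1))" using nz by simp
  have b1: "norm (Gamma (s + 2) / Gamma (s + 5/2)) \<le> K1"
    using norm_Gamma_ratio_le[of "c + 2" "1/2" "s + 2"] s c by (simp add: K1_def add.assoc)
  have b2: "norm (Gamma (s + 1) / Gamma (s + 7/2)) \<le> K2"
    using norm_Gamma_ratio_le[of "c + 1" "5/2" "s + 1"] s c by (simp add: K2_def add.assoc)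
  have "gamma_quot s = (Gamma (s + 2) / Gamma (s + 5/2)) * (Gamma (s + 1) / Gamma (s + 7/2)) / (s * (s + 1))"
    unfolding gamma_quot_def by (subst G) simp
  then have "norm (gamma_quot s) = norm (Gamma (s + 2) / Gamma (s + 5/2)) * norm (Gamma (s + 1) / Gamma (s + 7/2)) / (norm s * norm (s + 1))"
    by (simp add: norm_mult norm_divide)
  also have "\<dots> \<le> K1 * K2 / (norm s * norm (s + 1))"
    using b1 b2 K by (intro divide_right_mono mult_mono) auto
  also have "\<dots> \<le> K1 * K2 / (norm s)\<^sup>2"
  proof (rule divide_left_mono)
    have "norm s \<le> norm (s + 1)"
      using s c by (auto simp: cmod_def power2_eq_square algebra_simps)
    then show "(norm s)\<^sup>2 \<le> norm s * norm (s + 1)"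
      using nz by (simp add: power2_eq_square)
    have "norm (s + 1) > 0" using nz1 by simp
    then show "0 < norm s * norm (s + 1) * (norm s)\<^sup>2" using nz by simp
  qed (use K in auto)
  finally show "norm (gamma_quot s) \<le> K1 * K2 / (norm s)\<^sup>2" .
qed

text \<open>One identity for two purposes: it carries the decay to the left of the imaginary axis,
  and at s = (a + 1) / 2 it becomes the recursion of the moments.\<close>

lemma gamma_quot_plus1:
  assumes "Re s > 0 \<or> Im s \<noteq> 0"
  shows "gamma_quot s = gamma_quot (s + 1) * (((s + 5/2) / s) * ((s + 7/2) / (s + 1)))"
proof -
  have np: "s \<notin> \<int>\<^sub>\<le>\<^sub>0" "s + 1 \<notin> \<int>\<^sub>\<le>\<^sub>0" "s + 5/2 \<notin> \<int>\<^sub>\<le>\<^sub>0" "s + 7/2 \<notin> \<int>\<^sub>\<le>\<^sub>0"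
    using assms by (auto dest: nonpos_Ints_ReIm)
  have nz: "s \<noteq> 0" "s + 1 \<noteq> 0" "s + 5/2 \<noteq> 0" "s + 7/2 \<noteq> 0" using np by auto
  have g: "Gamma (s + 1) = s * Gamma s" "Gamma (s + 1 + 1) = (s + 1) * Gamma (s + 1)"
    "Gamma (s + 1 + 5/2) = (s + 5/2) * Gamma (s + 5/2)" "Gamma (s + 1 + 7/2) = (s + 7/2) * Gamma (s + 7/2)"
    using Gamma_plus1[OF np(1)] Gamma_plus1[OF np(2)] Gamma_plus1[OF np(3)] Gamma_plus1[OF np(4)]
    by (simp_all add: add_ac)
  have *: "a * (s * a) / (b * d) = (s * a) * (t * (s * a)) / ((p * b) * (q * d)) * ((p / s) * (q / t))"
    if "s \<noteq> 0" "t \<noteq> 0" "p \<noteq> 0" "q \<noteq> 0" "b \<noteq> 0" "d \<noteq> 0" for a b d p q s t :: complex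
    using that by (simp add: divide_simps)
  have gnz: "Gamma (s + 5/2) \<noteq> 0" "Gamma (s + 7/2) \<noteq> 0"
    using np by (auto simp: Gamma_eq_zero_iff)
  show ?thesis unfolding gamma_quot_def g(2-4) unfolding g(1) by (rule *) (use nz gnz in auto)
qed

text \<open>The straight ends of a Mellin--Barnes contour may have any abscissa, so decay is wanted
  in every right half-plane, away from the poles on the real axis. Each unit step to the left costs
  the factors (w + 5/2) / w with w = s and w = s + 1, of modulus at most 4 when |Im w| >= 1.\<close>

lemma gamma_quot_strip_aux:
  "\<exists>K\<ge>0. \<forall>s. Re s \<ge> 1/4 - real N \<and> \<bar>Im s\<bar> \<ge> 1 \<longrightarrow> norm (gamma_quot s) \<le> K / (Im s)\<^sup>2"
proof (induction N)
  case 0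
  obtain K where K: "K \<ge> 0" "\<And>s. Re s \<ge> 1/4 \<Longrightarrow> norm (gamma_quot s) \<le> K / (norm s)\<^sup>2"
    using gamma_quot_bound[of "1/4"] by auto
  show ?case
  proof (intro exI[of _ K] conjI allI impI K(1))
    fix s assume s: "1/4 - real 0 \<le> Re s \<and> 1 \<le> \<bar>Im s\<bar>"
    have "norm (gamma_quot s) \<le> K / (norm s)\<^sup>2" using K(2)[of s] s by simp
    also have "(Im s)\<^sup>2 \<le> (norm s)\<^sup>2" using abs_Im_le_cmod[of s] by (metis abs_le_square_iff abs_norm_cancel)
    then have "K / (norm s)\<^sup>2 \<le> K / (Im s)\<^sup>2"
    proof (rule divide_left_mono)
      have "Im s \<noteq> 0" "s \<noteq> 0" using s by auto
      then show "0 < (norm s)\<^sup>2 * (Im s)\<^sup>2" by simp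
    qed (rule K(1))
    finally show "norm (gamma_quot s) \<le> K / (Im s)\<^sup>2" .
  qed
next
  case (Suc N)
  then obtain K where K: "K \<ge> 0" "\<And>s. Re s \<ge> 1/4 - real N \<Longrightarrow> \<bar>Im s\<bar> \<ge> 1 \<Longrightarrow> norm (gamma_quot s) \<le> K / (Im s)\<^sup>2"
    by blast
  show ?case
  proof (intro exI[of _ "K * (4 * 4)"] conjI allI impI)
    fix s assume s: "1/4 - real (Suc N) \<le> Re s \<and> 1 \<le> \<bar>Im s\<bar>"
    have q: "norm ((w + 5/2) / w) \<le> 4" if "\<bar>Im w\<bar> \<ge> 1" for w :: complex
    proof -
      have w: "norm w \<ge> 1" using that abs_Im_le_cmod[of w] by linarith
      have "norm (w + 5/2) \<le> norm w + 5/2" using norm_triangle_ineq[of w "5/2"] by simp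
      then have "norm (w + 5/2) \<le> 4 * norm w" using w by linarith
      moreover have "norm w > 0" using w by linarith
      ultimately show ?thesis unfolding norm_divide by (simp add: divide_le_eq)
    qed
    have "norm (gamma_quot s) = norm (gamma_quot (s + 1)) * (norm ((s + 5/2) / s) * norm ((s + 1 + 5/2) / (s + 1)))"
      by (subst gamma_quot_plus1) (use s in \<open>auto simp: norm_mult norm_divide add_ac\<close>)
    also have "\<dots> \<le> K / (Im (s + 1))\<^sup>2 * (4 * 4)"
      using K(2)[of "s + 1"] s q[of s] q[of "s + 1"] K(1) by (intro mult_mono) auto
    finally show "norm (gamma_quot s) \<le> K * (4 * 4) / (Im s)\<^sup>2" by simp
  qed (use K in auto)
qed

lemma gamma_quot_strip:
  obtains K where "K \<ge> 0" "\<And>s. Re s \<ge> a \<Longrightarrow> \<bar>Im s\<bar> \<ge> 1 \<Longrightarrow> norm (gamma_quot s) \<le> K / (Im s)\<^sup>2"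
proof -
  obtain N :: nat where "real N \<ge> 1/4 - a" using real_arch_simple by blast
  then have N: "1/4 - real N \<le> a" by linarith
  obtain K where "K \<ge> 0" "\<forall>s. Re s \<ge> 1/4 - real N \<and> \<bar>Im s\<bar> \<ge> 1 \<longrightarrow> norm (gamma_quot s) \<le> K / (Im s)\<^sup>2"
    using gamma_quot_strip_aux by blast
  with N show thesis by (meson order_trans that)
qed

text \<open>Through the entire function \<open>rGamma\<close> the denominator imposes no
  restriction: the conventions \<open>Gamma\<close> = 0 at a pole and x / 0 = 0 reproduce exactly
  the zeros of \<open>rGamma\<close>.\<close>

lemma gamma_quot_holomorphic:
  assumes "S \<inter> \<int>\<^sub>\<le>\<^sub>0 = {}"
  shows "gamma_quot holomorphic_on S"
proof -
  have "s + 1 \<notin> \<int>\<^sub>\<le>\<^sub>0" if "s \<in> S" for s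
  proof
    assume "s + 1 \<in> \<int>\<^sub>\<le>\<^sub>0"
    then obtain n where "s + 1 = - of_nat n" by (elim nonpos_Ints_cases')
    then have "s = - of_nat (Suc n)" by (simp add: algebra_simps eq_neg_iff_add_eq_0)
    then have "s \<in> \<int>\<^sub>\<le>\<^sub>0" by (metis minus_of_nat_in_nonpos_Ints)
    then show False using assms that by auto
  qed
  then have "(\<lambda>s. Gamma s * Gamma (s + 1) * (rGamma (s + 5/2) * rGamma (s + 7/2))) holomorphic_on S"
    by (intro holomorphic_on_mult holomorphic_Gamma' holomorphic_rGamma' holomorphic_on_add
          holomorphic_on_ident holomorphic_on_const) (use assms in blast)+
  moreover have "gamma_quot = (\<lambda>s. Gamma s * Gamma (s + 1) * (rGamma (s + 5/2) * rGamma (s + 7/2)))"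
    by (rule ext) (simp only: gamma_quot_def rGamma_inverse_Gamma divide_inverse inverse_mult_distrib)
  ultimately show ?thesis by simp
qed

lemma continuous_on_gamma_quot_line:
  assumes "c > 0"
  shows "continuous_on UNIV (\<lambda>t. gamma_quot (Complex c t))"
proof -
  have "{s. Re s > 0} \<inter> \<int>\<^sub>\<le>\<^sub>0 = {}" by (auto dest: nonpos_Ints_ReIm(1))
  then have "continuous_on {s. Re s > 0} gamma_quot"
    by (intro holomorphic_on_imp_continuous_on gamma_quot_holomorphic)
  moreover have "continuous_on UNIV (Complex c)"
    unfolding Complex_eq by (intro continuous_intros)
  ultimately show ?thesis
    by (rule continuous_on_compose2) (use assms in auto)
qed

section \<open>Contours with vertical ends\<close>

text \<open>Conditional convergence is covered, since the Henstock--Kurzweil integral over the line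
  is itself a limit over intervals that contain large balls.\<close>

lemma tendsto_symmetric_integral:
  fixes f :: "real \<Rightarrow> complex"
  assumes "(f has_integral w) UNIV"
  shows "((\<lambda>T. integral {-T..T} f) \<longlongrightarrow> w) at_top"
proof (rule tendstoI)
  fix e :: real assume "e > 0"
  then obtain B where B: "B > 0" "\<And>a b. ball 0 B \<subseteq> cbox a b \<Longrightarrow>
      \<exists>z. (f has_integral z) (cbox a b) \<and> norm (z - w) < e"
    using assms unfolding has_integral'[of f w UNIV] by (simp del: ball_eq_greaterThanLessThan) blast
  show "\<forall>\<^sub>F T in at_top. dist (integral {-T..T} f) w < e"
    using eventually_ge_at_top[of B]
  proof eventually_elim
    case (elim T)
    then have "ball 0 B \<subseteq> cbox (-T) T" by (auto simp: dist_real_def)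
    from B(2)[OF this] show ?case by (auto simp: dist_norm dest!: integral_unique)
  qed
qed

lemma vector_derivative_vertical_line: "vector_derivative (vertical_line c) (at t) = \<i>"
proof -
  have "((\<lambda>t. of_real c + \<i> * of_real t) has_vector_derivative \<i>) (at t)"
    by (auto intro!: derivative_eq_intros simp: has_vector_derivative_def scaleR_conv_of_real algebra_simps)
  moreover have "vertical_line c = (\<lambda>t. of_real c + \<i> * of_real t)"
    by (rule ext) (simp add: vertical_line_def Complex_eq)
  ultimately show ?thesis by (simp add: vector_derivative_at)
qed

lemma vertical_line_differentiable: "vertical_line c differentiable at t"
proof -
  have "vertical_line c = (\<lambda>t. of_real c + \<i> * of_real t)"
    by (rule ext) (simp add: vertical_line_def Complex_eq)
  then show ?thesis by (auto intro!: derivative_intros)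
qed

locale straight_ends =
  fixes \<gamma> :: "real \<Rightarrow> complex" and c R :: real
  assumes R: "R \<ge> 0" and pw: "\<gamma> piecewise_C1_differentiable_on {-R..R}"
    and ends: "\<And>t. \<bar>t\<bar> \<ge> R \<Longrightarrow> \<gamma> t = Complex c t"
begin

lemma C1_outside: "\<gamma> C1_differentiable_on {t. \<bar>t\<bar> > R}"
proof -
  have op: "open {t :: real. \<bar>t\<bar> > R}" by (intro open_Collect_less continuous_intros)
  have "(\<gamma> has_vector_derivative \<i>) (at t)" if "\<bar>t\<bar> > R" for t
  proof -
    have "(vertical_line c has_vector_derivative \<i>) (at t)"
      using vertical_line_differentiable[of c t] vector_derivative_works vector_derivative_vertical_line
      by metis
    then show ?thesis
      by (rule has_vector_derivative_transform_within_open[OF _ op]) (use that in \<open>auto simp: ends vertical_line_def\<close>)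
  qed
  then show ?thesis
    unfolding C1_differentiable_on_def by (intro exI[of _ "\<lambda>_. \<i>"]) auto
qed

lemma continuous: "continuous_on UNIV \<gamma>"
proof -
  have "continuous_on {-R..R} \<gamma>"
    using pw by (simp add: piecewise_C1_differentiable_on_def)
  moreover have "continuous_on {t. \<bar>t\<bar> \<ge> R} \<gamma>"
  proof -
    have "continuous_on {t. \<bar>t\<bar> \<ge> R} (Complex c)"
      unfolding Complex_eq by (intro continuous_intros)
    then show ?thesis by (rule continuous_on_eq) (simp add: ends)
  qed
  moreover have "closed {t :: real. \<bar>t\<bar> \<ge> R}" by (intro closed_Collect_le continuous_intros)
  ultimately have "continuous_on ({-R..R} \<union> {t. \<bar>t\<bar> \<ge> R}) \<gamma>"
    by (intro continuous_on_closed_Un) auto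
  moreover have "{-R..R} \<union> {t. \<bar>t\<bar> \<ge> R} = UNIV" by auto
  ultimately show ?thesis by simp
qed

lemma piecewise_C1: "\<gamma> piecewise_C1_differentiable_on {-T..T}"
proof -
  obtain S where S: "finite S" "\<gamma> C1_differentiable_on {-R..R} - S"
    using pw by (auto simp: piecewise_C1_differentiable_on_def)
  define A where "A = {-R<..<R} - S"
  define B where "B = {t. \<bar>t\<bar> > R}"
  have op: "open A" "open B"
    unfolding A_def B_def using S(1)
    by (auto intro!: open_Diff finite_imp_closed open_Collect_less continuous_intros)
  have "\<gamma> C1_differentiable_on A"
    using S(2) by (rule C1_differentiable_on_subset) (auto simp: A_def)
  then have "\<gamma> C1_differentiable_on A \<union> B"
    using C1_outside op unfolding C1_differentiable_on_eq B_def[symmetric]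
    by (auto intro!: continuous_on_open_Un)
  \<comment> \<open>The curve may have corners where the vertical ends are attached, so R and -R
    join the exceptional points.\<close>
  then have "\<gamma> C1_differentiable_on {-T..T} - (S \<union> {-R, R})"
    by (rule C1_differentiable_on_subset) (auto simp: A_def B_def)
  then show ?thesis
    unfolding piecewise_C1_differentiable_on_def using S(1) continuous
    by (auto intro!: exI[of _ "S \<union> {-R, R}"] intro: continuous_on_subset)
qed

section \<open>Loops that close the contour on the right\<close>

definition arc :: "real \<Rightarrow> real \<Rightarrow> complex" where
  "arc T = (\<lambda>u. \<gamma> (2 * T * u - T))"

text \<open>The contour between the heights -T and T, closed by three sides of a rectangle that
  reaches Re s = D. For large D and T the poles to the left of the contour stay outside.\<close>

definition loop :: "real \<Rightarrow> real \<Rightarrow> real \<Rightarrow> complex" where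
  "loop D T = arc T +++ linepath (Complex c T) (Complex D T) +++
     linepath (Complex D T) (Complex D (-T)) +++ linepath (Complex D (-T)) (Complex c (-T))"

lemma arc_image: "T > 0 \<Longrightarrow> (\<lambda>u. 2 * T * u - T) ` {0..1} = {-T..T}" for T :: real
  using image_affinity_atLeastAtMost[of "2 * T" "-T" 0 1] by simp

lemma path_image_arc: "T > 0 \<Longrightarrow> path_image (arc T) = \<gamma> ` {-T..T}"
  unfolding path_image_def arc_def arc_image[symmetric] image_image ..

lemma valid_path_arc:
  assumes "T > 0"
  shows "valid_path (arc T)"
proof -
  have "\<gamma> \<circ> (\<lambda>u. (2 * T) *\<^sub>R u + (- T)) piecewise_C1_differentiable_on {0..1}"
    by (rule piecewise_C1_differentiable_affine)
       (use assms piecewise_C1[of T] arc_image[of T] in auto)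
  then show ?thesis by (simp add: valid_path_def arc_def o_def)
qed

lemma arc_ends:
  assumes "T > R"
  shows "pathstart (arc T) = Complex c (-T)" "pathfinish (arc T) = Complex c T"
  using assms R ends[of T] ends[of "-T"] by (auto simp: arc_def pathstart_def pathfinish_def)

lemma has_contour_integral_arc:
  assumes "T > 0" and "((\<lambda>t. F (\<gamma> t) * vector_derivative \<gamma> (at t)) has_integral w) {-T..T}"
  shows "(F has_contour_integral w) (arc T)"
proof -
  define h where "h t = F (\<gamma> t) * vector_derivative \<gamma> (at t)" for t
  have "((\<lambda>u. h ((2 * T) *\<^sub>R u + (- T))) has_integral (w /\<^sub>R (2 * T) ^ DIM(real)))
      (cbox ((- T - - T) /\<^sub>R (2 * T)) ((T - - T) /\<^sub>R (2 * T)))"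
  proof (rule has_integral_affinity')
    show "(h has_integral w) (cbox (- T) T)"
    proof -
      have "h = (\<lambda>t. F (\<gamma> t) * vector_derivative \<gamma> (at t))" by (rule ext) (rule h_def)
      then show ?thesis using assms(2) by simp
    qed
  qed (use assms(1) in simp)
  then have "((\<lambda>u. h (2 * T * u - T)) has_integral w / of_real (2 * T)) {0..1}"
  proof -
    have "w /\<^sub>R (2 * T) ^ DIM(real) = w / of_real (2 * T)"
      unfolding DIM_real power_one_right scaleR_conv_of_real of_real_inverse divide_inverse
      by (rule mult.commute)
    moreover have "(- T - - T) /\<^sub>R (2 * T) = 0" "(T - - T) /\<^sub>R (2 * T) = 1"
      using assms(1) by simp_all
    ultimately show ?thesis
      using \<open>((\<lambda>u. h ((2 * T) *\<^sub>R u + (- T))) has_integral _) _\<close>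
      by (simp only: cbox_interval real_scaleR_def add_uminus_conv_diff)
  qed
  then have "((\<lambda>u. of_real (2 * T) * h (2 * T * u - T)) has_integral of_real (2 * T) * (w / of_real (2 * T))) {0..1}"
    by (rule has_integral_mult_right)
  then have 1: "((\<lambda>u. of_real (2 * T) * h (2 * T * u - T)) has_integral w) {0..1}"
    using assms by simp
  obtain S where S: "finite S" "\<gamma> C1_differentiable_on {-T..T} - S"
    using piecewise_C1[of T] by (auto simp: piecewise_C1_differentiable_on_def)
  define S' where "S' = (\<lambda>t. (t + T) / (2 * T)) ` S"
  have "((\<lambda>u. F (arc T u) * vector_derivative (arc T) (at u)) has_integral w) {0..1}"
  proof (rule has_integral_spike_finite[OF _ _ 1])
    show "finite S'" using S by (simp add: S'_def)
    fix u assume u: "u \<in> {0..1} - S'"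
    have "2 * T * u - T \<notin> S"
    proof
      assume "2 * T * u - T \<in> S"
      then have "(2 * T * u - T + T) / (2 * T) \<in> S'" unfolding S'_def by (rule imageI)
      then show False using u assms by simp
    qed
    moreover have "2 * T * u - T \<in> {-T..T}"
      using u assms arc_image[of T] by blast
    ultimately have "\<gamma> differentiable at (2 * T * u - T)"
      using S(2) by (auto simp: C1_differentiable_on_eq)
    then have "(\<gamma> has_vector_derivative vector_derivative \<gamma> (at (2 * T * u - T))) (at (2 * T * u - T))"
      by (simp add: vector_derivative_works)
    moreover have "((\<lambda>u. 2 * T * u - T) has_vector_derivative 2 * T) (at u)"
      by (auto intro!: derivative_eq_intros simp: has_vector_derivative_def)
    ultimately have "((\<gamma> \<circ> (\<lambda>u. 2 * T * u - T)) has_vector_derivative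
        (2 * T) *\<^sub>R vector_derivative \<gamma> (at (2 * T * u - T))) (at u)"
      by (intro vector_diff_chain_at)
    then have "vector_derivative (arc T) (at u) = (2 * T) *\<^sub>R vector_derivative \<gamma> (at (2 * T * u - T))"
      unfolding arc_def by (intro vector_derivative_at) (simp add: o_def)
    then show "F (arc T u) * vector_derivative (arc T) (at u) = of_real (2 * T) * h (2 * T * u - T)"
      by (simp add: h_def arc_def scaleR_conv_of_real)
  qed
  then show ?thesis by (simp add: has_contour_integral)
qed

lemma loop_props:
  assumes "T > R"
  shows "valid_path (loop D T)" "pathfinish (loop D T) = pathstart (loop D T)"
    "path_image (loop D T) = \<gamma> ` {-T..T} \<union> closed_segment (Complex c T) (Complex D T)
       \<union> closed_segment (Complex D T) (Complex D (-T)) \<union> closed_segment (Complex D (-T)) (Complex c (-T))"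
proof -
  have T: "T > 0" using assms R by simp
  show "valid_path (loop D T)" "pathfinish (loop D T) = pathstart (loop D T)"
    unfolding loop_def using arc_ends[OF assms] valid_path_arc[OF T]
    by (auto intro!: valid_path_join)
  show "path_image (loop D T) = \<gamma> ` {-T..T} \<union> closed_segment (Complex c T) (Complex D T)
       \<union> closed_segment (Complex D T) (Complex D (-T)) \<union> closed_segment (Complex D (-T)) (Complex c (-T))"
    unfolding loop_def using arc_ends[OF assms]
    by (simp add: path_image_join path_image_arc[OF T] Un_assoc)
qed

text \<open>The complement is then open, which turns the connected components in
  \<open>left_of\<close> into path components.\<close>

lemma closed_range: "closed (range \<gamma>)"
proof -
  have "closed (\<gamma> ` {-R..R})"
    using continuous by (intro compact_imp_closed compact_continuous_image) (auto intro: continuous_on_subset)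
  moreover have "closed {s. Re s = c \<and> R \<le> \<bar>Im s\<bar>}"
    by (intro closed_Collect_conj closed_Collect_eq closed_Collect_le continuous_intros)
  moreover have "range \<gamma> = \<gamma> ` {-R..R} \<union> {s. Re s = c \<and> R \<le> \<bar>Im s\<bar>}"
  proof (intro equalityI subsetI)
    fix s assume "s \<in> range \<gamma>"
    then obtain t where t: "s = \<gamma> t" by blast
    show "s \<in> \<gamma> ` {-R..R} \<union> {s. Re s = c \<and> R \<le> \<bar>Im s\<bar>}"
    proof (cases "\<bar>t\<bar> \<ge> R")
      case True
      then show ?thesis using ends[OF True] t by simp
    next
      case False
      then have "t \<in> {-R..R}" by auto
      then show ?thesis using t by blast
    qed
  next
    fix s assume "s \<in> \<gamma> ` {-R..R} \<union> {s. Re s = c \<and> R \<le> \<bar>Im s\<bar>}"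
    then show "s \<in> range \<gamma>"
    proof
      assume "s \<in> {s. Re s = c \<and> R \<le> \<bar>Im s\<bar>}"
      then have "\<gamma> (Im s) = s" using ends[of "Im s"] by (auto simp: complex_eq_iff)
      then show ?thesis by (metis rangeI)
    qed auto
  qed
  ultimately show ?thesis by (simp add: closed_Un)
qed

lemma Re_bounded_below: "\<exists>b. \<forall>t. b \<le> Re (\<gamma> t)"
proof -
  have "compact (\<gamma> ` {-R..R})"
    using continuous by (intro compact_continuous_image) (auto intro: continuous_on_subset)
  then obtain B where B: "\<And>t. t \<in> {-R..R} \<Longrightarrow> norm (\<gamma> t) \<le> B"
    by (force dest: compact_imp_bounded simp: bounded_iff)
  have "min c (- B) \<le> Re (\<gamma> t)" for t
  proof (cases "\<bar>t\<bar> \<ge> R")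
    case True
    then show ?thesis using ends[OF True] by simp
  next
    case False
    then have "norm (\<gamma> t) \<le> B" by (intro B) auto
    then show ?thesis using abs_Re_le_cmod[of "\<gamma> t"] by linarith
  qed
  then show ?thesis by blast
qed

lemma winding_zero_half_plane:
  assumes b: "\<And>t. b \<le> Re (\<gamma> t)" "b \<le> D" and T: "T > R" and p: "Re p < b"
  shows "winding_number (loop D T) p = 0"
proof (rule winding_number_zero_outside)
  show "convex {s. b \<le> Re s}" by (rule convex_halfspace_Re_ge)
  have "b \<le> c" using b(1)[of R] ends[of R] by simp
  then have "b \<le> Re s" if "s \<in> path_image (loop D T)" for s
    using that b unfolding loop_props(3)[OF T]
    by (auto simp: closed_segment_same_Re closed_segment_same_Im closed_segment_eq_real_ivl split: if_splits)
  then show "path_image (loop D T) \<subseteq> {s. b \<le> Re s}" by blast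
qed (use loop_props[OF T] p in \<open>auto intro: valid_path_imp_path\<close>)

text \<open>A path in the complement of \<open>\<gamma>\<close> from \<open>p\<close> to the far left has bounded image, so it avoids the
  loop once the three segments are far enough away.\<close>

lemma winding_zero_left:
  assumes p: "p \<in> left_of \<gamma>"
  shows "\<exists>B. \<forall>D T. D > B \<longrightarrow> T > B \<longrightarrow> winding_number (loop D T) p = 0"
proof -
  obtain b where b: "\<And>t. b \<le> Re (\<gamma> t)" using Re_bounded_below by blast
  have "\<forall>\<^sub>F r in at_top. connected_component (- range \<gamma>) p (of_real (- r)) \<and> - r < b"
  proof (rule eventually_conj)
    show "\<forall>\<^sub>F r in at_top. connected_component (- range \<gamma>) p (of_real (- r))"
      using p by (simp add: left_of_def)
    show "\<forall>\<^sub>F r in at_top. - r < b"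
      using eventually_gt_at_top[of "- b"] by eventually_elim simp
  qed
  then obtain r where r: "connected_component (- range \<gamma>) p (of_real (- r))" "- r < b"
    using eventually_happens trivial_limit_at_top_linorder by blast
  have "open (- range \<gamma>)" using closed_range by (rule open_Compl)
  then have "path_component (- range \<gamma>) p (of_real (- r))"
    using r by (simp add: open_path_connected_component)
  then obtain q where q: "path q" "path_image q \<subseteq> - range \<gamma>" "pathstart q = p" "pathfinish q = of_real (- r)"
    unfolding path_component_def by blast
  obtain B where B: "\<And>s. s \<in> path_image q \<Longrightarrow> norm s \<le> B"
    using compact_imp_bounded[OF compact_path_image[OF q(1)]] by (auto simp: bounded_iff)
  show ?thesis
  proof (intro exI[of _ "max (max B R) b"] allI impI)
    fix D T assume D: "max (max B R) b < D" and T: "max (max B R) b < T"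
    then have T': "T > R" by simp
    have "path_image q \<inter> path_image (loop D T) = {}"
    proof (intro equals0I)
      fix s assume s: "s \<in> path_image q \<inter> path_image (loop D T)"
      have "norm s \<le> B" using s B by blast
      then have "\<bar>Re s\<bar> < D" "\<bar>Im s\<bar> < T"
        using abs_Re_le_cmod[of s] abs_Im_le_cmod[of s] D T by auto
      moreover have "s \<notin> \<gamma> ` {-T..T}" using s q(2) by auto
      ultimately show False
        using s unfolding loop_props(3)[OF T']
        by (auto simp: closed_segment_same_Re closed_segment_same_Im)
    qed
    moreover have "p \<in> path_image q" "of_real (- r) \<in> path_image q"
      using q(3,4) by (metis pathstart_in_path_image, metis pathfinish_in_path_image)
    ultimately have "winding_number (loop D T) p = winding_number (loop D T) (of_real (- r))"
      using loop_props[OF T'] q(1)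
      by (intro winding_number_eq[where S = "path_image q"])
         (auto intro: valid_path_imp_path connected_path_image)
    also have "\<dots> = 0"
      using winding_zero_half_plane[OF b _ T', of D "of_real (- r)"] D r by simp
    finally show "winding_number (loop D T) p = 0" .
  qed
qed

text \<open>\<open>winding_zero_left\<close> gives a threshold for each pole separately. Only
  finitely many poles have real part at least b; the half-plane argument treats all the others at
  once, so the maximum of finitely many thresholds serves for all.\<close>

lemma winding_zero_nonpos_Ints:
  assumes "\<And>s. s \<in> \<int>\<^sub>\<le>\<^sub>0 \<Longrightarrow> s \<in> left_of \<gamma>"
  shows "\<exists>B. \<forall>D T. D > B \<longrightarrow> T > B \<longrightarrow> (\<forall>s\<in>\<int>\<^sub>\<le>\<^sub>0. winding_number (loop D T) s = 0)"
proof -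
  obtain b where b: "\<And>t. b \<le> Re (\<gamma> t)" using Re_bounded_below by blast
  have "\<exists>B. \<forall>D T. D > B \<longrightarrow> T > B \<longrightarrow> winding_number (loop D T) (- of_nat n) = 0" for n
    by (intro winding_zero_left assms) simp
  then obtain B where B: "\<And>n D T. D > B n \<Longrightarrow> T > B n \<Longrightarrow> winding_number (loop D T) (- of_nat n) = 0"
    by metis
  obtain N :: nat where N: "- b < real N" using reals_Archimedean2 by blast
  define B' where "B' = Max (insert R (insert b (B ` {..N})))"
  have B': "R \<le> B'" "b \<le> B'" "\<And>n. n \<le> N \<Longrightarrow> B n \<le> B'"
    unfolding B'_def by (rule Max_ge; simp)+
  show ?thesis
  proof (intro exI[of _ B'] allI impI ballI)
    fix D T and s :: complex assume D: "D > B'" and T: "T > B'" and "s \<in> \<int>\<^sub>\<le>\<^sub>0"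
    then obtain n where n: "s = - of_nat n" by (elim nonpos_Ints_cases')
    show "winding_number (loop D T) s = 0"
    proof (cases "n \<le> N")
      case True
      then show ?thesis unfolding n using B'(3)[OF True] D T by (intro B) auto
    next
      case False
      then have "Re s < b" using N n by simp
      then show ?thesis using B' D T by (intro winding_zero_half_plane[OF b]) auto
    qed
  qed
qed

end

section \<open>Independence of the contour\<close>

definition gamma_quot_powr :: "real \<Rightarrow> complex \<Rightarrow> complex" where
  "gamma_quot_powr z s = gamma_quot s * of_real z powr (- s)"

lemma norm_of_real_powr: "z > 0 \<Longrightarrow> norm (of_real z powr s :: complex) = z powr Re s"
  by (simp add: norm_powr_real_powr)

lemma gamma_quot_powr_strip:
  assumes z: "z > 0"
  obtains K where "K \<ge> 0"
    "\<And>s. a \<le> Re s \<Longrightarrow> Re s \<le> b \<Longrightarrow> \<bar>Im s\<bar> \<ge> 1 \<Longrightarrow> norm (gamma_quot_powr z s) \<le> K / (Im s)\<^sup>2"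
proof -
  obtain K where K: "K \<ge> 0" "\<And>s. Re s \<ge> a \<Longrightarrow> \<bar>Im s\<bar> \<ge> 1 \<Longrightarrow> norm (gamma_quot s) \<le> K / (Im s)\<^sup>2"
    using gamma_quot_strip[of a] by blast
  \<comment> \<open>The real power of z is monotone in Re s, so one of the two edges of the strip
    dominates, according to whether z >= 1.\<close>
  define L where "L = z powr (- a) + z powr (- b)"
  have L: "L \<ge> 0" by (simp add: L_def)
  show thesis
  proof (rule that[of "K * L"])
    fix s assume s: "a \<le> Re s" "Re s \<le> b" "\<bar>Im s\<bar> \<ge> 1"
    have "z powr (- Re s) \<le> L"
    proof (cases "z \<ge> 1")
      case True
      then have "z powr (- Re s) \<le> z powr (- a)" using s by (intro powr_mono) auto
      also have "\<dots> \<le> L" by (simp add: L_def)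
      finally show ?thesis .
    next
      case False
      then have "z powr (- Re s) \<le> z powr (- b)" using s z by (intro powr_mono') auto
      also have "\<dots> \<le> L" by (simp add: L_def)
      finally show ?thesis .
    qed
    then have "norm (gamma_quot s) * norm (of_real z powr (- s) :: complex) \<le> K / (Im s)\<^sup>2 * L"
      using K s z by (intro mult_mono) (auto simp: norm_of_real_powr)
    then show "norm (gamma_quot_powr z s) \<le> K * L / (Im s)\<^sup>2"
      by (simp add: gamma_quot_powr_def norm_mult)
  qed (use K L in simp)
qed

lemma gamma_quot_powr_holomorphic:
  assumes "z > 0" "S \<inter> \<int>\<^sub>\<le>\<^sub>0 = {}"
  shows "gamma_quot_powr z holomorphic_on S"
proof -
  have "gamma_quot_powr z = (\<lambda>s. gamma_quot s * exp (- s * of_real (ln z)))"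
    using assms(1) by (auto simp: fun_eq_iff gamma_quot_powr_def powr_def Ln_of_real)
  moreover have "(\<lambda>s. gamma_quot s * exp (- s * of_real (ln z))) holomorphic_on S"
    by (intro holomorphic_on_mult gamma_quot_holomorphic assms holomorphic_on_exp' holomorphic_intros)
  ultimately show ?thesis by simp
qed

lemma integral_vertical_upward:
  assumes "T > 0" "continuous_on (closed_segment (Complex D (- T)) (Complex D T)) F"
  shows "(F has_contour_integral (- (\<i> * integral {-T..T} (\<lambda>t. F (Complex D t)))))
    (linepath (Complex D T) (Complex D (- T)))"
proof -
  have int: "F contour_integrable_on (linepath (Complex D T) (Complex D (- T)))"
    using assms(2) by (intro contour_integrable_continuous_linepath) (simp add: closed_segment_commute)
  have "contour_integral (linepath (Complex D T) (Complex D (- T))) F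
      = - contour_integral (linepath (Complex D (- T)) (Complex D T)) F"
    by (rule contour_integral_reverse_linepath) (use assms(2) in \<open>simp add: closed_segment_commute\<close>)
  also have "contour_integral (linepath (Complex D (- T)) (Complex D T)) F
      = \<i> * integral {-T..T} (\<lambda>t. F (Complex D t))"
    by (rule contour_integral_linepath_same_Re) (use assms(1) in auto)
  finally show ?thesis using has_contour_integral_integral[OF int] by simp
qed

context straight_ends
begin

text \<open>The limit mentions only D and not the curve: it is the common value through which two
  contours are compared. By Cauchy's theorem the truncated integrals differ only by the two
  horizontal sides, which are O(T^(-2)) for fixed D.\<close>

lemma contour_shift:
  assumes z: "z > 0" and left: "\<And>s. s \<in> \<int>\<^sub>\<le>\<^sub>0 \<Longrightarrow> s \<in> left_of \<gamma>"
    and v: "((\<lambda>t. gamma_quot_powr z (\<gamma> t) * vector_derivative \<gamma> (at t)) has_integral v) UNIV"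
  shows "\<exists>B. \<forall>D>B. ((\<lambda>T. \<i> * integral {-T..T} (\<lambda>t. gamma_quot_powr z (Complex D t))) \<longlongrightarrow> v) at_top"
proof -
  obtain B where B: "\<And>D T s. D > B \<Longrightarrow> T > B \<Longrightarrow> s \<in> \<int>\<^sub>\<le>\<^sub>0 \<Longrightarrow> winding_number (loop D T) s = 0"
    using winding_zero_nonpos_Ints[OF left] by blast
  show ?thesis
  proof (intro exI[of _ "max B (max 0 c)"] allI impI)
    fix D assume "D > max B (max 0 c)"
    then have D: "D > B" "D > 0" "D > c" by auto
    obtain K where K: "K \<ge> 0"
      "\<And>s. c \<le> Re s \<Longrightarrow> Re s \<le> D \<Longrightarrow> \<bar>Im s\<bar> \<ge> 1 \<Longrightarrow> norm (gamma_quot_powr z s) \<le> K / (Im s)\<^sup>2"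
      using gamma_quot_powr_strip[OF z, of c D] by blast
    define w where "w T = integral {-T..T} (\<lambda>t. gamma_quot_powr z (\<gamma> t) * vector_derivative \<gamma> (at t))" for T
    define J where "J T = \<i> * integral {-T..T} (\<lambda>t. gamma_quot_powr z (Complex D t))" for T
    have hol: "gamma_quot_powr z holomorphic_on (- \<int>\<^sub>\<le>\<^sub>0)" by (rule gamma_quot_powr_holomorphic[OF z]) auto
    have notin: "s \<notin> \<int>\<^sub>\<le>\<^sub>0" if "Re s > 0 \<or> Im s \<noteq> 0" for s
      using that nonpos_Ints_ReIm[of s] by auto
    \<comment> \<open>A pole on the curve would have to lie to its left, but no component of the
      complement contains a point of the curve.\<close>
    have range: "\<gamma> t \<notin> \<int>\<^sub>\<le>\<^sub>0" for t
    proof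
      assume "\<gamma> t \<in> \<int>\<^sub>\<le>\<^sub>0"
      then have "\<forall>\<^sub>F r in at_top. connected_component (- range \<gamma>) (\<gamma> t) (of_real (- r))"
        using left by (simp add: left_of_def)
      then have "\<exists>r. connected_component (- range \<gamma>) (\<gamma> t) (of_real (- r))"
        using eventually_happens trivial_limit_at_top_linorder by blast
      then show False using connected_component_in by fastforce
    qed
    have bound: "norm (J T - w T) \<le> 2 * (K * (D - c)) / T\<^sup>2" if T: "T > max B (max R 1)" for T
    proof -
      have T': "T > R" "T > B" "T > 0" "T \<ge> 1" using T by auto
      note loop = loop_props[OF T'(1), of D]
      have sub: "path_image (loop D T) \<subseteq> - \<int>\<^sub>\<le>\<^sub>0"
        unfolding loop(3) using range notin T' D
        by (auto simp: closed_segment_same_Re closed_segment_same_Im)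
      have cont: "continuous_on S (gamma_quot_powr z)" if "S \<subseteq> path_image (loop D T)" for S
        using holomorphic_on_imp_continuous_on[OF hol] continuous_on_subset sub that by blast
      have 0: "(gamma_quot_powr z has_contour_integral 0) (loop D T)"
        by (rule Cauchy_theorem_global[OF _ hol loop(1,2) sub])
           (use B[OF D(1) T'(2)] in \<open>auto simp: open_Compl\<close>)
      have "(\<lambda>t. gamma_quot_powr z (\<gamma> t) * vector_derivative \<gamma> (at t)) integrable_on {-T..T}"
        using integrable_on_subinterval[of _ UNIV "-T" T] v by (auto simp: integrable_on_def)
      then have A: "(gamma_quot_powr z has_contour_integral w T) (arc T)"
        unfolding w_def by (intro has_contour_integral_arc T'(3) integrable_integral)
      define I1 where "I1 = contour_integral (linepath (Complex c T) (Complex D T)) (gamma_quot_powr z)"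
      define I3 where "I3 = contour_integral (linepath (Complex D (-T)) (Complex c (-T))) (gamma_quot_powr z)"
      have 1: "(gamma_quot_powr z has_contour_integral I1) (linepath (Complex c T) (Complex D T))"
        unfolding I1_def
        by (intro has_contour_integral_integral contour_integrable_continuous_linepath cont) (auto simp: loop(3))
      have 3: "(gamma_quot_powr z has_contour_integral I3) (linepath (Complex D (-T)) (Complex c (-T)))"
        unfolding I3_def
        by (intro has_contour_integral_integral contour_integrable_continuous_linepath cont) (auto simp: loop(3))
      have 2: "(gamma_quot_powr z has_contour_integral (- J T)) (linepath (Complex D T) (Complex D (- T)))"
        unfolding J_def
        by (intro integral_vertical_upward T'(3) cont) (auto simp: loop(3) closed_segment_commute)
      have "(gamma_quot_powr z has_contour_integral (w T + (I1 + (- J T + I3)))) (loop D T)"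
        unfolding loop_def
        by (intro has_contour_integral_join A 1 2 3 valid_path_arc[OF T'(3)] valid_path_join) auto
      then have "0 = w T + (I1 + (- J T + I3))" by (rule has_contour_integral_unique[OF 0])
      then have eq: "J T - w T = I1 + I3" by (simp add: algebra_simps)
      have seg: "norm (gamma_quot_powr z s) \<le> K / T\<^sup>2" if "c \<le> Re s" "Re s \<le> D" "\<bar>Im s\<bar> = T" for s
      proof -
        have "norm (gamma_quot_powr z s) \<le> K / (Im s)\<^sup>2" using K(2)[of s] that T' by simp
        also have "(Im s)\<^sup>2 = T\<^sup>2" using that(3) by (metis power2_abs)
        finally show ?thesis .
      qed
      have "norm I1 \<le> K / T\<^sup>2 * norm (Complex D T - Complex c T)"
        by (rule has_contour_integral_bound_linepath[OF 1])
           (use K D T' in \<open>auto simp: closed_segment_same_Im closed_segment_eq_real_ivl intro!: seg\<close>)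
      also have "Complex D T - Complex c T = of_real (D - c)" by (simp add: complex_eq_iff)
      finally have I1: "norm I1 \<le> K * (D - c) / T\<^sup>2" using D by (simp del: of_real_diff)
      have "norm I3 \<le> K / T\<^sup>2 * norm (Complex c (-T) - Complex D (-T))"
        by (rule has_contour_integral_bound_linepath[OF 3])
           (use K D T' in \<open>auto simp: closed_segment_same_Im closed_segment_eq_real_ivl intro!: seg\<close>)
      also have "Complex c (-T) - Complex D (-T) = of_real (c - D)" by (simp add: complex_eq_iff)
      finally have I3: "norm I3 \<le> K * (D - c) / T\<^sup>2" using D by (simp del: of_real_diff)
      show ?thesis
        unfolding eq mult_2 add_divide_distrib using norm_triangle_ineq[of I1 I3] I1 I3 by linarith
    qed
    have "((\<lambda>T. 2 * (K * (D - c)) / T\<^sup>2) \<longlongrightarrow> 0) at_top"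
      by (intro tendsto_divide_0[OF tendsto_const] filterlim_at_top_imp_at_infinity
            filterlim_pow_at_top filterlim_ident) simp
    then have "((\<lambda>T. J T - w T) \<longlongrightarrow> 0) at_top"
      by (rule Lim_null_comparison[rotated])
         (use eventually_gt_at_top[of "max B (max R 1)"] bound in \<open>auto elim: eventually_mono\<close>)
    moreover have "(w \<longlongrightarrow> v) at_top"
      unfolding w_def[abs_def] by (rule tendsto_symmetric_integral[OF v])
    ultimately have "((\<lambda>T. (J T - w T) + w T) \<longlongrightarrow> 0 + v) at_top" by (rule tendsto_add)
    then show "((\<lambda>T. \<i> * integral {-T..T} (\<lambda>t. gamma_quot_powr z (Complex D t))) \<longlongrightarrow> v) at_top"
      by (simp add: J_def[abs_def])
  qed
qed

end

section \<open>Absolute convergence on vertical lines and the value of the Meijer function\<close>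

lemma integrable_inverse_1_square: "integrable lborel (\<lambda>t::real. 1 / (1 + t\<^sup>2))"
  using integrable_inverse_1_plus_square by (simp add: set_integrable_def divide_inverse)

lemma gamma_quot_line_bound:
  assumes "c > 0"
  obtains K where "K \<ge> 0" "\<And>t. norm (gamma_quot (Complex c t)) \<le> K * (1 / (1 + t\<^sup>2))"
proof -
  obtain K where K: "K \<ge> 0" "\<And>s. Re s \<ge> c \<Longrightarrow> norm (gamma_quot s) \<le> K / (norm s)\<^sup>2"
    using gamma_quot_bound[OF assms] by blast
  \<comment> \<open>With this choice e (1 + t^2) is at most c^2 + t^2, the squared modulus of c + i
    t.\<close>
  define e where "e = min 1 (c\<^sup>2)"
  have e: "e > 0" "e \<le> 1" "e \<le> c\<^sup>2" using assms by (auto simp: e_def)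
  show thesis
  proof (rule that[of "K / e"])
    fix t :: real
    have "e * t\<^sup>2 \<le> 1 * t\<^sup>2" using e by (intro mult_right_mono) auto
    then have le: "e * (1 + t\<^sup>2) \<le> (norm (Complex c t))\<^sup>2"
      using e(3) by (simp add: cmod_power2 algebra_simps)
    have pos: "e * (1 + t\<^sup>2) > 0" using e(1) by (intro mult_pos_pos) (auto intro: add_pos_nonneg)
    have "norm (gamma_quot (Complex c t)) \<le> K / (norm (Complex c t))\<^sup>2" by (rule K(2)) simp
    also have "\<dots> \<le> K / (e * (1 + t\<^sup>2))"
      by (rule divide_left_mono[OF le K(1) mult_pos_pos[OF less_le_trans[OF pos le] pos]])
    finally show "norm (gamma_quot (Complex c t)) \<le> K / e * (1 / (1 + t\<^sup>2))" by simp
  qed (use K e in auto)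
qed

lemma integrable_gamma_quot_line:
  assumes c: "c > 0"
  shows "integrable lborel (\<lambda>t. gamma_quot (Complex c t))"
proof -
  obtain K where K: "K \<ge> 0" "\<And>t. norm (gamma_quot (Complex c t)) \<le> K * (1 / (1 + t\<^sup>2))"
    using gamma_quot_line_bound[OF c] by blast
  show ?thesis
  proof (rule Bochner_Integration.integrable_bound)
    show "integrable lborel (\<lambda>t. K * (1 / (1 + t\<^sup>2)))"
      by (intro integrable_mult_right integrable_inverse_1_square)
    show "(\<lambda>t. gamma_quot (Complex c t)) \<in> borel_measurable lborel"
      using borel_measurable_continuous_onI[OF continuous_on_gamma_quot_line[OF c]] by simp
    show "AE t in lborel. norm (gamma_quot (Complex c t)) \<le> norm (K * (1 / (1 + t\<^sup>2)))"
      using K by (auto simp: abs_mult)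
  qed
qed

lemma continuous_on_gamma_quot_powr_line:
  assumes "c > 0" "z > 0"
  shows "continuous_on UNIV (\<lambda>t. gamma_quot_powr z (Complex c t))"
proof -
  have "continuous_on {s. Re s > 0} (gamma_quot_powr z)"
    using nonpos_Ints_ReIm(1) by (intro holomorphic_on_imp_continuous_on gamma_quot_powr_holomorphic assms) force
  moreover have "continuous_on UNIV (Complex c)"
    unfolding Complex_eq by (intro continuous_intros)
  ultimately show ?thesis
    by (rule continuous_on_compose2) (use assms in auto)
qed

lemma integrable_gamma_quot_powr_line:
  assumes c: "c > 0" and z: "z > 0"
  shows "integrable lborel (\<lambda>t. gamma_quot_powr z (Complex c t))"
proof (rule Bochner_Integration.integrable_bound)
  show "integrable lborel (\<lambda>t. of_real (z powr (- c)) * gamma_quot (Complex c t))"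
    by (intro integrable_mult_right integrable_gamma_quot_line c)
  show "(\<lambda>t. gamma_quot_powr z (Complex c t)) \<in> borel_measurable lborel"
    using borel_measurable_continuous_onI[OF continuous_on_gamma_quot_powr_line[OF c z]] by simp
  show "AE t in lborel. norm (gamma_quot_powr z (Complex c t)) \<le> norm (of_real (z powr (- c)) * gamma_quot (Complex c t))"
    using z by (auto simp: gamma_quot_powr_def norm_mult norm_of_real_powr)
qed

lemma has_line_integral_gamma_quot_powr:
  assumes c: "c > 0" and z: "z > 0"
  shows "has_line_integral (gamma_quot_powr z) (\<i> * (LINT t|lborel. gamma_quot_powr z (Complex c t))) (vertical_line c)"
proof -
  have "((\<lambda>t. gamma_quot_powr z (Complex c t)) has_integral (LINT t|lborel. gamma_quot_powr z (Complex c t))) UNIV"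
    by (rule has_integral_integral_lborel[OF integrable_gamma_quot_powr_line[OF c z]])
  then have "((\<lambda>t. \<i> * gamma_quot_powr z (Complex c t)) has_integral \<i> * (LINT t|lborel. gamma_quot_powr z (Complex c t))) UNIV"
    by (rule has_integral_mult_right)
  then show ?thesis
    by (simp add: has_line_integral_def vector_derivative_vertical_line vertical_line_def mult.commute)
qed

lemma meijer_integrand_gamma_quot_powr: "meijer_integrand 2 0 [5/2, 7/2] [0, 1] (of_real z) = gamma_quot_powr z"
  by (rule ext) (simp add: meijer_integrand_def gamma_quot_powr_def gamma_quot_def numeral_2_eq_2 lessThan_Suc atLeast0LessThan mult_ac)

lemma line_integral_unique:
  assumes z: "z > 0" and "mellin_barnes_contour 2 0 [5/2, 7/2] [0, 1] \<gamma>" "has_line_integral (gamma_quot_powr z) v \<gamma>"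
    and "mellin_barnes_contour 2 0 [5/2, 7/2] [0, 1] \<gamma>'" "has_line_integral (gamma_quot_powr z) v' \<gamma>'"
  shows "v = v'"
proof -
  have *: "\<exists>B. \<forall>D>B. ((\<lambda>T. \<i> * integral {-T..T} (\<lambda>t. gamma_quot_powr z (Complex D t))) \<longlongrightarrow> v) at_top"
    if \<gamma>: "mellin_barnes_contour 2 0 [5/2, 7/2] [0, 1] \<gamma>" and v: "has_line_integral (gamma_quot_powr z) v \<gamma>" for \<gamma> v
  proof -
    obtain c R where cR: "\<gamma> piecewise_C1_differentiable_on {-R..R}" "\<And>t. \<bar>t\<bar> \<ge> R \<Longrightarrow> \<gamma> t = Complex c t"
      using \<gamma> unfolding mellin_barnes_contour_def vertical_line_def by blast
    interpret straight_ends \<gamma> c "max R 0"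
    proof
      show "\<gamma> piecewise_C1_differentiable_on {- max R 0..max R 0}"
      \<comment> \<open>A contour may come with a negative R, in which case it is a full vertical
        line; the interval then shrinks to the point 0.\<close>
      proof (cases "R \<ge> 0")
        case False
        then show ?thesis
          by (auto simp: piecewise_C1_differentiable_on_def intro!: exI[of _ "{0}"])
      qed (use cR(1) in \<open>simp add: max_def\<close>)
    qed (use cR(2) in auto)
    have "s \<in> left_of \<gamma>" if "s \<in> \<int>\<^sub>\<le>\<^sub>0" for s
    proof -
      \<comment> \<open>Index 0 already yields all poles, as those of Gamma(s) include those of
        Gamma(s + 1).\<close>
      have "\<forall>k<2. \<forall>s. s + [0, 1] ! k \<in> \<int>\<^sub>\<le>\<^sub>0 \<longrightarrow> s \<in> left_of \<gamma>"
        using \<gamma> unfolding mellin_barnes_contour_def by blast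
      from this[rule_format, of 0 s] show ?thesis using that by simp
    qed
    then show ?thesis
      using v by (intro contour_shift z) (auto simp: has_line_integral_def)
  qed
  from *[OF assms(2,3)] obtain B where B: "\<And>D. D > B \<Longrightarrow>
      ((\<lambda>T. \<i> * integral {-T..T} (\<lambda>t. gamma_quot_powr z (Complex D t))) \<longlongrightarrow> v) at_top" by blast
  from *[OF assms(4,5)] obtain B' where B': "\<And>D. D > B' \<Longrightarrow>
      ((\<lambda>T. \<i> * integral {-T..T} (\<lambda>t. gamma_quot_powr z (Complex D t))) \<longlongrightarrow> v') at_top" by blast
  show ?thesis
    by (rule tendsto_unique[OF _ B[of "max B B' + 1"] B'[of "max B B' + 1"]]) auto
qed

text \<open>The vertical line witnesses existence and \<open>line_integral_unique\<close> gives
  uniqueness; the i of ds = i dt cancels the one in 1 / (2 i pi).\<close>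

lemma meijer_G_eq_line_integral:
  assumes z: "z > 0" and c: "c > 0"
  shows "meijer_G 2 0 [5/2, 7/2] [0, 1] (of_real z)
    = 1 / (2 * of_real pi) * (LINT t|lborel. gamma_quot_powr z (Complex c t))"
proof -
  define v where "v = \<i> * (LINT t|lborel. gamma_quot_powr z (Complex c t))"
  have v: "has_line_integral (gamma_quot_powr z) v (vertical_line c)"
    unfolding v_def by (rule has_line_integral_gamma_quot_powr[OF c z])
  have mbc: "mellin_barnes_contour 2 0 [5/2, 7/2] [0, 1] (vertical_line c)"
  proof (rule mellin_barnes_contour_vertical_line)
    fix k :: nat assume "k < 2"
    then have "k = 0 \<or> k = 1" by auto
    then show "- Re ([0, 1] ! k) < c" using c by auto
  qed
  have "meijer_G 2 0 [5/2, 7/2] [0, 1] (of_real z) = 1 / (2 * \<i> * of_real pi) * v"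
    unfolding meijer_G_def meijer_integrand_gamma_quot_powr
  proof (rule the_equality)
    show "\<exists>\<gamma> v'. mellin_barnes_contour 2 0 [5/2, 7/2] [0, 1] \<gamma> \<and> has_line_integral (gamma_quot_powr z) v' \<gamma> \<and>
        1 / (2 * \<i> * of_real pi) * v = 1 / (2 * \<i> * of_real pi) * v'"
      using v mbc by blast
    fix w assume "\<exists>\<gamma> v'. mellin_barnes_contour 2 0 [5/2, 7/2] [0, 1] \<gamma> \<and> has_line_integral (gamma_quot_powr z) v' \<gamma> \<and>
        w = 1 / (2 * \<i> * of_real pi) * v'"
    then show "w = 1 / (2 * \<i> * of_real pi) * v"
      using line_integral_unique[OF z _ _ mbc v] by blast
  qed
  then show ?thesis by (simp add: v_def)
qed

section \<open>Mellin transforms\<close>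

text \<open>Shifting the line of integration to the far right crosses only the pole at \<open>k\<close>.\<close>

lemma gamma_quot_line_residue:
  assumes c: "c > 0" and k: "c < k"
  shows "integrable lborel (\<lambda>t. gamma_quot (Complex c t) / (of_real k - Complex c t))"
    and "(LINT t|lborel. gamma_quot (Complex c t) / (of_real k - Complex c t)) = 2 * of_real pi * gamma_quot (of_real k)"
proof -
  define g where "g w = gamma_quot w / (w - of_real k)" for w
  have Re_k: "norm (of_real k - Complex c t) \<ge> k - c" for t
    using complex_Re_le_cmod[of "of_real k - Complex c t"] by simp
  have hol: "gamma_quot holomorphic_on {s. Re s > 0}"
    using nonpos_Ints_ReIm(1) by (intro gamma_quot_holomorphic) force
  have cont: "continuous_on ({s. Re s > 0} - {of_real k}) g"
    unfolding g_def
    by (intro continuous_intros continuous_on_subset[OF holomorphic_on_imp_continuous_on[OF hol]]) auto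
  have cl: "continuous_on UNIV (\<lambda>t. g (Complex c t))"
  proof -
    have "continuous_on UNIV (Complex c)"
      unfolding Complex_eq by (intro continuous_intros)
    then show ?thesis
      by (rule continuous_on_compose2[OF cont]) (use c k in \<open>auto simp: complex_eq_iff\<close>)
  qed
  have neg: "gamma_quot (Complex c t) / (of_real k - Complex c t) = - g (Complex c t)" for t
    unfolding g_def by (metis minus_diff_eq minus_divide_right)
  show int: "integrable lborel (\<lambda>t. gamma_quot (Complex c t) / (of_real k - Complex c t))"
  proof (rule Bochner_Integration.integrable_bound)
    show "integrable lborel (\<lambda>t. of_real (1 / (k - c)) * gamma_quot (Complex c t))"
      by (intro integrable_mult_right integrable_gamma_quot_line c)
    show "(\<lambda>t. gamma_quot (Complex c t) / (of_real k - Complex c t)) \<in> borel_measurable lborel"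
      unfolding neg using borel_measurable_continuous_onI[OF cl] by simp
    have "norm (gamma_quot (Complex c t) / (of_real k - Complex c t)) \<le> norm (of_real (1 / (k - c)) * gamma_quot (Complex c t))" for t
    proof -
      have "norm (gamma_quot (Complex c t)) / norm (of_real k - Complex c t) \<le> norm (gamma_quot (Complex c t)) / (k - c)"
        using Re_k[of t] k by (intro divide_left_mono mult_pos_pos) auto
      then show ?thesis using k by (simp add: norm_divide norm_mult del: of_real_diff)
    qed
    then show "AE t in lborel. norm (gamma_quot (Complex c t) / (of_real k - Complex c t)) \<le> norm (of_real (1 / (k - c)) * gamma_quot (Complex c t))"
      by simp
  qed
  obtain K where K: "K \<ge> 0" "\<And>s. Re s \<ge> c \<Longrightarrow> norm (gamma_quot s) \<le> K / (norm s)\<^sup>2"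
    using gamma_quot_bound[OF c] by blast
  define L where "L T = integral {-T..T} (\<lambda>t. g (Complex c t))" for T
  \<comment> \<open>Apply Cauchy's formula to the rectangle whose left side lies on Re s = c. On the
    other three sides |g| <= K / T^2, and each has length at most 2 T, which gives three times 2 K /
    T. The condition T > k + 1 keeps |s - k| >= 1 there.\<close>
  have bound: "norm (2 * pi * \<i> * gamma_quot (of_real k) + \<i> * L T) \<le> 6 * K / T" if T: "T > k + 1" for T
  proof -
    define a1 where "a1 = Complex c (-T)"
    define a2 where "a2 = Complex T (-T)"
    define a3 where "a3 = Complex T T"
    define a4 where "a4 = Complex c T"
    note a = a1_def a2_def a3_def a4_def
    have T': "T > 0" "T > c" "T > 1" using T c k by auto
    have wind: "winding_number (rectpath a1 a3) (of_real k) = 1"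
      by (rule winding_number_rectpath) (use T k T' in \<open>auto simp: a in_box_complex_iff\<close>)
    have img: "path_image (rectpath a1 a3) = closed_segment a1 a2 \<union> closed_segment a2 a3
        \<union> closed_segment a3 a4 \<union> closed_segment a4 a1"
      unfolding rectpath_def Let_def a by (simp add: path_image_join Un_assoc)
    have sub: "path_image (rectpath a1 a3) \<subseteq> {s. Re s > 0} - {of_real k}"
      unfolding img using T' c k T
      by (auto simp: a closed_segment_same_Re closed_segment_same_Im closed_segment_eq_real_ivl)
    have op: "open {s. Re s > 0}" by (rule open_halfspace_Re_gt)
    have total: "(g has_contour_integral (2 * pi * \<i> * gamma_quot (of_real k))) (rectpath a1 a3)"
      using Cauchy_integral_formula_convex_simple[OF convex_halfspace_Re_gt hol, of "of_real k" "rectpath a1 a3"]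
        sub wind c k interior_open[OF op]
      by (simp add: g_def[abs_def] valid_path_rectpath)
    have ci: "g contour_integrable_on (linepath p q)" if "closed_segment p q \<subseteq> path_image (rectpath a1 a3)" for p q
      by (intro contour_integrable_continuous_linepath continuous_on_subset[OF cont]) (use that sub in blast)
    define I1 I2 I3 where "I1 = contour_integral (linepath a1 a2) g"
      and "I2 = contour_integral (linepath a2 a3) g" and "I3 = contour_integral (linepath a3 a4) g"
    have h: "(g has_contour_integral I1) (linepath a1 a2)" "(g has_contour_integral I2) (linepath a2 a3)"
      "(g has_contour_integral I3) (linepath a3 a4)"
      unfolding I1_def I2_def I3_def by (intro has_contour_integral_integral ci; auto simp: img)+
    have "closed_segment a1 a4 \<subseteq> path_image (rectpath a1 a3)"
      unfolding img closed_segment_commute[of a1 a4] by blast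
    then have c4: "continuous_on (closed_segment a1 a4) g"
      using sub by (intro continuous_on_subset[OF cont]) blast
    have h4: "(g has_contour_integral (- (\<i> * L T))) (linepath a4 a1)"
      unfolding L_def a1_def a4_def
      by (rule integral_vertical_upward[OF T'(1) c4[unfolded a1_def a4_def]])
    have "(g has_contour_integral (I1 + (I2 + (I3 + - (\<i> * L T))))) (rectpath a1 a3)"
      unfolding rectpath_def Let_def
      using has_contour_integral_join[OF h(1) has_contour_integral_join[OF h(2) has_contour_integral_join[OF h(3) h4]]]
      by (simp add: a)
    then have "2 * pi * \<i> * gamma_quot (of_real k) = I1 + (I2 + (I3 + - (\<i> * L T)))"
      by (rule has_contour_integral_unique[OF total])
    then have eq: "2 * pi * \<i> * gamma_quot (of_real k) + \<i> * L T = I1 + I2 + I3" by simp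
    have gb: "norm (g s) \<le> K / T\<^sup>2" if "Re s \<ge> c" "\<bar>Im s\<bar> = T \<or> Re s = T" for s
    proof -
      have "\<bar>Re s\<bar> \<le> norm s" "\<bar>Im s\<bar> \<le> norm s" by (rule abs_Re_le_cmod abs_Im_le_cmod)+
      then have "T \<le> norm s" using that T' by auto
      then have n1: "T\<^sup>2 \<le> (norm s)\<^sup>2" using T' by (intro power_mono) auto
      have "\<bar>Re (s - of_real k)\<bar> \<le> norm (s - of_real k)" "\<bar>Im (s - of_real k)\<bar> \<le> norm (s - of_real k)"
        by (rule abs_Re_le_cmod abs_Im_le_cmod)+
      then have n2: "1 \<le> norm (s - of_real k)" using that T T' by auto
      have "T\<^sup>2 > 0" using T' by simp
      have "norm (g s) \<le> norm (gamma_quot s) / 1"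
        unfolding g_def norm_divide using n2 by (intro divide_left_mono) auto
      also have "\<dots> \<le> K / (norm s)\<^sup>2" using K(2)[OF that(1)] by simp
      also have "\<dots> \<le> K / T\<^sup>2"
        using n1 K(1) \<open>T\<^sup>2 > 0\<close> by (intro divide_left_mono mult_pos_pos) auto
      finally show ?thesis .
    qed
    have KT: "0 \<le> K / T\<^sup>2" using K(1) by simp
    have len: "K / T\<^sup>2 * l \<le> 2 * K / T" if "l \<le> 2 * T" for l
    proof -
      have "K / T\<^sup>2 * l \<le> K / T\<^sup>2 * (2 * T)" by (rule mult_left_mono[OF that KT])
      also have "\<dots> = 2 * K / T" using T' by (simp add: power2_eq_square)
      finally show ?thesis .
    qed
    have "norm I1 \<le> K / T\<^sup>2 * norm (a2 - a1)"
      by (rule has_contour_integral_bound_linepath[OF h(1) KT gb])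
         (use T' in \<open>auto simp: a closed_segment_same_Im closed_segment_eq_real_ivl\<close>)
    moreover have "a2 - a1 = of_real (T - c)" by (simp add: a complex_eq_iff)
    ultimately have n1: "norm I1 \<le> 2 * K / T"
      using len[of "T - c"] T' c by (simp del: of_real_diff)
    have "norm I2 \<le> K / T\<^sup>2 * norm (a3 - a2)"
      by (rule has_contour_integral_bound_linepath[OF h(2) KT gb])
         (use T' in \<open>auto simp: a closed_segment_same_Re closed_segment_eq_real_ivl\<close>)
    moreover have "norm (a3 - a2) = 2 * T"
    proof -
      have "a3 - a2 = of_real (2 * T) * \<i>" by (simp add: a complex_eq_iff)
      then show ?thesis using T' by (simp only: norm_mult norm_of_real norm_ii)
    qed
    ultimately have n2: "norm I2 \<le> 2 * K / T"
      using len[of "2 * T"] by simp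
    have "norm I3 \<le> K / T\<^sup>2 * norm (a4 - a3)"
      by (rule has_contour_integral_bound_linepath[OF h(3) KT gb])
         (use T' in \<open>auto simp: a closed_segment_same_Im closed_segment_eq_real_ivl\<close>)
    moreover have "a4 - a3 = of_real (c - T)" by (simp add: a complex_eq_iff)
    ultimately have n3: "norm I3 \<le> 2 * K / T"
      using len[of "T - c"] T' c by (simp del: of_real_diff)
    have "norm (I1 + I2 + I3) \<le> 2 * K / T + 2 * K / T + 2 * K / T"
      by (intro norm_triangle_mono n1 n2 n3)
    then show ?thesis unfolding eq by simp
  qed
  have "((\<lambda>T. 6 * K / T) \<longlongrightarrow> 0) at_top"
    by (intro tendsto_divide_0[OF tendsto_const] filterlim_at_top_imp_at_infinity filterlim_ident)
  then have "((\<lambda>T. 2 * pi * \<i> * gamma_quot (of_real k) + \<i> * L T) \<longlongrightarrow> 0) at_top"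
    by (rule Lim_null_comparison[rotated])
       (rule eventually_mono[OF eventually_gt_at_top[of "k + 1"] bound])
  moreover have "((\<lambda>T. 2 * pi * \<i> * gamma_quot (of_real k) + \<i> * L T) \<longlongrightarrow>
      2 * pi * \<i> * gamma_quot (of_real k) + \<i> * (LINT t|lborel. g (Complex c t))) at_top"
  proof (intro tendsto_intros)
    have "integrable lborel (\<lambda>t. g (Complex c t))"
      using int unfolding neg by simp
    from tendsto_symmetric_integral[OF has_integral_integral_lborel[OF this]]
    show "(L \<longlongrightarrow> (LINT t|lborel. g (Complex c t))) at_top" by (simp add: L_def[abs_def])
  qed
  ultimately have "2 * pi * \<i> * gamma_quot (of_real k) + \<i> * (LINT t|lborel. g (Complex c t)) = 0"
    by (metis tendsto_unique trivial_limit_at_top_linorder)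
  then have "\<i> * (2 * pi * gamma_quot (of_real k) + (LINT t|lborel. g (Complex c t))) = 0"
    by (simp add: algebra_simps)
  then have "(LINT t|lborel. g (Complex c t)) = - (2 * pi * gamma_quot (of_real k))"
    by (simp add: add_eq_0_iff)
  then show "(LINT t|lborel. gamma_quot (Complex c t) / (of_real k - Complex c t)) = 2 * of_real pi * gamma_quot (of_real k)"
    unfolding neg by simp
qed

text \<open>The kernel x (x^2 / 16)^(-s), in exponential form for the sake of derivatives and
  measurability. At x = 0 the factor x makes it 0, whatever the default value of the
  logarithm.\<close>

definition phi :: "complex \<Rightarrow> real \<Rightarrow> complex" where
  "phi s x = of_real x * exp (- s * of_real (ln (x\<^sup>2 / 16)))"

lemma phi_powr: "phi s x = of_real x * of_real (x\<^sup>2 / 16) powr (- s)"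
proof (cases "x = 0")
  case False
  have "(of_real u :: complex) powr (- s) = exp (- s * of_real (ln u))" if "u > 0" for u :: real
    using that by (simp add: powr_def Ln_of_real)
  moreover have "x\<^sup>2 / 16 > 0" using False by simp
  ultimately show ?thesis by (simp only: phi_def)
qed (simp add: phi_def)

text \<open>The abscissa 1/4 is the midpoint of the interval from 0 to 1/2. The bound tends to 0
  with x and is at most 4 on [-4, 4], which yields both continuity at 0 and a dominating
  function.\<close>

lemma norm_phi:
  assumes "Re s = 1/4"
  shows "norm (phi s x) = 2 * sqrt \<bar>x\<bar>"
proof (cases "x = 0")
  case False
  define u where "u = \<bar>x\<bar> / 4"
  have u: "u > 0" using False by (simp add: u_def)
  have "x\<^sup>2 / 16 = u\<^sup>2" by (simp add: u_def power_divide)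
  then have "ln (x\<^sup>2 / 16) = 2 * ln u" using u by (simp add: ln_realpow)
  then have "norm (phi s x) = \<bar>x\<bar> * exp (- (ln u / 2))"
    using assms by (simp add: phi_def norm_mult)
  also have "exp (- (ln u / 2)) = 1 / sqrt u"
  proof -
    have "sqrt u = exp (ln u / 2)" using u by (simp add: powr_def flip: powr_half_sqrt)
    then show ?thesis by (simp only: exp_minus inverse_eq_divide)
  qed
  also have "sqrt u = sqrt \<bar>x\<bar> / 2" by (simp add: u_def real_sqrt_divide)
  also have "\<bar>x\<bar> * (1 / (sqrt \<bar>x\<bar> / 2)) = 2 * (\<bar>x\<bar> / sqrt \<bar>x\<bar>)" by simp
  also have "\<bar>x\<bar> / sqrt \<bar>x\<bar> = sqrt \<bar>x\<bar>" by (rule real_div_sqrt) simp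
  finally show ?thesis .
qed (simp add: phi_def)

lemma phi_derivative:
  assumes "x \<noteq> 0"
  shows "(phi s has_vector_derivative ((1 - 2 * s) * exp (- s * of_real (ln (x\<^sup>2 / 16))))) (at x)"
proof -
  have pos: "x\<^sup>2 / 16 > 0" using assms by simp
  have "((\<lambda>x. ln (x\<^sup>2 / 16)) has_real_derivative (2 / x)) (at x)"
    using assms pos by (auto intro!: derivative_eq_intros simp: field_simps power2_eq_square)
  then have l: "((\<lambda>x. complex_of_real (ln (x\<^sup>2 / 16))) has_vector_derivative of_real (2 / x)) (at x)"
    unfolding has_real_derivative_iff_has_vector_derivative
    by (rule bounded_linear.has_vector_derivative[OF bounded_linear_of_real])
  have e1: "((\<lambda>x. - s * complex_of_real (ln (x\<^sup>2 / 16))) has_vector_derivative - s * of_real (2 / x)) (at x)"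
    by (rule has_vector_derivative_mult_right[OF l])
  have e2: "(exp has_field_derivative exp (- s * of_real (ln (x\<^sup>2 / 16)))) (at (- s * of_real (ln (x\<^sup>2 / 16))))"
    by (rule DERIV_exp)
  have e: "((\<lambda>x. exp (- s * complex_of_real (ln (x\<^sup>2 / 16)))) has_vector_derivative
      (- s * of_real (2 / x)) * exp (- s * of_real (ln (x\<^sup>2 / 16)))) (at x)"
    using field_vector_diff_chain_at[OF e1 e2] unfolding o_def .
  have "(phi s has_vector_derivative (of_real x * ((- s * of_real (2 / x)) * exp (- s * of_real (ln (x\<^sup>2 / 16))))
      + 1 * exp (- s * of_real (ln (x\<^sup>2 / 16))))) (at x)"
    unfolding phi_def[abs_def]
    by (rule has_vector_derivative_mult[OF _ e]) (auto intro!: derivative_eq_intros)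
  moreover have "of_real x * ((- s * of_real (2 / x)) * exp (- s * of_real (ln (x\<^sup>2 / 16))))
      + 1 * exp (- s * of_real (ln (x\<^sup>2 / 16))) = (1 - 2 * s) * exp (- s * of_real (ln (x\<^sup>2 / 16)))"
    using assms by (simp add: algebra_simps)
  ultimately show ?thesis by simp
qed

lemma continuous_phi:
  assumes "Re s = 1/4"
  shows "continuous_on UNIV (phi s)"
proof -
  have "isCont (phi s) x" for x
  proof (cases "x = 0")
    case False
    show ?thesis by (rule has_vector_derivative_continuous[OF phi_derivative[OF False]])
  next
    case True
    have "((\<lambda>x. 2 * sqrt \<bar>x\<bar>) \<longlongrightarrow> 2 * sqrt \<bar>0\<bar>) (at 0)"
      by (intro tendsto_intros)
    then have "(phi s \<longlongrightarrow> 0) (at 0)"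
      by (intro Lim_null_comparison[of "phi s" "\<lambda>x. 2 * sqrt \<bar>x\<bar>"]) (auto simp: norm_phi[OF assms])
    then show ?thesis using True by (simp add: isCont_def phi_def)
  qed
  then show ?thesis by (simp add: continuous_on_eq_continuous_at)
qed

text \<open>As x phi'(x) = (1 - 2 s) phi(x), an antiderivative is x^(m + 1) phi(x) / (m + 2 - 2 s);
  at 0 its continuity is enough. The result has a simple pole in s, and
  \<open>gamma_quot_line_residue\<close> evaluates the integral over s that it leads to.\<close>

lemma integral_power_phi:
  assumes s: "Re s = 1/4"
  shows "((\<lambda>x. of_real x ^ m * phi s x) has_integral
    ((4 ^ (m + 2) - (- 4) ^ (m + 2)) / 2) / (of_real (real (m + 2) / 2) - s)) {-4..4}"
proof -
  define k where "k = of_nat m + 2 - 2 * s"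
  have "Re k \<noteq> 0" using s by (simp add: k_def)
  then have k: "k \<noteq> 0" by auto
  define F where "F x = of_real x ^ (m + 1) * phi s x / k" for x
  have "((\<lambda>x. of_real x ^ m * phi s x) has_integral (F 4 - F (-4))) {-4..4}"
  proof (rule fundamental_theorem_of_calculus_interior_strong[of "{0}"])
    fix x :: real assume "x \<in> {- 4<..<4} - {0}"
    then have x: "x \<noteq> 0" by simp
    define E where "E = exp (- s * of_real (ln (x\<^sup>2 / 16)))"
    have p: "((\<lambda>x. complex_of_real x ^ (m + 1)) has_vector_derivative of_nat (m + 1) * of_real x ^ m) (at x)"
    proof -
      have "((\<lambda>z::complex. z ^ (m + 1)) has_field_derivative of_nat (m + 1) * of_real x ^ m) (at (of_real x))"
        using DERIV_power_Suc[OF DERIV_ident, of m] by (simp add: algebra_simps)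
      then show ?thesis by (rule has_vector_derivative_real_field)
    qed
    have "((\<lambda>x. of_real x ^ (m + 1) * phi s x) has_vector_derivative
      (of_real x ^ (m + 1) * ((1 - 2 * s) * E) + of_nat (m + 1) * of_real x ^ m * phi s x)) (at x)"
      unfolding E_def by (rule has_vector_derivative_mult[OF p phi_derivative[OF x]])
    then have "((\<lambda>x. (of_real x ^ (m + 1) * phi s x) * (1 / k)) has_vector_derivative
      (of_real x ^ (m + 1) * ((1 - 2 * s) * E) + of_nat (m + 1) * of_real x ^ m * phi s x) * (1 / k)) (at x)"
      by (rule has_vector_derivative_mult_left)
    moreover have "(of_real x ^ (m + 1) * ((1 - 2 * s) * E) + of_nat (m + 1) * of_real x ^ m * phi s x) * (1 / k)
      = of_real x ^ m * phi s x"
    proof -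
      have ph: "phi s x = of_real x * E" by (simp add: phi_def E_def)
      have "of_real x ^ (m + 1) * ((1 - 2 * s) * E) + of_nat (m + 1) * of_real x ^ m * phi s x
          = k * (of_real x ^ m * phi s x)"
        unfolding ph k_def by (simp add: algebra_simps)
      then show ?thesis using k by simp
    qed
    ultimately show "(F has_vector_derivative of_real x ^ m * phi s x) (at x)"
      by (simp add: F_def[abs_def])
  next
    show "continuous_on {- 4..4} F"
      unfolding F_def by (intro continuous_intros continuous_on_subset[OF continuous_phi[OF s]]) (use k in auto)
  qed auto
  moreover have "F 4 - F (-4) = ((4 ^ (m + 2) - (- 4) ^ (m + 2)) / 2) / (of_real (real (m + 2) / 2) - s)"
  proof -
    have "phi s 4 = 4" "phi s (- 4) = - 4" by (simp_all add: phi_def)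
    then have "F 4 - F (-4) = (4 ^ (m + 2) - (- 4) ^ (m + 2)) / k"
      by (simp add: F_def diff_divide_distrib)
    moreover have "k = 2 * (of_real (real (m + 2) / 2) - s)" by (simp add: k_def)
    ultimately show ?thesis by simp
  qed
  ultimately show ?thesis by simp
qed

section \<open>The density\<close>

text \<open>With \<open>G\<close> the Meijer function of the theorem this is \<open>x G(x\<^sup>2 / 16)\<close>: the factor \<open>x\<close> makes it
  continuous at 0, where \<open>G(x\<^sup>2 / 16)\<close> has a logarithmic singularity.\<close>

definition xG :: "real \<Rightarrow> complex" where
  "xG x = 1 / (2 * of_real pi) * (LINT t|lborel. gamma_quot (Complex (1/4) t) * phi (Complex (1/4) t) x)"

lemma xG_meijer_G:
  assumes "x \<noteq> 0"
  shows "xG x = of_real x * meijer_G 2 0 [5/2, 7/2] [0, 1] (of_real (x\<^sup>2 / 16))"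
proof -
  have z: "x\<^sup>2 / 16 > 0" using assms by simp
  have "gamma_quot s * phi s x = of_real x * gamma_quot_powr (x\<^sup>2 / 16) s" for s
    unfolding phi_powr gamma_quot_powr_def by (rule mult.left_commute)
  moreover have "meijer_G 2 0 [5/2, 7/2] [0, 1] (of_real (x\<^sup>2 / 16))
      = 1 / (2 * of_real pi) * (LINT t|lborel. gamma_quot_powr (x\<^sup>2 / 16) (Complex (1/4) t))"
    by (rule meijer_G_eq_line_integral[OF z]) simp
  ultimately show ?thesis
    by (simp only: xG_def integral_mult_right_zero mult.left_commute)
qed

lemma norm_gamma_quot_phi:
  "norm (gamma_quot (Complex (1/4) t) * phi (Complex (1/4) t) x) = norm (gamma_quot (Complex (1/4) t)) * (2 * sqrt \<bar>x\<bar>)"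
  by (simp add: norm_mult norm_phi)

lemma borel_measurable_Complex [measurable]: "Complex c \<in> borel_measurable borel"
  unfolding Complex_eq by measurable

lemma borel_measurable_gamma_quot_line [measurable]: "(\<lambda>t. gamma_quot (Complex (1/4) t)) \<in> borel_measurable borel"
  by (intro borel_measurable_continuous_onI continuous_on_gamma_quot_line) simp

lemma borel_measurable_phi [measurable]:
  "(\<lambda>p. phi (Complex (1/4) (snd p)) (fst p)) \<in> borel_measurable (borel \<Otimes>\<^sub>M borel)"
  unfolding phi_def by measurable

lemma sqrt_abs_le: "x \<in> {-4..4} \<Longrightarrow> 2 * sqrt \<bar>x\<bar> \<le> 4"
proof -
  assume "x \<in> {-4..4}"
  then have "sqrt \<bar>x\<bar> \<le> sqrt (2\<^sup>2)" by (intro real_sqrt_le_mono) auto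
  then show ?thesis by (simp only: real_sqrt_abs)
qed

lemma borel_measurable_phi_line [measurable]:
  "(\<lambda>t. phi (Complex (1/4) t) x) \<in> borel_measurable borel"
  unfolding phi_def by measurable

lemma integrable_gamma_quot_norm: "integrable lborel (\<lambda>t. K * norm (gamma_quot (Complex (1/4) t)))"
  by (intro integrable_mult_right integrable_norm integrable_gamma_quot_line) simp

text \<open>Dominated convergence, the kernel being bounded by 4 on the whole interval.\<close>

lemma continuous_xG: "continuous_on {-4..4} xG"
  unfolding continuous_on_sequentially
proof (intro allI ballI impI, elim conjE)
  fix u and x :: real assume x: "x \<in> {-4..4}" and u: "\<forall>n. u n \<in> {-4..4}" "u \<longlonglongrightarrow> x"
  have "(\<lambda>n. LINT t|lborel. gamma_quot (Complex (1/4) t) * phi (Complex (1/4) t) (u n))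
    \<longlonglongrightarrow> (LINT t|lborel. gamma_quot (Complex (1/4) t) * phi (Complex (1/4) t) x)"
  proof (rule integral_dominated_convergence[where w = "\<lambda>t. 4 * norm (gamma_quot (Complex (1/4) t))"])
    show "AE t in lborel. (\<lambda>n. gamma_quot (Complex (1/4) t) * phi (Complex (1/4) t) (u n))
        \<longlonglongrightarrow> gamma_quot (Complex (1/4) t) * phi (Complex (1/4) t) x"
    proof (intro AE_I2 tendsto_mult tendsto_const)
      fix t :: real
      have "isCont (phi (Complex (1/4) t)) x"
        using continuous_phi[of "Complex (1/4) t"] by (simp add: continuous_on_eq_continuous_at)
      then show "(\<lambda>n. phi (Complex (1/4) t) (u n)) \<longlonglongrightarrow> phi (Complex (1/4) t) x"
        using u(2) by (rule isCont_tendsto_compose)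
    qed
    fix n
    show "AE t in lborel. norm (gamma_quot (Complex (1/4) t) * phi (Complex (1/4) t) (u n))
        \<le> 4 * norm (gamma_quot (Complex (1/4) t))"
    proof (intro AE_I2)
      fix t :: real
      have "2 * sqrt \<bar>u n\<bar> \<le> 4" using u(1) by (intro sqrt_abs_le) auto
      then have "norm (gamma_quot (Complex (1/4) t)) * (2 * sqrt \<bar>u n\<bar>) \<le> norm (gamma_quot (Complex (1/4) t)) * 4"
        by (rule mult_left_mono) simp
      then show "norm (gamma_quot (Complex (1/4) t) * phi (Complex (1/4) t) (u n)) \<le> 4 * norm (gamma_quot (Complex (1/4) t))"
        unfolding norm_gamma_quot_phi by simp
    qed
  qed (use integrable_gamma_quot_norm in measurable)
  then have "(\<lambda>n. xG (u n)) \<longlonglongrightarrow> xG x"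
    unfolding xG_def by (rule tendsto_mult_left)
  then show "(xG \<circ> u) \<longlonglongrightarrow> xG x" by (simp add: o_def)
qed

lemma integral_power_xG:
  "integral {-4..4} (\<lambda>x. of_real x ^ m * xG x) = (4 ^ (m + 2) - (- 4) ^ (m + 2)) / 2 * gamma_quot (of_real (real (m + 2) / 2))"
proof -
  define s where "s = Complex (1/4)"
  define A :: complex where "A = (4 ^ (m + 2) - (- 4) ^ (m + 2)) / 2"
  define k where "k = real (m + 2) / 2"
  have res: "integral {-4..4} (\<lambda>x. of_real x ^ m * phi (s t) x) = A / (of_real k - s t)" for t
    using integral_power_phi[of "s t" m] by (intro integral_unique) (simp add: s_def A_def k_def)
  define f where "f x t = indicator {-4..4} x *\<^sub>R (of_real x ^ m * (gamma_quot (s t) * phi (s t) x))" for x t :: real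
  have meas: "case_prod f \<in> borel_measurable (lborel \<Otimes>\<^sub>M lborel)"
    unfolding f_def case_prod_beta' s_def by measurable
  \<comment> \<open>On this line the modulus of the kernel depends on x alone, so the modulus of
    \<open>f\<close> separates into a function of x and one of t; integrability for Fubini
    follows.\<close>
  have nf: "norm (f x t) = (indicator {-4..4} x * (\<bar>x\<bar> ^ m * (2 * sqrt \<bar>x\<bar>))) * norm (gamma_quot (s t))" for x t
    unfolding f_def s_def norm_scaleR norm_mult[of "_ ^ m"] norm_gamma_quot_phi norm_power norm_of_real
    by (simp add: indicator_def)
  define w where "w x = indicator {-4..4} x * (\<bar>x\<bar> ^ m * (2 * sqrt \<bar>x\<bar>))" for x :: real
  have "set_integrable lborel {-4..4} (\<lambda>x::real. \<bar>x\<bar> ^ m * (2 * sqrt \<bar>x\<bar>))"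
    by (intro borel_integrable_atLeastAtMost' continuous_intros)
  then have w: "integrable lborel w" by (simp add: set_integrable_def w_def[abs_def])
  have int: "integrable (lborel \<Otimes>\<^sub>M lborel) (case_prod f)"
  proof (rule lborel_pair.Fubini_integrable[OF meas])
    have "(LINT t|lborel. norm (case_prod f (x, t))) = w x * (LINT t|lborel. norm (gamma_quot (s t)))" for x
      by (simp add: nf w_def)
    then show "integrable lborel (\<lambda>x. LINT t|lborel. norm (case_prod f (x, t)))"
      using w by simp
    show "AE x in lborel. integrable lborel (\<lambda>t. case_prod f (x, t))"
    proof (intro AE_I2)
      fix x :: real
      have m: "(\<lambda>t. f x t) \<in> borel_measurable lborel"
        unfolding f_def s_def by measurable
      have "integrable lborel (\<lambda>t. w x * norm (gamma_quot (s t)))"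
        unfolding s_def by (rule integrable_gamma_quot_norm)
      then show "integrable lborel (\<lambda>t. case_prod f (x, t))"
        by (rule Bochner_Integration.integrable_bound) (use m in \<open>auto simp: nf w_def abs_mult\<close>)
    qed
  qed
  have inner_x: "(LINT x|lborel. f x t) = gamma_quot (s t) * (A / (of_real k - s t))" for t
  proof -
    have c: "continuous_on {-4..4} (\<lambda>x. of_real x ^ m * phi (s t) x)"
      by (intro continuous_intros continuous_on_subset[OF continuous_phi]) (auto simp: s_def)
    have "(LINT x|lborel. f x t) = (LINT x|lborel. gamma_quot (s t) * (indicator {-4..4} x *\<^sub>R (of_real x ^ m * phi (s t) x)))"
      unfolding f_def by (intro Bochner_Integration.integral_cong refl) (simp add: mult_ac scaleR_conv_of_real)
    also have "\<dots> = gamma_quot (s t) * (LBINT x:{-4..4}. of_real x ^ m * phi (s t) x)"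
      unfolding set_lebesgue_integral_def by (rule integral_mult_right_zero)
    also have "(LBINT x:{-4..4}. of_real x ^ m * phi (s t) x) = A / (of_real k - s t)"
      using set_borel_integral_eq_integral(2)[OF borel_integrable_atLeastAtMost'[OF c]] by (simp add: res)
    finally show ?thesis .
  qed
  have inner_t: "(LINT t|lborel. f x t) = 2 * of_real pi * (indicator {-4..4} x *\<^sub>R (of_real x ^ m * xG x))" for x
  proof -
    have "(LINT t|lborel. f x t)
        = (LINT t|lborel. (of_real (indicator {-4..4} x) * of_real x ^ m) * (gamma_quot (s t) * phi (s t) x))"
      unfolding f_def by (simp only: scaleR_conv_of_real mult.assoc)
    also have "\<dots> = of_real (indicator {-4..4} x) * of_real x ^ m * (LINT t|lborel. gamma_quot (s t) * phi (s t) x)"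
      by (rule integral_mult_right_zero)
    finally show ?thesis by (simp add: xG_def s_def scaleR_conv_of_real)
  qed
  have k: "1/4 < k" by (simp add: k_def)
  have c: "continuous_on {-4..4} (\<lambda>x. of_real x ^ m * xG x)"
    by (intro continuous_intros continuous_xG)
  have "2 * of_real pi * integral {-4..4} (\<lambda>x. of_real x ^ m * xG x)
      = 2 * of_real pi * (LBINT x:{-4..4}. of_real x ^ m * xG x)"
    using set_borel_integral_eq_integral(2)[OF borel_integrable_atLeastAtMost'[OF c]] by simp
  also have "\<dots> = (LINT x|lborel. LINT t|lborel. f x t)"
    unfolding inner_t set_lebesgue_integral_def by (rule integral_mult_right_zero[symmetric])
  also have "\<dots> = (LINT t|lborel. LINT x|lborel. f x t)"
    by (rule lborel_pair.Fubini_integral[OF int, symmetric])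
  also have "\<dots> = (LINT t|lborel. A * (gamma_quot (s t) / (of_real k - s t)))"
    unfolding inner_x by (simp only: times_divide_eq_right mult.commute)
  also have "\<dots> = A * (LINT t|lborel. gamma_quot (s t) / (of_real k - s t))"
    by (rule integral_mult_right_zero)
  also have "(LINT t|lborel. gamma_quot (s t) / (of_real k - s t)) = 2 * of_real pi * gamma_quot (of_real k)"
    unfolding s_def by (rule gamma_quot_line_residue(2)[OF _ k]) simp
  finally have "2 * of_real pi * integral {-4..4} (\<lambda>x. of_real x ^ m * xG x)
      = 2 * of_real pi * (A * gamma_quot (of_real k))" by (simp add: mult_ac)
  moreover have "2 * complex_of_real pi \<noteq> 0" by simp
  ultimately have "integral {-4..4} (\<lambda>x. of_real x ^ m * xG x) = A * gamma_quot (of_real k)"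
    by (metis mult_left_cancel)
  then show ?thesis unfolding A_def k_def .
qed

text \<open>By Weierstrass h lies within e of a polynomial p, and p is orthogonal to h. So the
  integral of h^2 equals that of (h - p) h and is at most e times that of |h|, for every e >
  0.\<close>

lemma continuous_zero_moments:
  fixes h :: "real \<Rightarrow> real"
  assumes ab: "a < b" and h: "continuous_on {a..b} h" and mom: "\<And>j. integral {a..b} (\<lambda>x. x ^ j * h x) = 0"
    and x: "x \<in> {a..b}"
  shows "h x = 0"
proof -
  define B where "B = integral {a..b} (\<lambda>x. \<bar>h x\<bar>)"
  have le: "integral {a..b} (\<lambda>x. h x * h x) \<le> e * B" if e: "e > 0" for e
  proof -
    obtain p where p: "real_polynomial_function p" "\<And>x. x \<in> {a..b} \<Longrightarrow> \<bar>h x - p x\<bar> < e"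
      using Stone_Weierstrass_real_polynomial_function[OF compact_Icc h e] by blast
    obtain q n where q: "p = (\<lambda>x. \<Sum>i\<le>n. q i * x ^ i)"
      using p(1) unfolding real_polynomial_function_iff_sum by blast
    have cp: "continuous_on {a..b} p" unfolding q by (intro continuous_intros)
    have "integral {a..b} (\<lambda>x. p x * h x) = integral {a..b} (\<lambda>x. \<Sum>i\<le>n. q i * (x ^ i * h x))"
      unfolding q by (simp add: sum_distrib_right mult.assoc)
    also have "\<dots> = (\<Sum>i\<le>n. integral {a..b} (\<lambda>x. q i * (x ^ i * h x)))"
      by (intro integral_sum integrable_continuous_real continuous_intros h) auto
    also have "\<dots> = 0" using mom by simp
    finally have 0: "integral {a..b} (\<lambda>x. p x * h x) = 0" .
    have "integral {a..b} (\<lambda>x. h x * h x) = integral {a..b} (\<lambda>x. (h x - p x) * h x + p x * h x)"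
      by (simp add: algebra_simps)
    also have "\<dots> = integral {a..b} (\<lambda>x. (h x - p x) * h x)"
      by (subst Henstock_Kurzweil_Integration.integral_add)
         (auto intro!: integrable_continuous_real continuous_intros h cp simp: 0)
    also have "\<dots> \<le> integral {a..b} (\<lambda>x. e * \<bar>h x\<bar>)"
    proof (rule integral_le)
      fix x assume "x \<in> {a..b}"
      then have "\<bar>h x - p x\<bar> * \<bar>h x\<bar> \<le> e * \<bar>h x\<bar>"
        using p(2)[of x] by (intro mult_right_mono) auto
      then show "(h x - p x) * h x \<le> e * \<bar>h x\<bar>"
        using abs_ge_self[of "(h x - p x) * h x"] by (simp only: abs_mult)
    qed (auto intro!: integrable_continuous_real continuous_intros h cp)
    finally show ?thesis by (simp add: B_def)
  qed
  have "integral {a..b} (\<lambda>x. h x * h x) \<le> 0"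
  proof (rule field_le_epsilon)
    fix e :: real assume e: "e > 0"
    have B: "B \<ge> 0" unfolding B_def
      by (rule integral_nonneg) (auto intro!: integrable_continuous_real continuous_intros h)
    have "e / (B + 1) * B \<le> e" using e B by (simp add: field_simps)
    then show "integral {a..b} (\<lambda>x. h x * h x) \<le> 0 + e"
      using le[of "e / (B + 1)"] e B by simp
  qed
  moreover have "integral {a..b} (\<lambda>x. h x * h x) \<ge> 0"
    by (rule integral_nonneg) (auto intro!: integrable_continuous_real continuous_intros h)
  moreover have c: "continuous_on (cbox a b) (\<lambda>x. h x * h x)"
    unfolding cbox_interval by (intro continuous_intros h)
  ultimately have "((\<lambda>x. h x * h x) has_integral 0) (cbox a b)"
    using integrable_integral[OF integrable_continuous[OF c]] by simp
  then have "h x * h x = 0"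
    using c ab x by (intro has_integral_0_cbox_imp_0[of a b "\<lambda>x. h x * h x"]) auto
  then show ?thesis by simp
qed

section \<open>Comparison of the moments of the trace and of the Meijer function\<close>

context haar_USp4
begin

text \<open>For a >= 1 the part after 6 / pi is \<open>integral_power_xG\<close> at m = a - 1, but
  the formula also makes sense at a = 0, where the induction starts. The power difference vanishes
  for odd a; for even a the induction goes in steps of two.\<close>

lemma moment_eq_gamma_quot:
  "moment a = of_real (6 / pi) * ((4 ^ (a + 1) - (- 4) ^ (a + 1)) / 2 * gamma_quot (of_real (real (a + 1) / 2)))"
proof (cases "even a")
  case False
  then show ?thesis using moment_odd[OF False] by simp
next
  case True
  define N :: "nat \<Rightarrow> complex" where "N a = of_real (6 / pi) * (4 ^ (a + 1) * gamma_quot (of_real (real (a + 1) / 2)))" for a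
  have N0: "N 0 = 1"
  proof -
    have g1: "Gamma (1/2 + 1 :: complex) = 1/2 * of_real (sqrt pi)"
      using Gamma_plus1[of "1/2 :: complex"] nonpos_Ints_ReIm(1)[of "1/2"] Gamma_one_half_complex by auto
    have g2: "Gamma (3 :: complex) = 2" "Gamma (4 :: complex) = 6"
      using Gamma_fact[of 2, where 'a = complex] Gamma_fact[of 3, where 'a = complex]
      by (simp_all add: fact_numeral)
    have "gamma_quot (1/2) = of_real (sqrt pi) * (1/2 * of_real (sqrt pi)) / (2 * 6)"
      unfolding gamma_quot_def Gamma_one_half_complex g1 using g2 by simp
    also have "\<dots> = of_real (sqrt pi * sqrt pi) / 24" by (simp only: of_real_mult) simp
    also have "\<dots> = of_real pi / 24" by simp
    finally have "gamma_quot (1/2) = of_real pi / 24" .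
    then show ?thesis by (simp add: N_def mult.commute)
  qed
  have Nrec: "of_nat ((a + 6) * (a + 8)) * N (a + 2) = of_nat (16 * (a + 1) * (a + 3)) * N a" for a
  proof -
    define s :: complex where "s = of_real (real (a + 1) / 2)"
    have s1: "of_real (real (a + 2 + 1) / 2) = s + 1" by (simp add: s_def field_simps)
    have "Re s > 0" by (simp add: s_def)
    then have rec: "gamma_quot s = gamma_quot (s + 1) * ((s + 5/2) / s * ((s + 7/2) / (s + 1)))"
      by (intro gamma_quot_plus1) simp
    have nat: "of_nat (a + 1) = 2 * s" "of_nat (a + 3) = 2 * (s + 1)" "of_nat (a + 6) = 2 * (s + 5/2)"
      "of_nat (a + 8) = 2 * (s + 7/2)"
      by (simp_all add: s_def field_simps)
    have nz: "s \<noteq> 0" "s + 1 \<noteq> 0"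
      using \<open>Re s > 0\<close> by (auto simp: complex_eq_iff)
    have rec': "s * (s + 1) * gamma_quot s = (s + 5/2) * (s + 7/2) * gamma_quot (s + 1)"
      unfolding rec using nz by simp
    have "of_nat (a + 1) * of_nat (a + 3) * gamma_quot s = of_nat (a + 6) * of_nat (a + 8) * gamma_quot (s + 1)"
    proof -
      have four: "4 * (p * q * r) = 2 * p * (2 * q) * r" for p q r :: complex by simp
      have "2 * s * (2 * (s + 1)) * gamma_quot s = 4 * (s * (s + 1) * gamma_quot s)" by (rule four[symmetric])
      also have "\<dots> = 4 * ((s + 5/2) * (s + 7/2) * gamma_quot (s + 1))" by (simp only: rec')
      also have "\<dots> = 2 * (s + 5/2) * (2 * (s + 7/2)) * gamma_quot (s + 1)" by (rule four)
      finally show ?thesis unfolding nat .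
    qed
    moreover have "(4::complex) ^ (a + 2 + 1) = 16 * 4 ^ (a + 1)" by simp
    moreover have "p * q * (c * (16 * u * y)) = 16 * c * u * (p * q * y)"
      "16 * p * q * (c * (u * x)) = 16 * c * u * (p * q * x)" for p q c u x y :: complex
      by simp_all
    ultimately show ?thesis
      unfolding N_def s1 s_def[symmetric] of_nat_mult of_nat_numeral by (simp only:)
  qed
  have "moment (2 * n) = N (2 * n)" for n
  proof (induction n)
    case 0
    show ?case using moment_0 N0 by simp
  next
    case (Suc n)
    have "of_nat ((2 * n + 6) * (2 * n + 8)) * moment (2 * n + 2) = of_nat ((2 * n + 6) * (2 * n + 8)) * N (2 * n + 2)"
      unfolding moment_rec Nrec Suc.IH ..
    moreover have "(of_nat ((2 * n + 6) * (2 * n + 8)) :: complex) \<noteq> 0"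
      unfolding of_nat_eq_0_iff by simp
    ultimately have "moment (2 * n + 2) = N (2 * n + 2)" by (metis mult_left_cancel)
    then show ?case by simp
  qed
  then have "moment a = N a" using True by (metis evenE)
  moreover have "(4 ^ (a + 1) - (- 4) ^ (a + 1)) / 2 = (4 :: complex) ^ (a + 1)"
    using True by simp
  ultimately show ?thesis by (simp only: N_def)
qed

lemma moment_density:
  assumes "continuous_trace_density M f"
  shows "integral {-4..4} (\<lambda>x. of_real x ^ a * of_real (f x)) = moment a"
proof -
  have cf: "continuous_on {-4..4} f" using assms by (simp add: continuous_trace_density_def)
  have c: "continuous_on {-4..4} (\<lambda>x. x ^ a * f x)" by (intro continuous_intros cf)
  have "moment a = (LINT m|M. of_real (tau m ^ a))"
    unfolding moment_def
    by (intro Bochner_Integration.integral_cong refl) (simp add: space_M of_real_tau)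
  also have "\<dots> = of_real (LINT m|M. tau m ^ a)" by (rule integral_complex_of_real)
  also have "(LINT m|M. tau m ^ a) = (LBINT x:{-4..4}. x ^ a * f x)"
    using assms unfolding continuous_trace_density_def by (auto intro!: continuous_intros)
  also have "\<dots> = integral {-4..4} (\<lambda>x. x ^ a * f x)"
    by (rule set_borel_integral_eq_integral(2)[OF borel_integrable_atLeastAtMost'[OF c]])
  also have "complex_of_real \<dots> = integral {-4..4} (\<lambda>x. of_real (x ^ a * f x))"
    using integral_linear[OF integrable_continuous_real[OF c] bounded_linear_of_real[where 'a = complex]]
    by (simp add: o_def)
  finally show ?thesis by simp
qed

text \<open>Moment j of the difference \<open>h\<close> involves moment j + 1 of f, so all moments
  of \<open>h\<close> vanish. Real and imaginary parts are treated separately because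
  \<open>xG\<close> is a priori complex; that G is real comes out as a by-product. Dividing by x at
  the end uses x nonzero.\<close>

lemma density_eq_meijer_G:
  assumes f: "continuous_trace_density M f" and x: "0 < \<bar>x\<bar>" "\<bar>x\<bar> < 4"
  shows "complex_of_real (f x) = of_real (6 / pi) * meijer_G 2 0 [5/2, 7/2] [0, 1] (of_real (x\<^sup>2 / 16))"
proof -
  have cf: "continuous_on {-4..4} f" using f by (simp add: continuous_trace_density_def)
  define h where "h x = of_real x * of_real (f x) - of_real (6 / pi) * xG x" for x
  have ch: "continuous_on {-4..4} h"
    unfolding h_def by (intro continuous_intros continuous_xG cf)
  have mom: "integral {-4..4} (\<lambda>x. of_real x ^ j * h x) = 0" for j
  proof -
    have "integral {-4..4} (\<lambda>x. of_real x ^ j * h x)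
      = integral {-4..4} (\<lambda>x. of_real x ^ (j + 1) * of_real (f x) - of_real (6 / pi) * (of_real x ^ j * xG x))"
      by (simp add: h_def algebra_simps)
    also have "\<dots> = integral {-4..4} (\<lambda>x. of_real x ^ (j + 1) * of_real (f x))
        - of_real (6 / pi) * integral {-4..4} (\<lambda>x. of_real x ^ j * xG x)"
      unfolding integral_mult_right[symmetric]
      by (intro Henstock_Kurzweil_Integration.integral_diff integrable_continuous_real continuous_intros cf continuous_xG)
    also have "\<dots> = 0"
      unfolding moment_density[OF f] integral_power_xG moment_eq_gamma_quot by simp
    finally show ?thesis .
  qed
  have x4: "x \<in> {-4..4}" using x by auto
  have ih: "(\<lambda>x. of_real x ^ j * h x) integrable_on {-4..4}" for j
    by (intro integrable_continuous_real continuous_intros ch)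
  have re: "Re (of_real x ^ j * h x) = x ^ j * Re (h x)" and im: "Im (of_real x ^ j * h x) = x ^ j * Im (h x)" for j x
    by (simp_all flip: of_real_power)
  have "Re (h x) = 0"
  proof (rule continuous_zero_moments[OF _ _ _ x4, of "\<lambda>x. Re (h x)"])
    show "integral {-4..4} (\<lambda>x. x ^ j * Re (h x)) = 0" for j
      using integral_linear[OF ih bounded_linear_Re, of j] by (simp add: o_def re mom)
  qed (use ch in \<open>auto intro!: continuous_intros\<close>)
  moreover have "Im (h x) = 0"
  proof (rule continuous_zero_moments[OF _ _ _ x4, of "\<lambda>x. Im (h x)"])
    show "integral {-4..4} (\<lambda>x. x ^ j * Im (h x)) = 0" for j
      using integral_linear[OF ih bounded_linear_Im, of j] by (simp add: o_def im mom)
  qed (use ch in \<open>auto intro!: continuous_intros\<close>)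
  ultimately have "h x = 0" by (simp add: complex_eq_iff)
  moreover have "x \<noteq> 0" using x by simp
  ultimately show ?thesis
    by (simp add: h_def xG_meijer_G mult.left_commute[of _ "of_real x"] del: of_real_divide)
qed

end

theorem corollary5p7:
  fixes dm :: "(complex^4^4) measure" and f_tau :: "real \<Rightarrow> real"
  assumes "normalized_haar_measure USp4 dm"
    and "continuous_trace_density dm f_tau"
  shows "(\<forall>x::real. 0 < \<bar>x\<bar> \<and> \<bar>x\<bar> < 4 \<longrightarrow>
            complex_of_real (f_tau x) =
              of_real (6 / pi) * meijer_G 2 0 [5/2, 7/2] [0, 1] (of_real (x\<^sup>2 / 16))) \<and>
         (\<forall>(z::real) (c::real). 0 < z \<and> z < 1 \<and> 0 < c \<and> c < 1/2 \<longrightarrow>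
            (let F = (\<lambda>s::complex. Gamma s * Gamma (s + 1) /
                        (Gamma (s + 5/2) * Gamma (s + 7/2)) * of_real z powr (- s))
             in line_integrable F (vertical_line c) \<and>
                meijer_G 2 0 [5/2, 7/2] [0, 1] (of_real z) =
                  1 / (2 * \<i> * of_real pi) * line_integral F (vertical_line c)))"
proof (intro conjI allI impI)
  interpret haar_USp4 dm by unfold_locales (rule assms(1))
  fix x :: real assume "0 < \<bar>x\<bar> \<and> \<bar>x\<bar> < 4"
  then show "complex_of_real (f_tau x) =
      of_real (6 / pi) * meijer_G 2 0 [5/2, 7/2] [0, 1] (of_real (x\<^sup>2 / 16))"
    using density_eq_meijer_G[OF assms(2)] by blast
next
  fix z c :: real assume "0 < z \<and> z < 1 \<and> 0 < c \<and> c < 1/2"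
  then have z: "z > 0" and c: "c > 0" by auto
  have F: "(\<lambda>s. Gamma s * Gamma (s + 1) / (Gamma (s + 5/2) * Gamma (s + 7/2)) * of_real z powr (- s)) = gamma_quot_powr z"
    by (simp only: gamma_quot_powr_def[abs_def] gamma_quot_def)
  have "line_integral (gamma_quot_powr z) (vertical_line c) = \<i> * (LINT t|lborel. gamma_quot_powr z (Complex c t))"
    unfolding line_integral_def
    using has_line_integral_gamma_quot_powr[OF c z] by (simp add: has_line_integral_def integral_unique)
  then show "let F = (\<lambda>s::complex. Gamma s * Gamma (s + 1) /
                        (Gamma (s + 5/2) * Gamma (s + 7/2)) * of_real z powr (- s))
             in line_integrable F (vertical_line c) \<and>
                meijer_G 2 0 [5/2, 7/2] [0, 1] (of_real z) =
                  1 / (2 * \<i> * of_real pi) * line_integral F (vertical_line c)"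
    unfolding Let_def F using has_line_integral_gamma_quot_powr[OF c z]
    by (auto simp: line_integrable_def meijer_G_eq_line_integral[OF z c])
qed

end
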